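(* Let $G$ be a simple complex Lie group with Lie algebra $\mathfrak g$, let $F=\mathbb C[G]$, and let $\lambda\in\mathfrak h^*$ be such that the Verma module $M(\lambda)$ is irreducible. Then for all $\varphi,\psi\in\mathrm{Hom}_{\mathfrak g}(M(\lambda),M(\lambda)\otimes F)$, $$f_{\varphi*\psi}=(m\circ\overrightarrow{J(\lambda)})(f_\varphi\otimes f_\psi),$$ where $J(\lambda)$ is the universal dynamical twist and $m$ is the multiplication in $F$.
   Context: $F=\mathbb C[G]$ is the algebra of polynomial functions on $G$ (generated by matrix elements of finite dimensional representations), a $U\mathfrak g$-module algebra via $(a,f)\mapsto\overrightarrow af$, where $\overrightarrow a$ is the left-invariant differential operator corresponding to $a\in U\mathfrak g$; as a $\mathfrak g$-module, $F$ is a direct sum of finite dimensional modules. $H\subset G$ is a Cartan subgroup, $\mathfrak h=\mathrm{Lie}\,H$, $\mathfrak g=\mathfrak n_+\oplus\mathfrak h\oplus\mathfrak n_-$ is a triangular decomposition, $\mathfrak b_\pm=\mathfrak h\oplus\mathfrak n_\pm$. $V[\mu]$ is the subspace of weight vectors of weight $\mu$ in a $\mathfrak g$-module $V$; in particular $F[0]=\{f\in F:\overrightarrow hf=0\ \text{for all } h\in\mathfrak h\}$. $M(\lambda)$ is the Verma module with highest weight $\lambda$ and highest weight vector $\mathbb I_\lambda$. For a $\mathfrak g$-module $M$, $\mathrm{Hom}_{\mathfrak g}(M,M\otimes F)$ is an associative algebra under $\varphi*\psi=(\mathrm{id}\otimes m)\circ(\varphi\otimes\mathrm{id})\circ\psi$.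 For $V=F$ or $V$ a finite dimensional $\mathfrak g$-module and $\varphi\in\mathrm{Hom}_{\mathfrak g}(M(\lambda),M(\lambda)\otimes V)$, the element $f_\varphi\in V[0]$ (the leading term of $\varphi$) is defined by $\varphi(\mathbb I_\lambda)=\mathbb I_\lambda\otimes f_\varphi+\sum_{\mu<\lambda}v_\mu\otimes f_\mu$ with $v_\mu\in M(\lambda)[\mu]$. The universal dynamical twist $J(\lambda)\in 1\otimes1+(\mathfrak n_-\cdot U\mathfrak n_-)\widehat\otimes(U\mathfrak b_+\cdot\mathfrak n_+)$, whose coefficients are rational functions of $\lambda$, is the universal series such that for all finite dimensional $\mathfrak g$-modules $V,W$ and all $\varphi\in\mathrm{Hom}_{\mathfrak g}(M(\lambda),M(\lambda)\otimes V)$, $\psi\in\mathrm{Hom}_{\mathfrak g}(M(\lambda),M(\lambda)\otimes W)$, the leading term of $(\varphi\otimes\mathrm{id})\circ\psi:M(\lambda)\to M(\lambda)\otimes V\otimes W$ equals $J(\lambda)_{V\otimes W}(f_\varphi\otimes f_\psi)$. $\overrightarrow{J(\lambda)}$ denotes the factorwise action of $J(\lambda)$ by left-invariant differential operators on functions from $F$. *)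

theory Defs
  imports "HOL-Analysis.Analysis" "HOL-Algebra.QuotRing" "HOL-Algebra.Module"
begin

section \<open>Complex vector spaces, quotients and tensor products\<close>

text \<open>
  Vector spaces are modules, in the sense of \<open>HOL-Algebra\<close>, over the ring record of the complex
  numbers.  The fields \<^const>\<open>mult\<close> and \<^const>\<open>one\<close> of a module record carry no meaning unless
  the space is an algebra.
\<close>

definition complex_ring :: "complex ring" where
  "complex_ring = \<lparr>carrier = UNIV, mult = (*), one = 1, zero = 0, add = (+)\<rparr>"

definition lin_span :: "(complex, 'v, 'm) module_scheme \<Rightarrow> 'v set \<Rightarrow> 'v set" where
  "lin_span V S = \<Inter> {N. submodule N complex_ring V \<and> S \<subseteq> N}"

definition finite_dim :: "(complex, 'v, 'm) module_scheme \<Rightarrow> bool" where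
  "finite_dim V \<longleftrightarrow> (\<exists>S. finite S \<and> S \<subseteq> carrier V \<and> lin_span V S = carrier V)"

definition linear_maps ::
  "(complex, 'v, 'm) module_scheme \<Rightarrow> (complex, 'w, 'n) module_scheme \<Rightarrow> ('v \<Rightarrow> 'w) set" where
  "linear_maps V W =
     {f \<in> carrier V \<rightarrow> carrier W.
        (\<forall>v\<in>carrier V. \<forall>v'\<in>carrier V. f (v \<oplus>\<^bsub>V\<^esub> v') = f v \<oplus>\<^bsub>W\<^esub> f v') \<and>
        (\<forall>c. \<forall>v\<in>carrier V. f (c \<odot>\<^bsub>V\<^esub> v) = c \<odot>\<^bsub>W\<^esub> f v)}"

definition quotient :: "(complex, 'v, 'm) module_scheme \<Rightarrow> 'v set \<Rightarrow> (complex, 'v set) module" where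
  "quotient V N =
     ring.extend (V Quot N) (module.fields (\<lambda>c X. \<Union>x\<in>X. N +>\<^bsub>V\<^esub> (c \<odot>\<^bsub>V\<^esub> x)))"

definition delta :: "'s \<Rightarrow> 's \<Rightarrow> complex" where
  "delta p = (\<lambda>q. if q = p then 1 else 0)"

definition free_space :: "'s set \<Rightarrow> (complex, 's \<Rightarrow> complex) module" where
  "free_space S =
     \<lparr>carrier = {t. finite {p. t p \<noteq> 0} \<and> {p. t p \<noteq> 0} \<subseteq> S},
      mult = undefined, one = undefined, zero = (\<lambda>_. 0),
      add = (\<lambda>s t p. s p + t p), smult = (\<lambda>c t p. c * t p)\<rparr>"

definition tensor_relations ::
  "(complex, 'v, 'm) module_scheme \<Rightarrow> (complex, 'w, 'n) module_scheme \<Rightarrow> ('v \<times> 'w \<Rightarrow> complex) set" where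
  "tensor_relations V W =
     {\<lambda>p. delta (v \<oplus>\<^bsub>V\<^esub> v', w) p - delta (v, w) p - delta (v', w) p | v v' w.
        v \<in> carrier V \<and> v' \<in> carrier V \<and> w \<in> carrier W} \<union>
     {\<lambda>p. delta (v, w \<oplus>\<^bsub>W\<^esub> w') p - delta (v, w) p - delta (v, w') p | v w w'.
        v \<in> carrier V \<and> w \<in> carrier W \<and> w' \<in> carrier W} \<union>
     {\<lambda>p. delta (c \<odot>\<^bsub>V\<^esub> v, w) p - c * delta (v, w) p | c v w.
        v \<in> carrier V \<and> w \<in> carrier W} \<union>
     {\<lambda>p. delta (v, c \<odot>\<^bsub>W\<^esub> w) p - c * delta (v, w) p | c v w.
        v \<in> carrier V \<and> w \<in> carrier W}"

definition tensor_null ::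
  "(complex, 'v, 'm) module_scheme \<Rightarrow> (complex, 'w, 'n) module_scheme \<Rightarrow> ('v \<times> 'w \<Rightarrow> complex) set" where
  "tensor_null V W = lin_span (free_space (carrier V \<times> carrier W)) (tensor_relations V W)"

definition tensor ::
  "(complex, 'v, 'm) module_scheme \<Rightarrow> (complex, 'w, 'n) module_scheme \<Rightarrow>
   (complex, ('v \<times> 'w \<Rightarrow> complex) set) module" where
  "tensor V W = quotient (free_space (carrier V \<times> carrier W)) (tensor_null V W)"

definition pure ::
  "(complex, 'v, 'm) module_scheme \<Rightarrow> (complex, 'w, 'n) module_scheme \<Rightarrow>
   'v \<Rightarrow> 'w \<Rightarrow> ('v \<times> 'w \<Rightarrow> complex) set" where
  "pure V W v w = tensor_null V W +>\<^bsub>free_space (carrier V \<times> carrier W)\<^esub> delta (v, w)"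

text \<open>
  The linear map on a tensor product induced by a bilinear map \<open>\<beta>\<close> with values in \<open>Z\<close>.  It is computed
  on an arbitrary representative of the coset, and used only for bilinear \<open>\<beta>\<close>, where the choice is
  immaterial.
\<close>

definition tensor_lift ::
  "(complex, 'z, 'm) module_scheme \<Rightarrow> ('v \<Rightarrow> 'w \<Rightarrow> 'z) \<Rightarrow> ('v \<times> 'w \<Rightarrow> complex) set \<Rightarrow> 'z" where
  "tensor_lift Z \<beta> X =
     (let t = (SOME t. t \<in> X)
      in \<Oplus>\<^bsub>Z\<^esub> p \<in> {p. t p \<noteq> 0}. t p \<odot>\<^bsub>Z\<^esub> \<beta> (fst p) (snd p))"

definition tensor_map ::
  "(complex, 'v1, 'm) module_scheme \<Rightarrow> (complex, 'w1, 'n) module_scheme \<Rightarrow>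
   ('v \<Rightarrow> 'v1) \<Rightarrow> ('w \<Rightarrow> 'w1) \<Rightarrow>
   ('v \<times> 'w \<Rightarrow> complex) set \<Rightarrow> ('v1 \<times> 'w1 \<Rightarrow> complex) set" where
  "tensor_map V' W' f g = tensor_lift (tensor V' W') (\<lambda>v w. pure V' W' (f v) (g w))"

definition tensor_assoc ::
  "(complex, 'a, 'm) module_scheme \<Rightarrow> (complex, 'b, 'n) module_scheme \<Rightarrow>
   (complex, 'c, 'o) module_scheme \<Rightarrow>
   (('a \<times> 'b \<Rightarrow> complex) set \<times> 'c \<Rightarrow> complex) set \<Rightarrow>
   ('a \<times> ('b \<times> 'c \<Rightarrow> complex) set \<Rightarrow> complex) set" where
  "tensor_assoc A B C =
     tensor_lift (tensor A (tensor B C))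
       (\<lambda>T c. tensor_lift (tensor A (tensor B C)) (\<lambda>a b. pure A (tensor B C) a (pure B C b c)) T)"


section \<open>Lie algebras and their modules\<close>

record 'x lie_algebra = "(complex, 'x) module" +
  bracket :: "'x \<Rightarrow> 'x \<Rightarrow> 'x"

definition is_lie_algebra :: "('x, 'e) lie_algebra_scheme \<Rightarrow> bool" where
  "is_lie_algebra L \<longleftrightarrow>
     module complex_ring L \<and>
     (\<forall>x\<in>carrier L. bracket L x \<in> linear_maps L L) \<and>
     (\<forall>y\<in>carrier L. (\<lambda>x. bracket L x y) \<in> linear_maps L L) \<and>
     (\<forall>x\<in>carrier L. bracket L x x = \<zero>\<^bsub>L\<^esub>) \<and>
     (\<forall>x\<in>carrier L. \<forall>y\<in>carrier L. \<forall>z\<in>carrier L.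
        bracket L x (bracket L y z) \<oplus>\<^bsub>L\<^esub> bracket L y (bracket L z x)
          \<oplus>\<^bsub>L\<^esub> bracket L z (bracket L x y) = \<zero>\<^bsub>L\<^esub>)"

definition lie_ideal :: "('x, 'e) lie_algebra_scheme \<Rightarrow> 'x set \<Rightarrow> bool" where
  "lie_ideal L I \<longleftrightarrow> submodule I complex_ring L \<and> (\<forall>x\<in>carrier L. \<forall>y\<in>I. bracket L x y \<in> I)"

definition simple_lie_algebra :: "('x, 'e) lie_algebra_scheme \<Rightarrow> bool" where
  "simple_lie_algebra L \<longleftrightarrow>
     is_lie_algebra L \<and>
     (\<exists>x\<in>carrier L. \<exists>y\<in>carrier L. bracket L x y \<noteq> \<zero>\<^bsub>L\<^esub>) \<and>
     (\<forall>I. lie_ideal L I \<longrightarrow> I = {\<zero>\<^bsub>L\<^esub>} \<or> I = carrier L)"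

definition lie_subalgebra :: "('x, 'e) lie_algebra_scheme \<Rightarrow> 'x set \<Rightarrow> bool" where
  "lie_subalgebra L K \<longleftrightarrow> submodule K complex_ring L \<and> (\<forall>x\<in>K. \<forall>y\<in>K. bracket L x y \<in> K)"

definition nilpotent_subalgebra :: "('x, 'e) lie_algebra_scheme \<Rightarrow> 'x set \<Rightarrow> bool" where
  "nilpotent_subalgebra L K \<longleftrightarrow>
     lie_subalgebra L K \<and>
     (\<exists>n. \<forall>xs\<in>lists K. \<forall>y\<in>K. length xs = n \<longrightarrow> foldr (bracket L) xs y = \<zero>\<^bsub>L\<^esub>)"

definition cartan_subalgebra :: "('x, 'e) lie_algebra_scheme \<Rightarrow> 'x set \<Rightarrow> bool" where
  "cartan_subalgebra L \<hh> \<longleftrightarrow>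
     nilpotent_subalgebra L \<hh> \<and>
     {x \<in> carrier L. \<forall>t\<in>\<hh>. bracket L x t \<in> \<hh>} = \<hh>"

text \<open>Linear forms on a subspace \<open>\<hh>\<close>, extended by zero outside \<open>\<hh>\<close>.\<close>

definition dual :: "('x, 'e) lie_algebra_scheme \<Rightarrow> 'x set \<Rightarrow> ('x \<Rightarrow> complex) set" where
  "dual L \<hh> =
     {\<Lambda>. (\<forall>x. x \<notin> \<hh> \<longrightarrow> \<Lambda> x = 0) \<and>
         (\<forall>s\<in>\<hh>. \<forall>t\<in>\<hh>. \<Lambda> (s \<oplus>\<^bsub>L\<^esub> t) = \<Lambda> s + \<Lambda> t) \<and>
         (\<forall>c. \<forall>t\<in>\<hh>. \<Lambda> (c \<odot>\<^bsub>L\<^esub> t) = c * \<Lambda> t)}"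

definition root_space ::
  "('x, 'e) lie_algebra_scheme \<Rightarrow> 'x set \<Rightarrow> ('x \<Rightarrow> complex) \<Rightarrow> 'x set" where
  "root_space L \<hh> \<alpha> = {x \<in> carrier L. \<forall>t\<in>\<hh>. bracket L t x = \<alpha> t \<odot>\<^bsub>L\<^esub> x}"

definition roots :: "('x, 'e) lie_algebra_scheme \<Rightarrow> 'x set \<Rightarrow> ('x \<Rightarrow> complex) set" where
  "roots L \<hh> = {\<alpha> \<in> dual L \<hh>. \<alpha> \<noteq> (\<lambda>_. 0) \<and> root_space L \<hh> \<alpha> \<noteq> {\<zero>\<^bsub>L\<^esub>}}"

text \<open>
  A choice of positive roots: those taking positive values at a regular element of the real form of
  the Cartan subalgebra on which all roots are real.
\<close>

definition positive_system ::
  "('x, 'e) lie_algebra_scheme \<Rightarrow> 'x set \<Rightarrow> ('x \<Rightarrow> complex) set \<Rightarrow> bool" where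
  "positive_system L \<hh> P \<longleftrightarrow>
     (\<exists>t\<in>\<hh>. (\<forall>\<alpha>\<in>roots L \<hh>. \<alpha> t \<in> \<real> \<and> \<alpha> t \<noteq> 0) \<and> P = {\<alpha> \<in> roots L \<hh>. Re (\<alpha> t) > 0})"

definition triangular_decomposition ::
  "('x, 'e) lie_algebra_scheme \<Rightarrow> 'x set \<Rightarrow> 'x set \<Rightarrow> 'x set \<Rightarrow> bool" where
  "triangular_decomposition L \<hh> np nm \<longleftrightarrow>
     (\<exists>P. positive_system L \<hh> P \<and>
          np = lin_span L (\<Union>\<alpha>\<in>P. root_space L \<hh> \<alpha>) \<and>
          nm = lin_span L (\<Union>\<alpha>\<in>P. root_space L \<hh> (\<lambda>t. - \<alpha> t))) \<and>
     (\<forall>x\<in>carrier L. \<exists>!(a, t, b). a \<in> np \<and> t \<in> \<hh> \<and> b \<in> nm \<and> x = a \<oplus>\<^bsub>L\<^esub> t \<oplus>\<^bsub>L\<^esub> b)"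

text \<open>
  Non-negative integral combinations of positive roots, and the induced strict order on weights; the
  positive roots are recovered from \<open>np\<close>.
\<close>

inductive_set positive_cone ::
  "('x, 'e) lie_algebra_scheme \<Rightarrow> 'x set \<Rightarrow> 'x set \<Rightarrow> ('x \<Rightarrow> complex) set"
  for L \<hh> np where
  zero: "(\<lambda>_. 0) \<in> positive_cone L \<hh> np"
| add: "\<lbrakk>\<beta> \<in> positive_cone L \<hh> np; \<alpha> \<in> roots L \<hh>; root_space L \<hh> \<alpha> \<subseteq> np\<rbrakk>
        \<Longrightarrow> (\<lambda>t. \<beta> t + \<alpha> t) \<in> positive_cone L \<hh> np"

definition weight_less ::
  "('x, 'e) lie_algebra_scheme \<Rightarrow> 'x set \<Rightarrow> 'x set \<Rightarrow> ('x \<Rightarrow> complex) \<Rightarrow> ('x \<Rightarrow> complex) \<Rightarrow> bool" where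
  "weight_less L \<hh> np \<mu> \<Lambda> \<longleftrightarrow> \<mu> \<noteq> \<Lambda> \<and> (\<lambda>t. \<Lambda> t - \<mu> t) \<in> positive_cone L \<hh> np"

record ('x, 'v) lie_module = "(complex, 'v) module" +
  act :: "'x \<Rightarrow> 'v \<Rightarrow> 'v"

definition is_lie_module ::
  "('x, 'e) lie_algebra_scheme \<Rightarrow> ('x, 'v, 'm) lie_module_scheme \<Rightarrow> bool" where
  "is_lie_module L V \<longleftrightarrow>
     module complex_ring V \<and>
     (\<forall>x\<in>carrier L. act V x \<in> linear_maps V V) \<and>
     (\<forall>v\<in>carrier V. (\<lambda>x. act V x v) \<in> linear_maps L V) \<and>
     (\<forall>x\<in>carrier L. \<forall>y\<in>carrier L. \<forall>v\<in>carrier V.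
        act V (bracket L x y) v = act V x (act V y v) \<ominus>\<^bsub>V\<^esub> act V y (act V x v))"

definition irreducible_module ::
  "('x, 'e) lie_algebra_scheme \<Rightarrow> ('x, 'v, 'm) lie_module_scheme \<Rightarrow> bool" where
  "irreducible_module L V \<longleftrightarrow>
     carrier V \<noteq> {\<zero>\<^bsub>V\<^esub>} \<and>
     (\<forall>N. submodule N complex_ring V \<and> (\<forall>x\<in>carrier L. \<forall>v\<in>N. act V x v \<in> N)
          \<longrightarrow> N = {\<zero>\<^bsub>V\<^esub>} \<or> N = carrier V)"

definition lie_hom ::
  "('x, 'e) lie_algebra_scheme \<Rightarrow> ('x, 'v, 'm) lie_module_scheme \<Rightarrow>
   ('x, 'w, 'n) lie_module_scheme \<Rightarrow> ('v \<Rightarrow> 'w) set" where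
  "lie_hom L V W =
     {f \<in> linear_maps V W. \<forall>x\<in>carrier L. \<forall>v\<in>carrier V. f (act V x v) = act W x (f v)}"

definition weight_space ::
  "'x set \<Rightarrow> ('x, 'v, 'm) lie_module_scheme \<Rightarrow> ('x \<Rightarrow> complex) \<Rightarrow> 'v set" where
  "weight_space \<hh> V \<mu> = {v \<in> carrier V. \<forall>t\<in>\<hh>. act V t v = \<mu> t \<odot>\<^bsub>V\<^esub> v}"

definition lie_tensor ::
  "('x, 'v, 'm) lie_module_scheme \<Rightarrow> ('x, 'w, 'n) lie_module_scheme \<Rightarrow>
   ('x, ('v \<times> 'w \<Rightarrow> complex) set) lie_module" where
  "lie_tensor V W =
     module.extend (tensor V W)
       (lie_module.fields
         (\<lambda>x. tensor_lift (tensor V W)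
                (\<lambda>v w. pure V W (act V x v) w \<oplus>\<^bsub>tensor V W\<^esub> pure V W v (act W x w))))"


section \<open>Universal enveloping algebras and Verma modules\<close>

text \<open>
  The universal enveloping algebra is presented by generators (the elements of \<open>L\<close>) and relations:
  the free associative algebra on the set \<open>L\<close>, with words as basis, modulo the two-sided ideal
  expressing linearity of \<open>L \<rightarrow> U L\<close> and \<open>x y - y x = [x, y]\<close>.
\<close>

definition free_alg :: "('x, 'e) lie_algebra_scheme \<Rightarrow> (complex, 'x list \<Rightarrow> complex) module" where
  "free_alg L = (free_space (lists (carrier L)))
     \<lparr>mult := (\<lambda>s t w. \<Sum>k\<le>length w. s (take k w) * t (drop k w)), one := delta []\<rparr>"

definition env_relations :: "('x, 'e) lie_algebra_scheme \<Rightarrow> ('x list \<Rightarrow> complex) set" where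
  "env_relations L =
     {\<lambda>w. delta [x \<oplus>\<^bsub>L\<^esub> y] w - delta [x] w - delta [y] w | x y. x \<in> carrier L \<and> y \<in> carrier L} \<union>
     {\<lambda>w. delta [c \<odot>\<^bsub>L\<^esub> x] w - c * delta [x] w | c x. x \<in> carrier L} \<union>
     {\<lambda>w. delta [x, y] w - delta [y, x] w - delta [bracket L x y] w | x y.
        x \<in> carrier L \<and> y \<in> carrier L}"

definition env_ideal :: "('x, 'e) lie_algebra_scheme \<Rightarrow> ('x list \<Rightarrow> complex) set" where
  "env_ideal L = genideal (free_alg L) (env_relations L)"

definition env :: "('x, 'e) lie_algebra_scheme \<Rightarrow> (complex, ('x list \<Rightarrow> complex) set) module" where
  "env L = quotient (free_alg L) (env_ideal L)"

definition env_word :: "('x, 'e) lie_algebra_scheme \<Rightarrow> 'x list \<Rightarrow> ('x list \<Rightarrow> complex) set" where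
  "env_word L w = env_ideal L +>\<^bsub>free_alg L\<^esub> delta w"

abbreviation env_gen :: "('x, 'e) lie_algebra_scheme \<Rightarrow> 'x \<Rightarrow> ('x list \<Rightarrow> complex) set" where
  "env_gen L x \<equiv> env_word L [x]"

text \<open>The enveloping algebra of the subalgebra \<open>K\<close>, as a subalgebra of \<open>env L\<close>.\<close>

definition env_sub :: "('x, 'e) lie_algebra_scheme \<Rightarrow> 'x set \<Rightarrow> ('x list \<Rightarrow> complex) set set" where
  "env_sub L K = lin_span (env L) (env_word L ` lists K)"

text \<open>
  The action of \<open>env L\<close> on a module over \<open>L\<close>, computed on an arbitrary representative in the free
  algebra.
\<close>

definition env_act ::
  "('x, 'v, 'm) lie_module_scheme \<Rightarrow> ('x list \<Rightarrow> complex) set \<Rightarrow> 'v \<Rightarrow> 'v" where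
  "env_act V u v =
     (let t = (SOME t. t \<in> u)
      in \<Oplus>\<^bsub>V\<^esub> w \<in> {w. t w \<noteq> 0}. t w \<odot>\<^bsub>V\<^esub> foldr (act V) w v)"

definition verma_ideal ::
  "('x, 'e) lie_algebra_scheme \<Rightarrow> 'x set \<Rightarrow> 'x set \<Rightarrow> ('x \<Rightarrow> complex) \<Rightarrow>
   ('x list \<Rightarrow> complex) set set" where
  "verma_ideal L \<hh> np \<Lambda> =
     lin_span (env L)
       {u \<otimes>\<^bsub>env L\<^esub> s | u s. u \<in> carrier (env L) \<and>
          s \<in> env_gen L ` np \<union>
              (\<lambda>t. env_gen L t \<ominus>\<^bsub>env L\<^esub> (\<Lambda> t \<odot>\<^bsub>env L\<^esub> \<one>\<^bsub>env L\<^esub>)) ` \<hh>}"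

definition verma ::
  "('x, 'e) lie_algebra_scheme \<Rightarrow> 'x set \<Rightarrow> 'x set \<Rightarrow> ('x \<Rightarrow> complex) \<Rightarrow>
   ('x, ('x list \<Rightarrow> complex) set set) lie_module" where
  "verma L \<hh> np \<Lambda> =
     module.extend (quotient (env L) (verma_ideal L \<hh> np \<Lambda>))
       (lie_module.fields
         (\<lambda>x X. \<Union>u\<in>X. verma_ideal L \<hh> np \<Lambda> +>\<^bsub>env L\<^esub> (env_gen L x \<otimes>\<^bsub>env L\<^esub> u)))"

definition verma_vec ::
  "('x, 'e) lie_algebra_scheme \<Rightarrow> 'x set \<Rightarrow> 'x set \<Rightarrow> ('x \<Rightarrow> complex) \<Rightarrow>
   ('x list \<Rightarrow> complex) set set" where
  "verma_vec L \<hh> np \<Lambda> = verma_ideal L \<hh> np \<Lambda> +>\<^bsub>env L\<^esub> \<one>\<^bsub>env L\<^esub>"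

definition leading_term ::
  "('x, 'e) lie_algebra_scheme \<Rightarrow> 'x set \<Rightarrow> 'x set \<Rightarrow> ('x \<Rightarrow> complex) \<Rightarrow>
   ('x, 'v, 'm) lie_module_scheme \<Rightarrow>
   (('x list \<Rightarrow> complex) set set \<Rightarrow>
      (('x list \<Rightarrow> complex) set set \<times> 'v \<Rightarrow> complex) set) \<Rightarrow> 'v" where
  "leading_term L \<hh> np \<Lambda> V \<phi> =
     (let M = verma L \<hh> np \<Lambda>; I = verma_vec L \<hh> np \<Lambda>
      in THE f. f \<in> weight_space \<hh> V (\<lambda>_. 0) \<and>
           \<phi> I \<ominus>\<^bsub>tensor M V\<^esub> pure M V I f
             \<in> lin_span (tensor M V)
                  {pure M V v g | v g \<mu>. \<mu> \<in> dual L \<hh> \<and> weight_less L \<hh> np \<mu> \<Lambda> \<and>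
                                          v \<in> weight_space \<hh> M \<mu> \<and> g \<in> carrier V})"

text \<open>\<open>(\<phi> \<otimes> id) \<circ> \<psi>\<close>, read as a map \<open>M \<rightarrow> M \<otimes> (V \<otimes> W)\<close>.\<close>

definition compose_intertwiners ::
  "('x, 'a, 'l) lie_module_scheme \<Rightarrow> ('x, 'v, 'm) lie_module_scheme \<Rightarrow>
   ('x, 'w, 'n) lie_module_scheme \<Rightarrow>
   ('a \<Rightarrow> ('a \<times> 'v \<Rightarrow> complex) set) \<Rightarrow> ('a \<Rightarrow> ('a \<times> 'w \<Rightarrow> complex) set) \<Rightarrow>
   'a \<Rightarrow> ('a \<times> ('v \<times> 'w \<Rightarrow> complex) set \<Rightarrow> complex) set" where
  "compose_intertwiners M V W \<phi> \<psi> =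
     tensor_assoc M V W \<circ> tensor_map (tensor M V) W \<phi> id \<circ> \<psi>"

text \<open>Multiplication as a linear map on \<open>A \<otimes> A\<close>, and the product \<open>(id \<otimes> m) \<circ> (\<phi> \<otimes> id) \<circ> \<psi>\<close>.\<close>

definition mult_map :: "(complex, 'a, 'm) module_scheme \<Rightarrow> ('a \<times> 'a \<Rightarrow> complex) set \<Rightarrow> 'a" where
  "mult_map A = tensor_lift A (\<lambda>f g. f \<otimes>\<^bsub>A\<^esub> g)"

definition star_product ::
  "('x, 'a, 'l) lie_module_scheme \<Rightarrow> ('x, 'f, 'm) lie_module_scheme \<Rightarrow>
   ('a \<Rightarrow> ('a \<times> 'f \<Rightarrow> complex) set) \<Rightarrow> ('a \<Rightarrow> ('a \<times> 'f \<Rightarrow> complex) set) \<Rightarrow>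
   'a \<Rightarrow> ('a \<times> 'f \<Rightarrow> complex) set" where
  "star_product M A \<phi> \<psi> = tensor_map M A id (mult_map A) \<circ> compose_intertwiners M A A \<phi> \<psi>"


section \<open>The universal dynamical twist\<close>

type_synonym 'x env2 =
  "(('x list \<Rightarrow> complex) set \<times> ('x list \<Rightarrow> complex) set \<Rightarrow> complex) set"

definition env2_act ::
  "('x, 'v, 'm) lie_module_scheme \<Rightarrow> ('x, 'w, 'n) lie_module_scheme \<Rightarrow> 'x env2 \<Rightarrow>
   ('v \<times> 'w \<Rightarrow> complex) set \<Rightarrow> ('v \<times> 'w \<Rightarrow> complex) set" where
  "env2_act V W Z T =
     tensor_lift (tensor V W) (\<lambda>a b. tensor_map V W (env_act V a) (env_act W b) T) Z"

text \<open>
  A formal series in the completion of \<open>env L \<otimes> env L\<close> is given by its homogeneous components, indexed by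
  the pairs of weights of the adjoint action of \<open>\<hh>\<close>.  On tensor products of locally finite modules all
  but finitely many components of a series in \<open>1 \<otimes> 1 + U nm \<otimes> U bp\<close> annihilate a given vector.
\<close>

type_synonym 'x env2_series = "('x \<Rightarrow> complex) \<Rightarrow> ('x \<Rightarrow> complex) \<Rightarrow> 'x env2"

definition series_act ::
  "('x, 'e) lie_algebra_scheme \<Rightarrow> 'x set \<Rightarrow> ('x, 'v, 'm) lie_module_scheme \<Rightarrow>
   ('x, 'w, 'n) lie_module_scheme \<Rightarrow> 'x env2_series \<Rightarrow>
   ('v \<times> 'w \<Rightarrow> complex) set \<Rightarrow> ('v \<times> 'w \<Rightarrow> complex) set" where
  "series_act L \<hh> V W K T =
     (\<Oplus>\<^bsub>tensor V W\<^esub> p \<in> {p \<in> dual L \<hh> \<times> dual L \<hh>.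
           env2_act V W (K (fst p) (snd p)) T \<noteq> \<zero>\<^bsub>tensor V W\<^esub>}.
        env2_act V W (K (fst p) (snd p)) T)"

definition env_weight_space ::
  "('x, 'e) lie_algebra_scheme \<Rightarrow> 'x set \<Rightarrow> ('x \<Rightarrow> complex) \<Rightarrow> ('x list \<Rightarrow> complex) set set" where
  "env_weight_space L \<hh> \<beta> =
     {u \<in> carrier (env L). \<forall>t\<in>\<hh>.
        (env_gen L t \<otimes>\<^bsub>env L\<^esub> u) \<ominus>\<^bsub>env L\<^esub> (u \<otimes>\<^bsub>env L\<^esub> env_gen L t) = \<beta> t \<odot>\<^bsub>env L\<^esub> u}"

text \<open>\<open>K\<close> lies in \<open>1 \<otimes> 1 + (nm U(nm)) \<otimes> (U(bp) np)\<close>, completed.\<close>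

definition twist_series ::
  "('x, 'e) lie_algebra_scheme \<Rightarrow> 'x set \<Rightarrow> 'x set \<Rightarrow> 'x set \<Rightarrow> 'x env2_series \<Rightarrow> bool" where
  "twist_series L \<hh> np nm K \<longleftrightarrow>
     (let U = env L; bp = lin_span L (\<hh> \<union> np);
          A = lin_span U {env_gen L y \<otimes>\<^bsub>U\<^esub> u | y u. y \<in> nm \<and> u \<in> env_sub L nm};
          B = lin_span U {u \<otimes>\<^bsub>U\<^esub> env_gen L x | u x. u \<in> env_sub L bp \<and> x \<in> np}
      in \<forall>\<beta>\<in>dual L \<hh>. \<forall>\<gamma>\<in>dual L \<hh>.
           K \<beta> \<gamma> \<in> carrier (tensor U U) \<and>
           K \<beta> \<gamma> \<ominus>\<^bsub>tensor U U\<^esub>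
               (if \<beta> = (\<lambda>_. 0) \<and> \<gamma> = (\<lambda>_. 0) then pure U U \<one>\<^bsub>U\<^esub> \<one>\<^bsub>U\<^esub> else \<zero>\<^bsub>tensor U U\<^esub>)
             \<in> lin_span (tensor U U)
                  {pure U U a b | a b. a \<in> A \<inter> env_weight_space L \<hh> \<beta> \<and>
                                       b \<in> B \<inter> env_weight_space L \<hh> \<gamma>})"

inductive_set weight_polynomials :: "'x set \<Rightarrow> (('x \<Rightarrow> complex) \<Rightarrow> complex) set"
  for \<hh> where
  const: "(\<lambda>_. c) \<in> weight_polynomials \<hh>"
| eval: "t \<in> \<hh> \<Longrightarrow> (\<lambda>\<Lambda>. \<Lambda> t) \<in> weight_polynomials \<hh>"
| add: "\<lbrakk>p \<in> weight_polynomials \<hh>; q \<in> weight_polynomials \<hh>\<rbrakk>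
        \<Longrightarrow> (\<lambda>\<Lambda>. p \<Lambda> + q \<Lambda>) \<in> weight_polynomials \<hh>"
| mult: "\<lbrakk>p \<in> weight_polynomials \<hh>; q \<in> weight_polynomials \<hh>\<rbrakk>
        \<Longrightarrow> (\<lambda>\<Lambda>. p \<Lambda> * q \<Lambda>) \<in> weight_polynomials \<hh>"

definition rational_on ::
  "'x set \<Rightarrow> ('x \<Rightarrow> complex) set \<Rightarrow> (('x \<Rightarrow> complex) \<Rightarrow> complex) \<Rightarrow> bool" where
  "rational_on \<hh> S c \<longleftrightarrow>
     (\<exists>p\<in>weight_polynomials \<hh>. \<exists>q\<in>weight_polynomials \<hh>. \<forall>\<Lambda>\<in>S. q \<Lambda> \<noteq> 0 \<and> c \<Lambda> = p \<Lambda> / q \<Lambda>)"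

definition rational_series ::
  "('x, 'e) lie_algebra_scheme \<Rightarrow> 'x set \<Rightarrow> ('x \<Rightarrow> complex) set \<Rightarrow>
   (('x \<Rightarrow> complex) \<Rightarrow> 'x env2_series) \<Rightarrow> bool" where
  "rational_series L \<hh> S J \<longleftrightarrow>
     (let UU = tensor (env L) (env L)
      in \<forall>\<beta>\<in>dual L \<hh>. \<forall>\<gamma>\<in>dual L \<hh>. \<exists>n (t :: nat \<Rightarrow> _) c.
           (\<forall>i<n. t i \<in> carrier UU \<and> rational_on \<hh> S (c i)) \<and>
           (\<forall>\<Lambda>\<in>S. J \<Lambda> \<beta> \<gamma> = (\<Oplus>\<^bsub>UU\<^esub> i \<in> {..<n}. c i \<Lambda> \<odot>\<^bsub>UU\<^esub> t i)))"

text \<open>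
  A twist is a family of series \<open>J \<Lambda>\<close>, regular at all weights \<open>\<Lambda>\<close> with irreducible Verma module.
  The type argument fixes a type from which the carriers of the finite-dimensional modules \<open>V\<close>
  and \<open>W\<close> are taken; every finite-dimensional module is isomorphic to one carried by a subset of \<open>'v\<close> as
  soon as \<open>'v\<close> has at least the cardinality of the continuum.
\<close>

definition universal_dynamical_twist ::
  "'v itself \<Rightarrow> ('x, 'e) lie_algebra_scheme \<Rightarrow> 'x set \<Rightarrow> 'x set \<Rightarrow> 'x set \<Rightarrow>
   (('x \<Rightarrow> complex) \<Rightarrow> 'x env2_series) \<Rightarrow> bool" where
  "universal_dynamical_twist _ L \<hh> np nm J \<longleftrightarrow>
     (let S = {\<Lambda> \<in> dual L \<hh>. irreducible_module L (verma L \<hh> np \<Lambda>)}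
      in rational_series L \<hh> S J \<and>
         (\<forall>\<Lambda>\<in>S. twist_series L \<hh> np nm (J \<Lambda>) \<and>
            (\<forall>(V :: ('x, 'v) lie_module) (W :: ('x, 'v) lie_module).
               is_lie_module L V \<and> finite_dim V \<and> is_lie_module L W \<and> finite_dim W \<longrightarrow>
               (let M = verma L \<hh> np \<Lambda>
                in \<forall>\<phi>\<in>lie_hom L M (lie_tensor M V). \<forall>\<psi>\<in>lie_hom L M (lie_tensor M W).
                     leading_term L \<hh> np \<Lambda> (lie_tensor V W) (compose_intertwiners M V W \<phi> \<psi>)
                     = series_act L \<hh> V W (J \<Lambda>)
                         (pure V W (leading_term L \<hh> np \<Lambda> V \<phi>) (leading_term L \<hh> np \<Lambda> W \<psi>))))))"


section \<open>Complex Lie groups\<close>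

text \<open>
  Complex differentiability at a point, that is, real Frechet differentiability with
  complex linear derivative; the first two arguments are the complex scalings of domain and codomain.
\<close>

definition complex_differentiable ::
  "(complex \<Rightarrow> 'a \<Rightarrow> 'a) \<Rightarrow> (complex \<Rightarrow> 'b \<Rightarrow> 'b) \<Rightarrow>
   ('a::real_normed_vector \<Rightarrow> 'b::real_normed_vector) \<Rightarrow> 'a \<Rightarrow> bool" where
  "complex_differentiable sa sb f z \<longleftrightarrow>
     (\<exists>D. (f has_derivative D) (at z) \<and> (\<forall>c v. D (sa c v) = sb c (D v)))"

record ('g, 'n) complex_lie_group = "'g monoid" +
  group_topology :: "'g topology"
  atlas :: "('g set \<times> ('g \<Rightarrow> complex ^ 'n)) set"

definition is_chart :: "'g topology \<Rightarrow> 'g set \<Rightarrow> ('g \<Rightarrow> complex ^ 'n::finite) \<Rightarrow> bool" where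
  "is_chart T U \<kappa> \<longleftrightarrow>
     openin T U \<and> open (\<kappa> ` U) \<and> homeomorphic_map (subtopology T U) (top_of_set (\<kappa> ` U)) \<kappa>"

definition is_complex_manifold ::
  "'g topology \<Rightarrow> ('g set \<times> ('g \<Rightarrow> complex ^ 'n::finite)) set \<Rightarrow> bool" where
  "is_complex_manifold T \<A> \<longleftrightarrow>
     Hausdorff_space T \<and> second_countable T \<and>
     (\<forall>(U, \<kappa>)\<in>\<A>. is_chart T U \<kappa>) \<and> \<Union> (fst ` \<A>) = topspace T \<and>
     (\<forall>(U, \<kappa>)\<in>\<A>. \<forall>(V, \<xi>)\<in>\<A>. \<forall>z \<in> \<kappa> ` (U \<inter> V).
        complex_differentiable (*s) (*s) (\<xi> \<circ> inv_into U \<kappa>) z)"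

definition is_complex_lie_group :: "('g, 'n::finite, 'e) complex_lie_group_scheme \<Rightarrow> bool" where
  "is_complex_lie_group G \<longleftrightarrow>
     (let T = group_topology G; \<A> = atlas G
      in group G \<and> topspace T = carrier G \<and> is_complex_manifold T \<A> \<and>
         continuous_map (prod_topology T T) T (\<lambda>(x, y). x \<otimes>\<^bsub>G\<^esub> y) \<and>
         continuous_map T T (\<lambda>x. inv\<^bsub>G\<^esub> x) \<and>
         (\<forall>(U, \<kappa>)\<in>\<A>. \<forall>(V, \<xi>)\<in>\<A>. \<forall>(W, \<omega>)\<in>\<A>. \<forall>x\<in>U. \<forall>y\<in>V. x \<otimes>\<^bsub>G\<^esub> y \<in> W \<longrightarrow>
            complex_differentiable (\<lambda>c (u, v). (c *s u, c *s v)) (*s)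
              (\<lambda>(u, v). \<omega> (inv_into U \<kappa> u \<otimes>\<^bsub>G\<^esub> inv_into V \<xi> v)) (\<kappa> x, \<xi> y)) \<and>
         (\<forall>(U, \<kappa>)\<in>\<A>. \<forall>(V, \<xi>)\<in>\<A>. \<forall>x\<in>U. inv\<^bsub>G\<^esub> x \<in> V \<longrightarrow>
            complex_differentiable (*s) (*s) (\<lambda>u. \<xi> (inv\<^bsub>G\<^esub> (inv_into U \<kappa> u))) (\<kappa> x)))"

definition holomorphic_near ::
  "('g, 'n::finite, 'e) complex_lie_group_scheme \<Rightarrow> ('g \<Rightarrow> complex) \<Rightarrow> 'g \<Rightarrow> bool" where
  "holomorphic_near G f x \<longleftrightarrow>
     (\<exists>N. openin (group_topology G) N \<and> x \<in> N \<and>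
        (\<forall>y\<in>N. \<forall>(U, \<kappa>)\<in>atlas G. y \<in> U \<longrightarrow>
           complex_differentiable (*s) (*) (f \<circ> inv_into U \<kappa>) (\<kappa> y)))"

text \<open>
  The Lie algebra of \<open>G\<close> is the tangent space at the identity, realised as the point derivations of germs
  of holomorphic functions (normalised to vanish on functions that are not holomorphic near the
  identity).  A derivation \<open>a\<close> corresponds to the left-invariant differential operator
  \<open>(a\<^sup>\<rightarrow> f)(x) = a (y \<mapsto> f (x y))\<close>, and the bracket is the commutator of these operators,
  evaluated at the identity.
\<close>

definition point_derivations ::
  "('g, 'n::finite, 'e) complex_lie_group_scheme \<Rightarrow> (('g \<Rightarrow> complex) \<Rightarrow> complex) set" where
  "point_derivations G =
     (let hol = (\<lambda>f. holomorphic_near G f \<one>\<^bsub>G\<^esub>)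
      in {D. (\<forall>f. \<not> hol f \<longrightarrow> D f = 0) \<and>
             (\<forall>f g. hol f \<and> hol g \<and>
                (\<exists>N. openin (group_topology G) N \<and> \<one>\<^bsub>G\<^esub> \<in> N \<and> (\<forall>y\<in>N. f y = g y)) \<longrightarrow> D f = D g) \<and>
             (\<forall>f g. hol f \<and> hol g \<longrightarrow> D (\<lambda>x. f x + g x) = D f + D g) \<and>
             (\<forall>c f. hol f \<longrightarrow> D (\<lambda>x. c * f x) = c * D f) \<and>
             (\<forall>f g. hol f \<and> hol g \<longrightarrow>
                D (\<lambda>x. f x * g x) = D f * g \<one>\<^bsub>G\<^esub> + f \<one>\<^bsub>G\<^esub> * D g)})"

definition left_invariant ::
  "('g, 'e) monoid_scheme \<Rightarrow> (('g \<Rightarrow> complex) \<Rightarrow> complex) \<Rightarrow> ('g \<Rightarrow> complex) \<Rightarrow> 'g \<Rightarrow> complex" where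
  "left_invariant G a f = (\<lambda>x. if x \<in> carrier G then a (\<lambda>y. f (x \<otimes>\<^bsub>G\<^esub> y)) else 0)"

definition lie_alg ::
  "('g, 'n::finite, 'e) complex_lie_group_scheme \<Rightarrow> (('g \<Rightarrow> complex) \<Rightarrow> complex) lie_algebra" where
  "lie_alg G =
     \<lparr>carrier = point_derivations G, mult = undefined, one = undefined, zero = (\<lambda>_. 0),
      add = (\<lambda>a b f. a f + b f), smult = (\<lambda>c a f. c * a f),
      bracket = (\<lambda>a b f. if holomorphic_near G f \<one>\<^bsub>G\<^esub>
                         then a (left_invariant G b f) - b (left_invariant G a f) else 0)\<rparr>"

definition simple_complex_lie_group ::
  "('g, 'n::finite, 'e) complex_lie_group_scheme \<Rightarrow> bool" where
  "simple_complex_lie_group G \<longleftrightarrow>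
     is_complex_lie_group G \<and> connected_space (group_topology G) \<and> simple_lie_algebra (lie_alg G)"

text \<open>
  The Lie algebra of a closed complex subgroup: the tangent vectors at the identity that annihilate
  all germs vanishing on the subgroup.
\<close>

definition lie_of_subgroup ::
  "('g, 'n::finite, 'e) complex_lie_group_scheme \<Rightarrow> 'g set \<Rightarrow> (('g \<Rightarrow> complex) \<Rightarrow> complex) set" where
  "lie_of_subgroup G H =
     {a \<in> carrier (lie_alg G). \<forall>f. holomorphic_near G f \<one>\<^bsub>G\<^esub> \<and>
        (\<exists>N. openin (group_topology G) N \<and> \<one>\<^bsub>G\<^esub> \<in> N \<and> (\<forall>y\<in>N \<inter> H. f y = 0)) \<longrightarrow> a f = 0}"

definition adjoint ::
  "('g, 'e) monoid_scheme \<Rightarrow> 'g \<Rightarrow> (('g \<Rightarrow> complex) \<Rightarrow> complex) \<Rightarrow> ('g \<Rightarrow> complex) \<Rightarrow> complex" where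
  "adjoint G x a = (\<lambda>f. a (\<lambda>y. f (x \<otimes>\<^bsub>G\<^esub> y \<otimes>\<^bsub>G\<^esub> inv\<^bsub>G\<^esub> x)))"

definition cartan_subgroup ::
  "('g, 'n::finite, 'e) complex_lie_group_scheme \<Rightarrow> 'g set \<Rightarrow> bool" where
  "cartan_subgroup G H \<longleftrightarrow>
     subgroup H G \<and> closedin (group_topology G) H \<and>
     cartan_subalgebra (lie_alg G) (lie_of_subgroup G H) \<and>
     H = {x \<in> carrier G. \<forall>a\<in>lie_of_subgroup G H. adjoint G x a = a}"


section \<open>Polynomial functions on a complex Lie group\<close>

definition matrix_representation ::
  "('g, 'n::finite, 'e) complex_lie_group_scheme \<Rightarrow> nat \<Rightarrow> ('g \<Rightarrow> nat \<Rightarrow> nat \<Rightarrow> complex) \<Rightarrow> bool" where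
  "matrix_representation G n \<rho> \<longleftrightarrow>
     (\<forall>i<n. \<forall>j<n. \<rho> \<one>\<^bsub>G\<^esub> i j = (if i = j then 1 else 0)) \<and>
     (\<forall>x\<in>carrier G. \<forall>y\<in>carrier G. \<forall>i<n. \<forall>j<n.
        \<rho> (x \<otimes>\<^bsub>G\<^esub> y) i j = (\<Sum>k<n. \<rho> x i k * \<rho> y k j)) \<and>
     (\<forall>i<n. \<forall>j<n. \<forall>x\<in>carrier G. holomorphic_near G (\<lambda>x. \<rho> x i j) x)"

text \<open>Functions on \<open>G\<close> are extended by zero outside the carrier.\<close>

inductive_set polynomial_functions ::
  "('g, 'n::finite, 'e) complex_lie_group_scheme \<Rightarrow> ('g \<Rightarrow> complex) set"
  for G where
  matrix_element: "\<lbrakk>matrix_representation G n \<rho>; i < n; j < n\<rbrakk>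
    \<Longrightarrow> (\<lambda>x. if x \<in> carrier G then \<rho> x i j else 0) \<in> polynomial_functions G"
| scale: "f \<in> polynomial_functions G \<Longrightarrow> (\<lambda>x. c * f x) \<in> polynomial_functions G"
| add: "\<lbrakk>f \<in> polynomial_functions G; g \<in> polynomial_functions G\<rbrakk>
    \<Longrightarrow> (\<lambda>x. f x + g x) \<in> polynomial_functions G"
| mult: "\<lbrakk>f \<in> polynomial_functions G; g \<in> polynomial_functions G\<rbrakk>
    \<Longrightarrow> (\<lambda>x. f x * g x) \<in> polynomial_functions G"

definition poly_alg ::
  "('g, 'n::finite, 'e) complex_lie_group_scheme \<Rightarrow>
   (('g \<Rightarrow> complex) \<Rightarrow> complex, 'g \<Rightarrow> complex) lie_module" where
  "poly_alg G =
     \<lparr>carrier = polynomial_functions G, mult = (\<lambda>f g x. f x * g x),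
      one = (\<lambda>x. if x \<in> carrier G then 1 else 0), zero = (\<lambda>_. 0),
      add = (\<lambda>f g x. f x + g x), smult = (\<lambda>c f x. c * f x), act = left_invariant G\<rparr>"

end

theory Submission
  imports Defs "HOL-Library.Function_Algebras"
begin

text \<open>
  The algebra \<open>F\<close> is locally finite: left-invariant derivations act on the matrix elements in one row
  of a representation by a constant matrix, and they obey the Leibniz rule.  Since \<open>M(\<Lambda>)\<close> is generated
  by its highest weight vector, two intertwiners into \<open>M(\<Lambda>) \<otimes> F\<close> therefore factor through
  \<open>M(\<Lambda>) \<otimes> V\<close> for a common finite-dimensional submodule \<open>V\<close> of \<open>F\<close>, where the defining property of the
  twist applies.  Both sides of that property are then transported along \<open>V \<otimes> V \<rightarrow> F \<otimes> F \<rightarrow> F\<close>.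
  The leading term is natural because it is the image under \<open>\<xi> \<otimes> id\<close> of the value at the highest weight
  vector, where the linear form \<open>\<xi>\<close> on \<open>M(\<Lambda>)\<close> reads off the coefficient of that vector, which is
  non-zero by irreducibility.
\<close>

section \<open>Complex vector spaces\<close>

text \<open>The twist property speaks about finite-dimensional modules on the type
  \<open>'g \<Rightarrow> complex\<close>, while \<open>F\<close> is in general
  infinite-dimensional; submodules of \<open>F\<close> live on that very type, which is why the
  twist is taken at \<open>TYPE('g \<Rightarrow> complex)\<close>. The delicate point of the
  reduction is that a tensor product is a quotient: M \<otimes> V is not a subset of M \<otimes> F,
  and neither pulling an intertwiner back to V nor comparing the index sets in
  \<open>series_act\<close> is possible before the induced maps of tensor products are known to be
  injective. One device meets both needs: a linear retraction of \<open>F\<close> onto V. It does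
  not commute with the Lie algebra in general, but the inclusion does, and an injective equivariant
  map reflects equivariance. The other obstacle is that \<open>leading_term\<close> is a definite
  description. Its uniqueness rests on a separation of weights: one element of the Cartan subalgebra
  takes values with positive real part on all nonzero elements of the positive cone, so a single
  operator already distinguishes \<Lambda> from every lower weight.\<close>

abbreviation (input) vspace :: "(complex, 'v, 'm) module_scheme \<Rightarrow> bool" where
  "vspace V \<equiv> module complex_ring V"

abbreviation (input) subspace_of :: "'v set \<Rightarrow> (complex, 'v, 'm) module_scheme \<Rightarrow> bool" where
  "subspace_of N V \<equiv> submodule N complex_ring V"

lemma complex_ring_simps [simp]:
  "carrier complex_ring = UNIV" "mult complex_ring = (*)" "one complex_ring = 1"
  "zero complex_ring = 0" "add complex_ring = (+)"
  by (simp_all add: complex_ring_def)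

lemma cring_complex_ring: "cring complex_ring"
proof (rule cringI)
  show "abelian_group complex_ring"
    by (rule abelian_groupI) (auto simp: algebra_simps intro: exI[of _ "- x" for x])
  show "Group.comm_monoid complex_ring"
    by (rule comm_monoidI) (auto simp: algebra_simps)
qed (auto simp: algebra_simps)

text \<open>Negatives come for free: the law for the scalar 0 and distributivity make the
  (-1)-multiple of v its inverse. In return the law for the scalar 0 is a premise, which is
  immediate for pointwise operations and for images.\<close>

lemma vspaceI:
  assumes "\<And>v w. v \<in> carrier V \<Longrightarrow> w \<in> carrier V \<Longrightarrow> v \<oplus>\<^bsub>V\<^esub> w \<in> carrier V"
    and "\<zero>\<^bsub>V\<^esub> \<in> carrier V"
    and "\<And>u v w. u \<in> carrier V \<Longrightarrow> v \<in> carrier V \<Longrightarrow> w \<in> carrier V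
           \<Longrightarrow> (u \<oplus>\<^bsub>V\<^esub> v) \<oplus>\<^bsub>V\<^esub> w = u \<oplus>\<^bsub>V\<^esub> (v \<oplus>\<^bsub>V\<^esub> w)"
    and "\<And>v w. v \<in> carrier V \<Longrightarrow> w \<in> carrier V \<Longrightarrow> v \<oplus>\<^bsub>V\<^esub> w = w \<oplus>\<^bsub>V\<^esub> v"
    and "\<And>v. v \<in> carrier V \<Longrightarrow> \<zero>\<^bsub>V\<^esub> \<oplus>\<^bsub>V\<^esub> v = v"
    and "\<And>c v. v \<in> carrier V \<Longrightarrow> c \<odot>\<^bsub>V\<^esub> v \<in> carrier V"
    and distl: "\<And>c d v. v \<in> carrier V \<Longrightarrow> (c + d) \<odot>\<^bsub>V\<^esub> v = c \<odot>\<^bsub>V\<^esub> v \<oplus>\<^bsub>V\<^esub> d \<odot>\<^bsub>V\<^esub> v"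
    and "\<And>c v w. v \<in> carrier V \<Longrightarrow> w \<in> carrier V
           \<Longrightarrow> c \<odot>\<^bsub>V\<^esub> (v \<oplus>\<^bsub>V\<^esub> w) = c \<odot>\<^bsub>V\<^esub> v \<oplus>\<^bsub>V\<^esub> c \<odot>\<^bsub>V\<^esub> w"
    and "\<And>c d v. v \<in> carrier V \<Longrightarrow> (c * d) \<odot>\<^bsub>V\<^esub> v = c \<odot>\<^bsub>V\<^esub> (d \<odot>\<^bsub>V\<^esub> v)"
    and one: "\<And>v. v \<in> carrier V \<Longrightarrow> 1 \<odot>\<^bsub>V\<^esub> v = v"
    and null: "\<And>v. v \<in> carrier V \<Longrightarrow> 0 \<odot>\<^bsub>V\<^esub> v = \<zero>\<^bsub>V\<^esub>"
  shows "vspace V"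
proof (rule moduleI)
  show "abelian_group V"
  proof (rule abelian_groupI)
    fix v assume v: "v \<in> carrier V"
    have "(-1) \<odot>\<^bsub>V\<^esub> v \<oplus>\<^bsub>V\<^esub> v = \<zero>\<^bsub>V\<^esub>"
      using distl[OF v, of "-1" 1] one[OF v] null[OF v] by simp
    then show "\<exists>w\<in>carrier V. w \<oplus>\<^bsub>V\<^esub> v = \<zero>\<^bsub>V\<^esub>"
      using assms(6)[OF v] by blast
  qed (use assms in auto)
qed (use assms cring_complex_ring in auto)

lemma
  assumes "vspace V"
  shows vs_abelian: "abelian_group V"
    and vs_zero_closed: "\<zero>\<^bsub>V\<^esub> \<in> carrier V"
    and vs_add_closed: "\<And>v w. v \<in> carrier V \<Longrightarrow> w \<in> carrier V \<Longrightarrow> v \<oplus>\<^bsub>V\<^esub> w \<in> carrier V"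
    and vs_smult_closed: "\<And>c v. v \<in> carrier V \<Longrightarrow> c \<odot>\<^bsub>V\<^esub> v \<in> carrier V"
    and vs_minus_closed: "\<And>v w. v \<in> carrier V \<Longrightarrow> w \<in> carrier V \<Longrightarrow> v \<ominus>\<^bsub>V\<^esub> w \<in> carrier V"
    and vs_assoc: "\<And>u v w. u \<in> carrier V \<Longrightarrow> v \<in> carrier V \<Longrightarrow> w \<in> carrier V
           \<Longrightarrow> (u \<oplus>\<^bsub>V\<^esub> v) \<oplus>\<^bsub>V\<^esub> w = u \<oplus>\<^bsub>V\<^esub> (v \<oplus>\<^bsub>V\<^esub> w)"
    and vs_comm: "\<And>v w. v \<in> carrier V \<Longrightarrow> w \<in> carrier V \<Longrightarrow> v \<oplus>\<^bsub>V\<^esub> w = w \<oplus>\<^bsub>V\<^esub> v"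
    and vs_lcomm: "\<And>u v w. u \<in> carrier V \<Longrightarrow> v \<in> carrier V \<Longrightarrow> w \<in> carrier V
           \<Longrightarrow> u \<oplus>\<^bsub>V\<^esub> (v \<oplus>\<^bsub>V\<^esub> w) = v \<oplus>\<^bsub>V\<^esub> (u \<oplus>\<^bsub>V\<^esub> w)"
    and vs_zero_l: "\<And>v. v \<in> carrier V \<Longrightarrow> \<zero>\<^bsub>V\<^esub> \<oplus>\<^bsub>V\<^esub> v = v"
    and vs_zero_r: "\<And>v. v \<in> carrier V \<Longrightarrow> v \<oplus>\<^bsub>V\<^esub> \<zero>\<^bsub>V\<^esub> = v"
    and vs_smult_l: "\<And>c d v. v \<in> carrier V \<Longrightarrow> (c + d) \<odot>\<^bsub>V\<^esub> v = c \<odot>\<^bsub>V\<^esub> v \<oplus>\<^bsub>V\<^esub> d \<odot>\<^bsub>V\<^esub> v"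
    and vs_smult_r: "\<And>c v w. v \<in> carrier V \<Longrightarrow> w \<in> carrier V
           \<Longrightarrow> c \<odot>\<^bsub>V\<^esub> (v \<oplus>\<^bsub>V\<^esub> w) = c \<odot>\<^bsub>V\<^esub> v \<oplus>\<^bsub>V\<^esub> c \<odot>\<^bsub>V\<^esub> w"
    and vs_smult_assoc: "\<And>c d v. v \<in> carrier V \<Longrightarrow> c \<odot>\<^bsub>V\<^esub> (d \<odot>\<^bsub>V\<^esub> v) = (c * d) \<odot>\<^bsub>V\<^esub> v"
    and vs_one: "\<And>v. v \<in> carrier V \<Longrightarrow> 1 \<odot>\<^bsub>V\<^esub> v = v"
    and vs_smult_zero_l: "\<And>v. v \<in> carrier V \<Longrightarrow> 0 \<odot>\<^bsub>V\<^esub> v = \<zero>\<^bsub>V\<^esub>"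
    and vs_smult_zero_r: "\<And>c. c \<odot>\<^bsub>V\<^esub> \<zero>\<^bsub>V\<^esub> = \<zero>\<^bsub>V\<^esub>"
    and vs_neg: "\<And>v. v \<in> carrier V \<Longrightarrow> \<ominus>\<^bsub>V\<^esub> v = (-1) \<odot>\<^bsub>V\<^esub> v"
    and vs_minus: "\<And>v w. v \<in> carrier V \<Longrightarrow> w \<in> carrier V
           \<Longrightarrow> v \<ominus>\<^bsub>V\<^esub> w = v \<oplus>\<^bsub>V\<^esub> (-1) \<odot>\<^bsub>V\<^esub> w"
    and vs_minus_eq_zero: "\<And>v w. v \<in> carrier V \<Longrightarrow> w \<in> carrier V
           \<Longrightarrow> v \<ominus>\<^bsub>V\<^esub> w = \<zero>\<^bsub>V\<^esub> \<longleftrightarrow> v = w"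
proof -
  interpret module complex_ring V by fact
  show "abelian_group V" by (rule M.abelian_group_axioms)
  show "\<zero>\<^bsub>V\<^esub> \<in> carrier V" by simp
  show "v \<oplus>\<^bsub>V\<^esub> w \<in> carrier V" if "v \<in> carrier V" "w \<in> carrier V" for v w
    using that by simp
  show "c \<odot>\<^bsub>V\<^esub> v \<in> carrier V" if "v \<in> carrier V" for c v using that by simp
  show "v \<ominus>\<^bsub>V\<^esub> w \<in> carrier V" if "v \<in> carrier V" "w \<in> carrier V" for v w
    using that by simp
  show "(u \<oplus>\<^bsub>V\<^esub> v) \<oplus>\<^bsub>V\<^esub> w = u \<oplus>\<^bsub>V\<^esub> (v \<oplus>\<^bsub>V\<^esub> w)"
    "u \<oplus>\<^bsub>V\<^esub> (v \<oplus>\<^bsub>V\<^esub> w) = v \<oplus>\<^bsub>V\<^esub> (u \<oplus>\<^bsub>V\<^esub> w)"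
    if "u \<in> carrier V" "v \<in> carrier V" "w \<in> carrier V" for u v w
    using that by (simp_all add: M.a_assoc M.a_lcomm)
  show "v \<oplus>\<^bsub>V\<^esub> w = w \<oplus>\<^bsub>V\<^esub> v" if "v \<in> carrier V" "w \<in> carrier V" for v w
    using that by (rule M.a_comm)
  show "\<zero>\<^bsub>V\<^esub> \<oplus>\<^bsub>V\<^esub> v = v" "v \<oplus>\<^bsub>V\<^esub> \<zero>\<^bsub>V\<^esub> = v" "1 \<odot>\<^bsub>V\<^esub> v = v" "0 \<odot>\<^bsub>V\<^esub> v = \<zero>\<^bsub>V\<^esub>"
    if "v \<in> carrier V" for v
    using that smult_one[of v] smult_l_null[of v] by simp_all
  show "(c + d) \<odot>\<^bsub>V\<^esub> v = c \<odot>\<^bsub>V\<^esub> v \<oplus>\<^bsub>V\<^esub> d \<odot>\<^bsub>V\<^esub> v" if "v \<in> carrier V" for c d v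
    using that smult_l_distr[of c d v] by simp
  show "c \<odot>\<^bsub>V\<^esub> (v \<oplus>\<^bsub>V\<^esub> w) = c \<odot>\<^bsub>V\<^esub> v \<oplus>\<^bsub>V\<^esub> c \<odot>\<^bsub>V\<^esub> w"
    if "v \<in> carrier V" "w \<in> carrier V" for c v w
    using that smult_r_distr[of c v w] by simp
  show "c \<odot>\<^bsub>V\<^esub> (d \<odot>\<^bsub>V\<^esub> v) = (c * d) \<odot>\<^bsub>V\<^esub> v" if "v \<in> carrier V" for c d v
    using that smult_assoc1[of c d v] by simp
  show "c \<odot>\<^bsub>V\<^esub> \<zero>\<^bsub>V\<^esub> = \<zero>\<^bsub>V\<^esub>" for c by simp
  show neg: "\<ominus>\<^bsub>V\<^esub> v = (-1) \<odot>\<^bsub>V\<^esub> v" if v: "v \<in> carrier V" for v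
  proof -
    have "(-1) \<odot>\<^bsub>V\<^esub> v \<oplus>\<^bsub>V\<^esub> v = \<zero>\<^bsub>V\<^esub>"
      using smult_l_distr[of "-1" 1 v] smult_one[OF v] smult_l_null[OF v] v by simp
    then show ?thesis using v by (intro M.minus_equality) auto
  qed
  show "v \<ominus>\<^bsub>V\<^esub> w = v \<oplus>\<^bsub>V\<^esub> (-1) \<odot>\<^bsub>V\<^esub> w" if "v \<in> carrier V" "w \<in> carrier V" for v w
    using that neg by (simp add: M.minus_eq)
  show "v \<ominus>\<^bsub>V\<^esub> w = \<zero>\<^bsub>V\<^esub> \<longleftrightarrow> v = w" if "v \<in> carrier V" "w \<in> carrier V" for v w
  proof -
    have "v = (v \<ominus>\<^bsub>V\<^esub> w) \<oplus>\<^bsub>V\<^esub> w" using that by (simp add: M.minus_eq M.a_assoc M.l_neg)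
    then show ?thesis using that by (auto simp: M.minus_eq M.r_neg)
  qed
qed

lemmas vs_closed = vs_zero_closed vs_add_closed vs_smult_closed
text \<open>Normal form: sums of scalar multiples, with a difference read as addition of a
  (-1)-multiple. \<open>vs_smult_l\<close> is kept apart, because it is used in both directions, to
  split and to merge coefficients.\<close>

lemmas vs_simps = vs_assoc vs_comm vs_lcomm vs_zero_l vs_zero_r vs_smult_r vs_smult_assoc
  vs_one vs_smult_zero_l vs_smult_zero_r vs_minus

lemma vs_add_minus_cancel:
  assumes "vspace V" "v \<in> carrier V" "w \<in> carrier V"
  shows "v \<oplus>\<^bsub>V\<^esub> (w \<ominus>\<^bsub>V\<^esub> v) = w"
proof -
  interpret abelian_group V by (rule vs_abelian[OF assms(1)])
  show ?thesis using assms(2,3) by (simp add: a_minus_def a_lcomm[of v w] r_neg)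
qed

text \<open>The shape in which a commutator shifts a weight: with v = y m and w = t y m the
  difference is the bracket term, and the eigenvalues c and d add up.\<close>

lemma vs_smult_from_minus:
  assumes "vspace V" "v \<in> carrier V" "w \<in> carrier V" "w \<ominus>\<^bsub>V\<^esub> c \<odot>\<^bsub>V\<^esub> v = d \<odot>\<^bsub>V\<^esub> v"
  shows "w = (c + d) \<odot>\<^bsub>V\<^esub> v"
  using vs_add_minus_cancel[OF assms(1) vs_smult_closed[OF assms(1,2), of c] assms(3)] assms(4)
  by (simp add: vs_smult_l[OF assms(1,2)])

lemma vs_smult_eq_zeroD:
  assumes "vspace V" "x \<in> carrier V" "k \<odot>\<^bsub>V\<^esub> x = \<zero>\<^bsub>V\<^esub>" "x \<noteq> \<zero>\<^bsub>V\<^esub>"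
  shows "k = 0"
proof (rule ccontr)
  assume "k \<noteq> 0"
  then have "x = (1 / k) \<odot>\<^bsub>V\<^esub> (k \<odot>\<^bsub>V\<^esub> x)"
    by (simp add: vs_smult_assoc[OF assms(1,2)] vs_one[OF assms(1,2)])
  then show False using assms by (simp add: vs_smult_zero_r[OF assms(1)])
qed

section \<open>Linear maps between carriers\<close>

lemma linear_mapsI:
  assumes "\<And>v. v \<in> carrier V \<Longrightarrow> f v \<in> carrier W"
    and "\<And>v v'. v \<in> carrier V \<Longrightarrow> v' \<in> carrier V \<Longrightarrow> f (v \<oplus>\<^bsub>V\<^esub> v') = f v \<oplus>\<^bsub>W\<^esub> f v'"
    and "\<And>c v. v \<in> carrier V \<Longrightarrow> f (c \<odot>\<^bsub>V\<^esub> v) = c \<odot>\<^bsub>W\<^esub> f v"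
  shows "f \<in> linear_maps V W"
  using assms by (auto simp: linear_maps_def)

lemma
  assumes "f \<in> linear_maps V W"
  shows lin_closed: "\<And>v. v \<in> carrier V \<Longrightarrow> f v \<in> carrier W"
    and lin_add: "\<And>v v'. v \<in> carrier V \<Longrightarrow> v' \<in> carrier V \<Longrightarrow> f (v \<oplus>\<^bsub>V\<^esub> v') = f v \<oplus>\<^bsub>W\<^esub> f v'"
    and lin_smult: "\<And>c v. v \<in> carrier V \<Longrightarrow> f (c \<odot>\<^bsub>V\<^esub> v) = c \<odot>\<^bsub>W\<^esub> f v"
  using assms by (auto simp: linear_maps_def)

lemma lin_zero:
  assumes "vspace V" "vspace W" "f \<in> linear_maps V W"
  shows "f \<zero>\<^bsub>V\<^esub> = \<zero>\<^bsub>W\<^esub>"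
  using lin_smult[OF assms(3) vs_zero_closed[OF assms(1)], of 0]
    vs_smult_zero_l[OF assms(1) vs_zero_closed[OF assms(1)]]
    vs_smult_zero_l[OF assms(2) lin_closed[OF assms(3) vs_zero_closed[OF assms(1)]]]
  by simp

lemma lin_minus:
  assumes "vspace V" "vspace W" "f \<in> linear_maps V W" "v \<in> carrier V" "v' \<in> carrier V"
  shows "f (v \<ominus>\<^bsub>V\<^esub> v') = f v \<ominus>\<^bsub>W\<^esub> f v'"
  using assms(4,5) by (simp add: vs_minus[OF assms(1)] vs_minus[OF assms(2)] vs_closed[OF assms(1)]
      lin_add[OF assms(3)] lin_smult[OF assms(3)] lin_closed[OF assms(3)])

lemma lin_comp:
  "f \<in> linear_maps V W \<Longrightarrow> g \<in> linear_maps W Z \<Longrightarrow> (\<lambda>v. g (f v)) \<in> linear_maps V Z"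
  by (rule linear_mapsI) (simp_all add: lin_closed lin_add lin_smult)

lemma lin_id: "(\<lambda>v. v) \<in> linear_maps V V"
  by (auto simp: linear_maps_def)

lemma lin_plus:
  assumes W: "vspace W" and f: "f \<in> linear_maps V W" and g: "g \<in> linear_maps V W"
  shows "(\<lambda>v. f v \<oplus>\<^bsub>W\<^esub> g v) \<in> linear_maps V W"
  by (rule linear_mapsI)
     (simp_all add: lin_closed[OF f] lin_closed[OF g] lin_add[OF f] lin_add[OF g]
       lin_smult[OF f] lin_smult[OF g] vs_simps[OF W] vs_closed[OF W])

lemma lin_scale:
  assumes W: "vspace W" and f: "f \<in> linear_maps V W"
  shows "(\<lambda>v. c \<odot>\<^bsub>W\<^esub> f v) \<in> linear_maps V W"
  by (rule linear_mapsI)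
     (simp_all add: lin_closed[OF f] lin_add[OF f] lin_smult[OF f] vs_simps[OF W] vs_closed[OF W]
       mult.commute)

lemma lin_finsum:
  assumes V: "vspace V" and W: "vspace W" and f: "f \<in> linear_maps V W"
    and h: "h \<in> A \<rightarrow> carrier V"
  shows "f (\<Oplus>\<^bsub>V\<^esub> i \<in> A. h i) = (\<Oplus>\<^bsub>W\<^esub> i \<in> A. f (h i))"
proof -
  interpret V: abelian_group V by (rule vs_abelian[OF V])
  interpret W: abelian_group W by (rule vs_abelian[OF W])
  show ?thesis
  proof (cases "finite A")
    case True
    then show ?thesis using h
    proof (induction A rule: finite_induct)
      case empty
      then show ?case by (simp add: lin_zero[OF V W f])
    next
      case (insert a A)
      have "(\<lambda>i. f (h i)) \<in> A \<rightarrow> carrier W" using insert.prems lin_closed[OF f] by auto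
      moreover have "h \<in> A \<rightarrow> carrier V" using insert.prems by auto
      ultimately show ?case
        using insert lin_closed[OF f] by (simp add: lin_add[OF f])
    qed
  next
    \<comment> \<open>Over an infinite index set \<open>finsum\<close> takes its default value zero
      on both sides, and a linear map preserves it.\<close>
    case False
    then show ?thesis by (simp add: lin_zero[OF V W f])
  qed
qed

lemma lin_combination_finsum:
  assumes V: "vspace V" and W: "vspace W" and f: "\<And>i. i \<in> A \<Longrightarrow> f i \<in> linear_maps V W"
  shows "(\<lambda>v. \<Oplus>\<^bsub>W\<^esub> i \<in> A. f i v) \<in> linear_maps V W"
proof -
  interpret W: abelian_group W by (rule vs_abelian[OF W])
  have cl: "(\<lambda>i. f i v) \<in> A \<rightarrow> carrier W" if "v \<in> carrier V" for v
    using that by (auto intro: lin_closed[OF f])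
  show ?thesis
  proof (rule linear_mapsI)
    fix v v' assume v: "v \<in> carrier V" and v': "v' \<in> carrier V"
    have "(\<Oplus>\<^bsub>W\<^esub> i \<in> A. f i (v \<oplus>\<^bsub>V\<^esub> v')) = (\<Oplus>\<^bsub>W\<^esub> i \<in> A. f i v \<oplus>\<^bsub>W\<^esub> f i v')"
      by (rule W.finsum_cong') (use v v' in \<open>auto simp: lin_add[OF f] intro!: vs_closed[OF V] vs_add_closed[OF W] lin_closed[OF f]\<close>)
    also have "\<dots> = (\<Oplus>\<^bsub>W\<^esub> i \<in> A. f i v) \<oplus>\<^bsub>W\<^esub> (\<Oplus>\<^bsub>W\<^esub> i \<in> A. f i v')"
      by (rule W.finsum_addf) (use cl[OF v] cl[OF v'] in auto)
    finally show "(\<Oplus>\<^bsub>W\<^esub> i \<in> A. f i (v \<oplus>\<^bsub>V\<^esub> v')) = \<dots>" .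
  next
    fix c v assume v: "v \<in> carrier V"
    have "(\<lambda>w. c \<odot>\<^bsub>W\<^esub> w) \<in> linear_maps W W" by (rule lin_scale[OF W lin_id])
    from lin_finsum[OF W W this cl[OF v]]
    have "c \<odot>\<^bsub>W\<^esub> (\<Oplus>\<^bsub>W\<^esub> i \<in> A. f i v) = (\<Oplus>\<^bsub>W\<^esub> i \<in> A. c \<odot>\<^bsub>W\<^esub> f i v)" .
    also have "\<dots> = (\<Oplus>\<^bsub>W\<^esub> i \<in> A. f i (c \<odot>\<^bsub>V\<^esub> v))"
      by (rule W.finsum_cong') (use v in \<open>auto simp: lin_smult[OF f] intro!: vs_closed[OF V] vs_smult_closed[OF W] lin_closed[OF f]\<close>)
    finally show "(\<Oplus>\<^bsub>W\<^esub> i \<in> A. f i (c \<odot>\<^bsub>V\<^esub> v)) = c \<odot>\<^bsub>W\<^esub> (\<Oplus>\<^bsub>W\<^esub> i \<in> A. f i v)" by simp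
  qed (use cl in auto)
qed

section \<open>Subspaces, spans and images\<close>

lemma subspaceI:
  assumes "vspace V" "N \<subseteq> carrier V" "\<zero>\<^bsub>V\<^esub> \<in> N"
    and "\<And>v w. v \<in> N \<Longrightarrow> w \<in> N \<Longrightarrow> v \<oplus>\<^bsub>V\<^esub> w \<in> N" and "\<And>c v. v \<in> N \<Longrightarrow> c \<odot>\<^bsub>V\<^esub> v \<in> N"
  shows "subspace_of N V"
  by (rule module.submoduleI[OF assms(1)]) (use assms vs_neg[OF assms(1)] in auto)

lemma
  assumes "vspace V" "subspace_of N V"
  shows subspace_subset: "N \<subseteq> carrier V"
    and subspace_zero: "\<zero>\<^bsub>V\<^esub> \<in> N"
    and subspace_add: "\<And>v w. v \<in> N \<Longrightarrow> w \<in> N \<Longrightarrow> v \<oplus>\<^bsub>V\<^esub> w \<in> N"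
    and subspace_smult: "\<And>c v. v \<in> N \<Longrightarrow> c \<odot>\<^bsub>V\<^esub> v \<in> N"
    and subspace_minus: "\<And>v w. v \<in> N \<Longrightarrow> w \<in> N \<Longrightarrow> v \<ominus>\<^bsub>V\<^esub> w \<in> N"
proof -
  note E = module.submoduleE[OF assms]
  show sub: "N \<subseteq> carrier V" and add: "\<And>v w. v \<in> N \<Longrightarrow> w \<in> N \<Longrightarrow> v \<oplus>\<^bsub>V\<^esub> w \<in> N"
    and sm: "\<And>c v. v \<in> N \<Longrightarrow> c \<odot>\<^bsub>V\<^esub> v \<in> N"
    using E by auto
  obtain v where "v \<in> N" using E(2) by auto
  then show "\<zero>\<^bsub>V\<^esub> \<in> N" using sm[of v 0] sub by (auto simp: vs_smult_zero_l[OF assms(1)])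
  show "v \<ominus>\<^bsub>V\<^esub> w \<in> N" if "v \<in> N" "w \<in> N" for v w
    using add[OF that(1) sm[OF that(2), of "-1"]]
    by (simp add: vs_minus[OF assms(1)] subsetD[OF sub] that)
qed

lemma subspace_vspace: "vspace V \<Longrightarrow> subspace_of N V \<Longrightarrow> vspace (V\<lparr>carrier := N\<rparr>)"
  by (rule submodule.submodule_is_module)

lemma subspace_carrier: "vspace V \<Longrightarrow> subspace_of (carrier V) V"
  by (rule module.carrier_is_submodule)

lemma lin_span_subspace:
  assumes V: "vspace V" and S: "S \<subseteq> carrier V"
  shows "subspace_of (lin_span V S) V"
proof (rule subspaceI[OF V])
  show "lin_span V S \<subseteq> carrier V"
    unfolding lin_span_def using subspace_carrier[OF V] S by blast
qed (auto simp: lin_span_def intro: subspace_zero[OF V] subspace_add[OF V] subspace_smult[OF V])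

lemma lin_span_base: "s \<in> S \<Longrightarrow> s \<in> lin_span V S"
  by (auto simp: lin_span_def)

lemma lin_span_minimal: "subspace_of N V \<Longrightarrow> S \<subseteq> N \<Longrightarrow> lin_span V S \<subseteq> N"
  by (auto simp: lin_span_def)

lemma lin_span_mono: "S \<subseteq> T \<Longrightarrow> lin_span V S \<subseteq> lin_span V T"
  unfolding lin_span_def by (rule Inter_anti_mono) auto

lemma lin_span_induct:
  assumes V: "vspace V" and S: "S \<subseteq> carrier V" and x: "x \<in> lin_span V S"
    and "P \<zero>\<^bsub>V\<^esub>" and "\<And>s. s \<in> S \<Longrightarrow> P s"
    and "\<And>v w. v \<in> carrier V \<Longrightarrow> w \<in> carrier V \<Longrightarrow> P v \<Longrightarrow> P w \<Longrightarrow> P (v \<oplus>\<^bsub>V\<^esub> w)"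
    and "\<And>c v. v \<in> carrier V \<Longrightarrow> P v \<Longrightarrow> P (c \<odot>\<^bsub>V\<^esub> v)"
  shows "P x"
proof -
  have "subspace_of {v \<in> carrier V. P v} V"
    by (rule subspaceI[OF V]) (use assms vs_closed[OF V] in auto)
  then have "lin_span V S \<subseteq> {v \<in> carrier V. P v}"
    by (rule lin_span_minimal) (use assms in auto)
  then show ?thesis using x by auto
qed

lemma lin_kernel_subspace:
  assumes "vspace V" "vspace W" "f \<in> linear_maps V W"
  shows "subspace_of {v \<in> carrier V. f v = \<zero>\<^bsub>W\<^esub>} V"
  by (rule subspaceI[OF assms(1)])
     (auto simp: lin_zero[OF assms] lin_add[OF assms(3)] lin_smult[OF assms(3)]
       vs_simps[OF assms(2)] vs_closed[OF assms(1)] vs_closed[OF assms(2)])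

lemma lin_vimage_subspace:
  assumes "vspace V" "vspace W" "f \<in> linear_maps V W" "subspace_of N W"
  shows "subspace_of {v \<in> carrier V. f v \<in> N} V"
  by (rule subspaceI[OF assms(1)])
     (auto simp: lin_zero[OF assms(1-3)] lin_add[OF assms(3)] lin_smult[OF assms(3)]
       vs_closed[OF assms(1)] subspace_zero[OF assms(2,4)] subspace_add[OF assms(2,4)]
       subspace_smult[OF assms(2,4)])

text \<open>Vector space axioms are identities, so they pass along a surjection compatible with the
  operations. That zero goes to zero is a separate premise because \<open>W\<close> is not yet known
  to be a group, where it could be derived.\<close>

lemma vspace_image:
  assumes V: "vspace V" and f: "f \<in> linear_maps V W" and onto: "f ` carrier V = carrier W"
    and zero: "f \<zero>\<^bsub>V\<^esub> = \<zero>\<^bsub>W\<^esub>"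
  shows "vspace W"
proof -
  note simps = lin_add[OF f, symmetric] lin_smult[OF f, symmetric] zero[symmetric]
    vs_closed[OF V] vs_simps[OF V]
  have r: "\<exists>v\<in>carrier V. w = f v" if "w \<in> carrier W" for w using that onto by auto
  have c: "f v \<in> carrier W" if "v \<in> carrier V" for v using that lin_closed[OF f] by auto
  show ?thesis
    by (rule vspaceI) (auto dest!: r simp: simps c vs_smult_l[OF V])
qed


text \<open>Transfers the axioms between records that share the linear structure and differ in
  further fields, such as a product or an action.\<close>

lemma vspace_cong:
  assumes "vspace V" "carrier W = carrier V" "add W = add V" "zero W = zero V" "smult W = smult V"
  shows "vspace W"
  by (rule vspace_image[OF assms(1), of "\<lambda>v. v"]) (auto intro!: linear_mapsI simp: assms vs_closed[OF assms(1)])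

subsection \<open>Quotients\<close>

context
  fixes V :: "(complex, 'v, 'm) module_scheme" and N
  assumes V: "vspace V" and N: "subspace_of N V"
begin

lemma quot_abelian_subgroup: "abelian_subgroup N V"
proof (rule abelian_subgroupI3)
  show "additive_subgroup N V"
    using N by (simp add: submodule_def additive_subgroup_def)
  show "abelian_group V" by (rule vs_abelian[OF V])
qed

lemma quot_carrier: "carrier (quotient V N) = (\<lambda>v. N +>\<^bsub>V\<^esub> v) ` carrier V"
  by (auto simp: quotient_def ring.defs module.defs FactRing_def A_RCOSETS_def')

lemma quot_zero: "\<zero>\<^bsub>quotient V N\<^esub> = N"
  by (simp add: quotient_def ring.defs module.defs FactRing_def)

lemma quot_eq_iff:
  assumes "v \<in> carrier V" "w \<in> carrier V"
  shows "N +>\<^bsub>V\<^esub> v = N +>\<^bsub>V\<^esub> w \<longleftrightarrow> v \<ominus>\<^bsub>V\<^esub> w \<in> N"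
proof -
  interpret abelian_subgroup N V by (rule quot_abelian_subgroup)
  have "v \<in> N +>\<^bsub>V\<^esub> w \<longleftrightarrow> v \<ominus>\<^bsub>V\<^esub> w \<in> N"
    using assms a_rcos_module_minus[of w v] a_rcos_module[of w v]
    by (simp add: a_minus_def)
  then show ?thesis
    using assms a_repr_independence' a_rcos_self by metis
qed

lemma quot_mem_iff:
  assumes "v \<in> carrier V"
  shows "x \<in> N +>\<^bsub>V\<^esub> v \<longleftrightarrow> x \<in> carrier V \<and> N +>\<^bsub>V\<^esub> x = N +>\<^bsub>V\<^esub> v"
proof -
  interpret abelian_subgroup N V by (rule quot_abelian_subgroup)
  show ?thesis
    using assms a_repr_independence' a_rcos_self a_elemrcos_carrier by metis
qed

lemma quot_add:
  assumes "v \<in> carrier V" "w \<in> carrier V"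
  shows "(N +>\<^bsub>V\<^esub> v) \<oplus>\<^bsub>quotient V N\<^esub> (N +>\<^bsub>V\<^esub> w) = N +>\<^bsub>V\<^esub> (v \<oplus>\<^bsub>V\<^esub> w)"
proof -
  interpret abelian_subgroup N V by (rule quot_abelian_subgroup)
  show ?thesis
    using a_rcos_sum[OF assms] by (simp add: quotient_def ring.defs module.defs FactRing_def)
qed

lemma quot_smult:
  assumes v: "v \<in> carrier V"
  shows "c \<odot>\<^bsub>quotient V N\<^esub> (N +>\<^bsub>V\<^esub> v) = N +>\<^bsub>V\<^esub> (c \<odot>\<^bsub>V\<^esub> v)"
proof -
  \<comment> \<open>The definition takes a union over all representatives of the coset; it is a
    single coset because each representative contributes the same one.\<close>
  have *: "N +>\<^bsub>V\<^esub> (c \<odot>\<^bsub>V\<^esub> x) = N +>\<^bsub>V\<^esub> (c \<odot>\<^bsub>V\<^esub> v)" if "x \<in> N +>\<^bsub>V\<^esub> v" for x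
  proof -
    have x: "x \<in> carrier V" "x \<ominus>\<^bsub>V\<^esub> v \<in> N"
      using that quot_mem_iff[OF v] quot_eq_iff[OF _ v] by blast+
    then have "c \<odot>\<^bsub>V\<^esub> (x \<ominus>\<^bsub>V\<^esub> v) \<in> N" using subspace_smult[OF V N] by blast
    then show ?thesis
      using x v by (simp add: quot_eq_iff vs_simps[OF V] vs_closed[OF V] mult.commute)
  qed
  have "v \<in> N +>\<^bsub>V\<^esub> v" using quot_mem_iff[OF v] v by blast
  then have "(\<Union>x\<in>N +>\<^bsub>V\<^esub> v. N +>\<^bsub>V\<^esub> (c \<odot>\<^bsub>V\<^esub> x)) = N +>\<^bsub>V\<^esub> (c \<odot>\<^bsub>V\<^esub> v)"
    using * by blast
  then show ?thesis by (simp add: quotient_def ring.defs module.defs)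
qed

lemma quot_coset_zero: "N +>\<^bsub>V\<^esub> \<zero>\<^bsub>V\<^esub> = N"
  using abelian_group.a_coset_add_zero[OF vs_abelian[OF V] subspace_subset[OF V N]] .

lemma quot_coset_linear: "(\<lambda>v. N +>\<^bsub>V\<^esub> v) \<in> linear_maps V (quotient V N)"
  by (rule linear_mapsI) (auto simp: quot_carrier quot_add quot_smult)

lemma quot_vspace: "vspace (quotient V N)"
  by (rule vspace_image[OF V quot_coset_linear]) (auto simp: quot_carrier quot_zero quot_coset_zero)

lemma quot_eq_zero_iff:
  assumes "v \<in> carrier V"
  shows "N +>\<^bsub>V\<^esub> v = \<zero>\<^bsub>quotient V N\<^esub> \<longleftrightarrow> v \<in> N"
  using assms quot_eq_iff[OF assms vs_zero_closed[OF V]]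
  by (simp add: quot_zero quot_coset_zero vs_simps[OF V] vs_closed[OF V])

lemma quot_some:
  assumes "X \<in> carrier (quotient V N)"
  shows "(SOME t. t \<in> X) \<in> carrier V" "N +>\<^bsub>V\<^esub> (SOME t. t \<in> X) = X"
proof -
  obtain v where v: "v \<in> carrier V" "X = N +>\<^bsub>V\<^esub> v" using assms by (auto simp: quot_carrier)
  then have "v \<in> X" using quot_mem_iff by blast
  then have "(SOME t. t \<in> X) \<in> X" by (rule someI)
  then show "(SOME t. t \<in> X) \<in> carrier V" "N +>\<^bsub>V\<^esub> (SOME t. t \<in> X) = X"
    using v quot_mem_iff by blast+
qed

text \<open>A linear map that kills N has equal values on any two elements of a coset, so evaluating
  it at the element picked by \<open>SOME\<close> gives a well-defined map.
  \<open>tensor_lift\<close> is of this form.\<close>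

lemma quot_lift:
  assumes Z: "vspace Z" and f: "f \<in> linear_maps V Z" and null: "\<And>n. n \<in> N \<Longrightarrow> f n = \<zero>\<^bsub>Z\<^esub>"
  shows "\<And>v. v \<in> carrier V \<Longrightarrow> f (SOME t. t \<in> N +>\<^bsub>V\<^esub> v) = f v"
    and "(\<lambda>X. f (SOME t. t \<in> X)) \<in> linear_maps (quotient V N) Z"
proof -
  show *: "f (SOME t. t \<in> N +>\<^bsub>V\<^esub> v) = f v" if v: "v \<in> carrier V" for v
  proof -
    let ?t = "SOME t. t \<in> N +>\<^bsub>V\<^esub> v"
    have t: "?t \<in> carrier V" "N +>\<^bsub>V\<^esub> ?t = N +>\<^bsub>V\<^esub> v"
      using quot_some[of "N +>\<^bsub>V\<^esub> v"] v by (auto simp: quot_carrier)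
    then have "f (?t \<ominus>\<^bsub>V\<^esub> v) = \<zero>\<^bsub>Z\<^esub>" using null quot_eq_iff[OF t(1) v] by blast
    then show ?thesis
      using t v by (simp add: lin_minus[OF V Z f] vs_minus_eq_zero[OF Z] lin_closed[OF f])
  qed
  show "(\<lambda>X. f (SOME t. t \<in> X)) \<in> linear_maps (quotient V N) Z"
    by (rule linear_mapsI)
       (auto simp: quot_carrier quot_add quot_smult * vs_closed[OF V] lin_closed[OF f]
         lin_add[OF f] lin_smult[OF f])
qed

end


subsection \<open>Free vector spaces\<close>

lemma free_carrier: "t \<in> carrier (free_space S) \<longleftrightarrow> finite {p. t p \<noteq> 0} \<and> {p. t p \<noteq> 0} \<subseteq> S"
  by (simp add: free_space_def)

lemma free_ops [simp]:
  "s \<oplus>\<^bsub>free_space S\<^esub> t = (\<lambda>p. s p + t p)" "c \<odot>\<^bsub>free_space S\<^esub> t = (\<lambda>p. c * t p)"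
  "\<zero>\<^bsub>free_space S\<^esub> = (\<lambda>_. 0)"
  by (simp_all add: free_space_def)

lemma free_vspace: "vspace (free_space S)"
proof (rule vspaceI)
  fix s t assume st: "s \<in> carrier (free_space S)" "t \<in> carrier (free_space S)"
  have "{p. s p + t p \<noteq> 0} \<subseteq> {p. s p \<noteq> 0} \<union> {p. t p \<noteq> 0}" by auto
  then show "s \<oplus>\<^bsub>free_space S\<^esub> t \<in> carrier (free_space S)"
    using st by (auto simp: free_carrier intro: finite_subset)
qed (auto simp: free_carrier algebra_simps)

lemma delta_closed: "p \<in> S \<Longrightarrow> delta p \<in> carrier (free_space S)"
  by (auto simp: free_carrier delta_def)

text \<open>Induction over a finite set containing the support. Removing a point a from that set
  replaces t by the function u that vanishes at a and agrees with t elsewhere; the term split off is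
  \<open>t a\<close> times \<open>delta a\<close>, and if \<open>t a\<close> is 0 then u is t
  itself.\<close>

lemma free_induct:
  assumes t: "t \<in> carrier (free_space S)" and zero: "P (\<lambda>_. 0)"
    and step: "\<And>c p t. p \<in> S \<Longrightarrow> t \<in> carrier (free_space S) \<Longrightarrow> P t \<Longrightarrow> P (\<lambda>q. c * delta p q + t q)"
  shows "P t"
proof -
  have "\<forall>t. {p. t p \<noteq> 0} \<subseteq> A \<longrightarrow> t \<in> carrier (free_space S) \<longrightarrow> P t" if "finite A" for A
    using that
  proof (induction A rule: finite_induct)
    case empty
    have "t = (\<lambda>_. 0)" if "{p. t p \<noteq> 0} \<subseteq> {}" for t :: "'a \<Rightarrow> complex" using that by auto
    then show ?case using zero by metis
  next
    case (insert a A)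
    show ?case
    proof (intro allI impI)
      fix t assume sub: "{p. t p \<noteq> 0} \<subseteq> insert a A" and t: "t \<in> carrier (free_space S)"
      define u where "u = (\<lambda>q. if q = a then 0 else t q)"
      have "{p. u p \<noteq> 0} \<subseteq> {p. t p \<noteq> 0}" by (auto simp: u_def)
      then have u: "u \<in> carrier (free_space S)" using t by (auto simp: free_carrier intro: finite_subset)
      have "{p. u p \<noteq> 0} \<subseteq> A" using sub by (auto simp: u_def)
      then have Pu: "P u" using insert.IH u by blast
      show "P t"
      proof (cases "t a = 0")
        case True
        then have "u = t" by (auto simp: u_def)
        then show ?thesis using Pu by simp
      next
        case False
        then have "a \<in> S" using t by (auto simp: free_carrier)
        moreover have "t = (\<lambda>q. t a * delta a q + u q)" by (auto simp: u_def delta_def)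
        ultimately show ?thesis using step[OF _ u Pu, of a "t a"] by metis
      qed
    qed
  qed
  then show ?thesis using t by (auto simp: free_carrier)
qed

text \<open>The linear extension of \<beta> from the basis of deltas. It is the sum inside
  \<open>tensor_lift\<close>, separated from the choice of a representative.\<close>

definition free_lift :: "(complex, 'z, 'm) module_scheme \<Rightarrow> ('s \<Rightarrow> 'z) \<Rightarrow> ('s \<Rightarrow> complex) \<Rightarrow> 'z" where
  "free_lift Z \<beta> t = (\<Oplus>\<^bsub>Z\<^esub> p \<in> {p. t p \<noteq> 0}. t p \<odot>\<^bsub>Z\<^esub> \<beta> p)"

context
  fixes Z :: "(complex, 'z, 'm) module_scheme" and S :: "'s set" and \<beta>
  assumes Z: "vspace Z" and \<beta>: "\<beta> \<in> S \<rightarrow> carrier Z"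
begin

text \<open>Cancellation can make the support of a sum smaller than the union of the supports. Sums
  over one larger index set, whose extra terms are zero, can be added termwise.\<close>

lemma free_lift_superset:
  assumes "finite A" "A \<subseteq> S" "{p. t p \<noteq> 0} \<subseteq> A"
  shows "free_lift Z \<beta> t = (\<Oplus>\<^bsub>Z\<^esub> p \<in> A. t p \<odot>\<^bsub>Z\<^esub> \<beta> p)"
proof -
  interpret Z: abelian_group Z by (rule vs_abelian[OF Z])
  have "\<beta> p \<in> carrier Z" if "p \<in> A" for p using that assms(2) \<beta> by auto
  then show ?thesis unfolding free_lift_def
    by (intro Z.add.finprod_mono_neutral_cong_left)
       (use assms in \<open>auto simp: vs_smult_zero_l[OF Z] intro!: vs_smult_closed[OF Z]\<close>)
qed

lemma free_lift_delta: "p \<in> S \<Longrightarrow> free_lift Z \<beta> (delta p) = \<beta> p"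
proof -
  interpret Z: abelian_group Z by (rule vs_abelian[OF Z])
  assume p: "p \<in> S"
  then have "free_lift Z \<beta> (delta p) = (\<Oplus>\<^bsub>Z\<^esub> q \<in> {p}. delta p q \<odot>\<^bsub>Z\<^esub> \<beta> q)"
    by (intro free_lift_superset) (auto simp: delta_def)
  also have "\<dots> = \<beta> p"
    using p \<beta> by (auto simp: delta_def vs_one[OF Z] vs_smult_closed[OF Z] Pi_iff Z.finsum_insert Z.finsum_empty)
  finally show ?thesis .
qed

lemma free_lift_linear: "free_lift Z \<beta> \<in> linear_maps (free_space S) Z"
proof (rule linear_mapsI)
  interpret Z: abelian_group Z by (rule vs_abelian[OF Z])
  have cl: "(\<lambda>p. t p \<odot>\<^bsub>Z\<^esub> \<beta> p) \<in> A \<rightarrow> carrier Z" if "A \<subseteq> S" for A t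
    using that \<beta> by (auto intro!: vs_smult_closed[OF Z])
  fix s assume s: "s \<in> carrier (free_space S)"
  show "free_lift Z \<beta> s \<in> carrier Z"
    unfolding free_lift_def using s cl by (auto simp: free_carrier)
  { fix t assume t: "t \<in> carrier (free_space S)"
    let ?A = "{p. s p \<noteq> 0} \<union> {p. t p \<noteq> 0}"
    have A: "finite ?A" "?A \<subseteq> S" using s t by (auto simp: free_carrier)
    have "free_lift Z \<beta> (\<lambda>p. s p + t p) = (\<Oplus>\<^bsub>Z\<^esub> p \<in> ?A. (s p + t p) \<odot>\<^bsub>Z\<^esub> \<beta> p)"
      by (rule free_lift_superset) (use A in auto)
    also have "\<dots> = (\<Oplus>\<^bsub>Z\<^esub> p \<in> ?A. s p \<odot>\<^bsub>Z\<^esub> \<beta> p \<oplus>\<^bsub>Z\<^esub> t p \<odot>\<^bsub>Z\<^esub> \<beta> p)"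
    proof (rule Z.finsum_cong'[OF refl])
      show "(\<lambda>p. s p \<odot>\<^bsub>Z\<^esub> \<beta> p \<oplus>\<^bsub>Z\<^esub> t p \<odot>\<^bsub>Z\<^esub> \<beta> p) \<in> ?A \<rightarrow> carrier Z"
        using cl[OF A(2), of s] cl[OF A(2), of t] by (auto simp: Pi_iff)
      show "(s p + t p) \<odot>\<^bsub>Z\<^esub> \<beta> p = s p \<odot>\<^bsub>Z\<^esub> \<beta> p \<oplus>\<^bsub>Z\<^esub> t p \<odot>\<^bsub>Z\<^esub> \<beta> p" if "p \<in> ?A" for p
        using that A(2) \<beta> by (intro vs_smult_l[OF Z]) auto
    qed
    also have "\<dots> = (\<Oplus>\<^bsub>Z\<^esub> p \<in> ?A. s p \<odot>\<^bsub>Z\<^esub> \<beta> p) \<oplus>\<^bsub>Z\<^esub> (\<Oplus>\<^bsub>Z\<^esub> p \<in> ?A. t p \<odot>\<^bsub>Z\<^esub> \<beta> p)"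
      by (rule Z.finsum_addf) (use cl[OF A(2)] in auto)
    also have "\<dots> = free_lift Z \<beta> s \<oplus>\<^bsub>Z\<^esub> free_lift Z \<beta> t"
      using free_lift_superset[OF A, of s] free_lift_superset[OF A, of t] by auto
    finally show "free_lift Z \<beta> (s \<oplus>\<^bsub>free_space S\<^esub> t) = free_lift Z \<beta> s \<oplus>\<^bsub>Z\<^esub> free_lift Z \<beta> t"
      by simp }
  fix c
  let ?A = "{p. s p \<noteq> 0}"
  have A: "finite ?A" "?A \<subseteq> S" using s by (auto simp: free_carrier)
  have "free_lift Z \<beta> (\<lambda>p. c * s p) = (\<Oplus>\<^bsub>Z\<^esub> p \<in> ?A. (c * s p) \<odot>\<^bsub>Z\<^esub> \<beta> p)"
    by (rule free_lift_superset) (use A in auto)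
  also have "\<dots> = (\<Oplus>\<^bsub>Z\<^esub> p \<in> ?A. c \<odot>\<^bsub>Z\<^esub> (s p \<odot>\<^bsub>Z\<^esub> \<beta> p))"
    by (rule Z.finsum_cong'[OF refl])
       (use cl[OF A(2), of s] A(2) \<beta> in \<open>auto simp: Pi_iff vs_smult_assoc[OF Z] subset_iff intro!: vs_smult_closed[OF Z]\<close>)
  also have "\<dots> = c \<odot>\<^bsub>Z\<^esub> free_lift Z \<beta> s"
    unfolding free_lift_def
    by (rule lin_finsum[OF Z Z, symmetric]) (use cl[OF A(2)] in \<open>auto intro: lin_scale[OF Z lin_id]\<close>)
  finally show "free_lift Z \<beta> (c \<odot>\<^bsub>free_space S\<^esub> s) = c \<odot>\<^bsub>Z\<^esub> free_lift Z \<beta> s"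
    by simp
qed

end


subsection \<open>Tensor products\<close>

definition bilinear_maps ::
  "(complex, 'v, 'm) module_scheme \<Rightarrow> (complex, 'w, 'n) module_scheme \<Rightarrow>
   (complex, 'z, 'o) module_scheme \<Rightarrow> ('v \<Rightarrow> 'w \<Rightarrow> 'z) set" where
  "bilinear_maps V W Z =
     {\<beta>. (\<forall>v\<in>carrier V. \<beta> v \<in> linear_maps W Z) \<and> (\<forall>w\<in>carrier W. (\<lambda>v. \<beta> v w) \<in> linear_maps V Z)}"

lemma bilinear_mapsI:
  assumes "\<And>v. v \<in> carrier V \<Longrightarrow> \<beta> v \<in> linear_maps W Z"
    and "\<And>w. w \<in> carrier W \<Longrightarrow> (\<lambda>v. \<beta> v w) \<in> linear_maps V Z"
  shows "\<beta> \<in> bilinear_maps V W Z"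
  using assms by (auto simp: bilinear_maps_def)

lemma bilinear_mapsD:
  assumes "\<beta> \<in> bilinear_maps V W Z"
  shows "\<And>v. v \<in> carrier V \<Longrightarrow> \<beta> v \<in> linear_maps W Z"
    and "\<And>w. w \<in> carrier W \<Longrightarrow> (\<lambda>v. \<beta> v w) \<in> linear_maps V Z"
  using assms by (auto simp: bilinear_maps_def)

lemma bilinear_maps_closed:
  "\<beta> \<in> bilinear_maps V W Z \<Longrightarrow> v \<in> carrier V \<Longrightarrow> w \<in> carrier W \<Longrightarrow> \<beta> v w \<in> carrier Z"
  by (meson bilinear_mapsD(1) lin_closed)

lemma bilinear_maps_comp:
  assumes "\<beta> \<in> bilinear_maps V' W' Z" "f \<in> linear_maps V V'" "g \<in> linear_maps W W'"
  shows "(\<lambda>v w. \<beta> (f v) (g w)) \<in> bilinear_maps V W Z"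
proof (rule bilinear_mapsI)
  show "(\<lambda>w. \<beta> (f v) (g w)) \<in> linear_maps W Z" if "v \<in> carrier V" for v
    using lin_comp[OF assms(3) bilinear_mapsD(1)[OF assms(1) lin_closed[OF assms(2) that]]] .
  show "(\<lambda>v. \<beta> (f v) (g w)) \<in> linear_maps V Z" if "w \<in> carrier W" for w
    using lin_comp[OF assms(2) bilinear_mapsD(2)[OF assms(1) lin_closed[OF assms(3) that]]] .
qed

lemma bilinear_maps_plus:
  assumes "vspace Z" "\<beta> \<in> bilinear_maps V W Z" "\<gamma> \<in> bilinear_maps V W Z"
  shows "(\<lambda>v w. \<beta> v w \<oplus>\<^bsub>Z\<^esub> \<gamma> v w) \<in> bilinear_maps V W Z"
  by (rule bilinear_mapsI; rule lin_plus[OF assms(1)])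
     (simp_all add: bilinear_mapsD[OF assms(2)] bilinear_mapsD[OF assms(3)])

context
  fixes V :: "(complex, 'v, 'm) module_scheme" and W :: "(complex, 'w, 'n) module_scheme"
  assumes V: "vspace V" and W: "vspace W"
begin

private abbreviation (input) "FS \<equiv> free_space (carrier V \<times> carrier W)"

lemma tensor_relations_closed: "tensor_relations V W \<subseteq> carrier FS"
proof -
  have sub: "(\<lambda>p. s p - t p) \<in> carrier FS" if "s \<in> carrier FS" "t \<in> carrier FS" for s t
    using vs_add_closed[OF free_vspace that(1) vs_smult_closed[OF free_vspace that(2), of "-1"]] by simp
  have sm: "(\<lambda>p. c * t p) \<in> carrier FS" if "t \<in> carrier FS" for c t
    using vs_smult_closed[OF free_vspace that, of c] by simp
  show ?thesis
    unfolding tensor_relations_def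
    by (auto intro!: sub sm delta_closed vs_closed[OF V] vs_closed[OF W])
qed

lemma tensor_null_subspace: "subspace_of (tensor_null V W) FS"
  unfolding tensor_null_def by (rule lin_span_subspace[OF free_vspace tensor_relations_closed])

lemma tensor_vspace: "vspace (tensor V W)"
  unfolding tensor_def by (rule quot_vspace[OF free_vspace tensor_null_subspace])

lemma pure_closed: "v \<in> carrier V \<Longrightarrow> w \<in> carrier W \<Longrightarrow> pure V W v w \<in> carrier (tensor V W)"
  unfolding tensor_def pure_def
  by (rule lin_closed[OF quot_coset_linear[OF free_vspace tensor_null_subspace] delta_closed]) simp

lemma tensor_relations_intros:
  "\<lbrakk>v \<in> carrier V; v' \<in> carrier V; w \<in> carrier W\<rbrakk> \<Longrightarrow>
    (\<lambda>p. delta (v \<oplus>\<^bsub>V\<^esub> v', w) p - delta (v, w) p - delta (v', w) p) \<in> tensor_relations V W"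
  "\<lbrakk>v \<in> carrier V; w \<in> carrier W; w' \<in> carrier W\<rbrakk> \<Longrightarrow>
    (\<lambda>p. delta (v, w \<oplus>\<^bsub>W\<^esub> w') p - delta (v, w) p - delta (v, w') p) \<in> tensor_relations V W"
  "\<lbrakk>v \<in> carrier V; w \<in> carrier W\<rbrakk> \<Longrightarrow>
    (\<lambda>p. delta (c \<odot>\<^bsub>V\<^esub> v, w) p - c * delta (v, w) p) \<in> tensor_relations V W"
  "\<lbrakk>v \<in> carrier V; w \<in> carrier W\<rbrakk> \<Longrightarrow>
    (\<lambda>p. delta (v, c \<odot>\<^bsub>W\<^esub> w) p - c * delta (v, w) p) \<in> tensor_relations V W"
  unfolding tensor_relations_def
     apply (rule UnI1, rule UnI1, rule UnI1, rule CollectI, intro exI conjI; (assumption | rule refl))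
    apply (rule UnI1, rule UnI1, rule UnI2, rule CollectI, intro exI conjI; (assumption | rule refl))
   apply (rule UnI1, rule UnI2, rule CollectI, intro exI conjI; (assumption | rule refl))
  apply (rule UnI2, rule CollectI, intro exI conjI; (assumption | rule refl))
  done

lemma pure_bilinear: "pure V W \<in> bilinear_maps V W (tensor V W)"
proof -
  have sub: "(\<lambda>p. s p - t p) \<in> carrier FS" if "s \<in> carrier FS" "t \<in> carrier FS" for s t
    using vs_add_closed[OF free_vspace that(1) vs_smult_closed[OF free_vspace that(2), of "-1"]] by simp
  have sm: "(\<lambda>p. c * t p) \<in> carrier FS" if "t \<in> carrier FS" for c t
    using vs_smult_closed[OF free_vspace that, of c] by simp
  have pl: "(\<lambda>p. s p + t p) \<in> carrier FS" if "s \<in> carrier FS" "t \<in> carrier FS" for s t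
    using vs_add_closed[OF free_vspace that] by simp
  \<comment> \<open>Representatives that differ by a generating relation lie in one coset; each of
    the four bilinearity laws is one family of relations.\<close>
  have eq: "tensor_null V W +>\<^bsub>FS\<^esub> s = tensor_null V W +>\<^bsub>FS\<^esub> t"
    if "s \<in> carrier FS" "t \<in> carrier FS" "(\<lambda>p. s p - t p) \<in> tensor_relations V W" for s t
    using that quot_eq_iff[OF free_vspace tensor_null_subspace that(1,2)]
      lin_span_base[of "\<lambda>p. s p - t p" "tensor_relations V W" FS]
    by (simp add: tensor_null_def vs_minus[OF free_vspace])
  have add_l: "pure V W (v \<oplus>\<^bsub>V\<^esub> v') w = pure V W v w \<oplus>\<^bsub>tensor V W\<^esub> pure V W v' w"
    if "v \<in> carrier V" "v' \<in> carrier V" "w \<in> carrier W" for v v' w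
  proof -
    have "(\<lambda>p. delta (v \<oplus>\<^bsub>V\<^esub> v', w) p - (delta (v, w) p + delta (v', w) p)) \<in> tensor_relations V W"
      unfolding diff_diff_add[symmetric] using that by (intro tensor_relations_intros)
    note eq = eq[OF _ _ this]
    show ?thesis
      using that eq quot_add[OF free_vspace tensor_null_subspace delta_closed delta_closed, of "(v, w)" "(v', w)"]
      unfolding pure_def tensor_def by (simp add: vs_closed[OF V] delta_closed pl)
  qed
  have add_r: "pure V W v (w \<oplus>\<^bsub>W\<^esub> w') = pure V W v w \<oplus>\<^bsub>tensor V W\<^esub> pure V W v w'"
    if "v \<in> carrier V" "w' \<in> carrier W" "w \<in> carrier W" for v w w'
  proof -
    have "(\<lambda>p. delta (v, w \<oplus>\<^bsub>W\<^esub> w') p - (delta (v, w) p + delta (v, w') p)) \<in> tensor_relations V W"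
      unfolding diff_diff_add[symmetric] using that by (intro tensor_relations_intros)
    note eq = eq[OF _ _ this]
    show ?thesis
      using that eq quot_add[OF free_vspace tensor_null_subspace delta_closed delta_closed, of "(v, w)" "(v, w')"]
      unfolding pure_def tensor_def by (simp add: vs_closed[OF W] delta_closed pl)
  qed
  have "pure V W (c \<odot>\<^bsub>V\<^esub> v) w = c \<odot>\<^bsub>tensor V W\<^esub> pure V W v w"
    if "v \<in> carrier V" "w \<in> carrier W" for c v w
  proof -
    have "(\<lambda>p. delta (c \<odot>\<^bsub>V\<^esub> v, w) p - c * delta (v, w) p) \<in> tensor_relations V W"
      using that by (intro tensor_relations_intros)
    note eq = eq[OF _ _ this]
    show ?thesis
      using that eq quot_smult[OF free_vspace tensor_null_subspace delta_closed, of "(v, w)" c]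
      unfolding pure_def tensor_def by (simp add: vs_closed[OF V] delta_closed sm)
  qed
  moreover have "pure V W v (c \<odot>\<^bsub>W\<^esub> w) = c \<odot>\<^bsub>tensor V W\<^esub> pure V W v w"
    if "v \<in> carrier V" "w \<in> carrier W" for c v w
  proof -
    have "(\<lambda>p. delta (v, c \<odot>\<^bsub>W\<^esub> w) p - c * delta (v, w) p) \<in> tensor_relations V W"
      using that by (intro tensor_relations_intros)
    note eq = eq[OF _ _ this]
    show ?thesis
      using that eq quot_smult[OF free_vspace tensor_null_subspace delta_closed, of "(v, w)" c]
      unfolding pure_def tensor_def by (simp add: vs_closed[OF W] delta_closed sm)
  qed
  ultimately show ?thesis
    by (intro bilinear_mapsI linear_mapsI) (auto simp: pure_closed add_l add_r)
qed

text \<open>Every tensor is a finite sum of pure ones: the scalar of a basis element is absorbed by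
  its first factor, and zero is the pure tensor of two zeros. Hence there is neither a zero case nor
  a scalar case.\<close>

lemma tensor_induct:
  assumes T: "T \<in> carrier (tensor V W)"
    and pure: "\<And>v w. v \<in> carrier V \<Longrightarrow> w \<in> carrier W \<Longrightarrow> P (pure V W v w)"
    and add: "\<And>S T. S \<in> carrier (tensor V W) \<Longrightarrow> T \<in> carrier (tensor V W) \<Longrightarrow> P S \<Longrightarrow> P T
      \<Longrightarrow> P (S \<oplus>\<^bsub>tensor V W\<^esub> T)"
  shows "P T"
proof -
  let ?q = "\<lambda>t. tensor_null V W +>\<^bsub>FS\<^esub> t"
  have q: "?q \<in> linear_maps FS (tensor V W)"
    unfolding tensor_def by (rule quot_coset_linear[OF free_vspace tensor_null_subspace])
  have zero: "P (?q (\<lambda>_. 0))"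
  proof -
    have "pure V W \<zero>\<^bsub>V\<^esub> \<zero>\<^bsub>W\<^esub> = \<zero>\<^bsub>tensor V W\<^esub>"
      using lin_zero[OF V tensor_vspace bilinear_mapsD(2)[OF pure_bilinear vs_zero_closed[OF W]]] .
    then have "?q (\<lambda>_. 0) = pure V W \<zero>\<^bsub>V\<^esub> \<zero>\<^bsub>W\<^esub>"
      using lin_zero[OF free_vspace tensor_vspace q] by simp
    then show ?thesis using pure vs_zero_closed[OF V] vs_zero_closed[OF W] by simp
  qed
  have "P (?q t)" if "t \<in> carrier FS" for t
    using that zero
  proof (rule free_induct)
    fix c p t assume p: "p \<in> carrier V \<times> carrier W" and t: "t \<in> carrier FS" and Pt: "P (?q t)"
    have d: "delta p \<in> carrier FS" using p by (rule delta_closed)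
    have "?q (\<lambda>q. c * delta p q + t q) = ?q (c \<odot>\<^bsub>FS\<^esub> delta p \<oplus>\<^bsub>FS\<^esub> t)" by simp
    also have "\<dots> = c \<odot>\<^bsub>tensor V W\<^esub> ?q (delta p) \<oplus>\<^bsub>tensor V W\<^esub> ?q t"
      using d t lin_add[OF q vs_smult_closed[OF free_vspace d] t] lin_smult[OF q d] by simp
    also have "c \<odot>\<^bsub>tensor V W\<^esub> ?q (delta p) = pure V W (c \<odot>\<^bsub>V\<^esub> fst p) (snd p)"
      using p lin_smult[OF bilinear_mapsD(2)[OF pure_bilinear], of "snd p" "fst p" c]
      by (auto simp: pure_def)
    finally have "?q (\<lambda>q. c * delta p q + t q)
        = pure V W (c \<odot>\<^bsub>V\<^esub> fst p) (snd p) \<oplus>\<^bsub>tensor V W\<^esub> ?q t" .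
    then show "P (?q (\<lambda>q. c * delta p q + t q))"
      using add[OF _ _ pure Pt, of "c \<odot>\<^bsub>V\<^esub> fst p" "snd p"] p vs_smult_closed[OF V] pure_closed
        lin_closed[OF q t] by auto
  qed
  moreover obtain t where "t \<in> carrier FS" "T = ?q t"
    using T quot_carrier[OF free_vspace tensor_null_subspace] by (auto simp: tensor_def)
  ultimately show ?thesis by blast
qed

lemma tensor_lift_alt:
  "tensor_lift Z \<beta> X = free_lift Z (\<lambda>p. \<beta> (fst p) (snd p)) (SOME t. t \<in> X)"
  by (simp add: tensor_lift_def free_lift_def Let_def)

context
  fixes Z :: "(complex, 'z, 'o) module_scheme" and \<beta>
  assumes Z: "vspace Z" and \<beta>: "\<beta> \<in> bilinear_maps V W Z"
begin

private abbreviation (input) "fl \<equiv> free_lift Z (\<lambda>p. \<beta> (fst p) (snd p))"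

text \<open>Bilinearity of \<beta> says precisely that its linear extension vanishes on the four
  families of relations; the kernel, being a subspace, then contains their span.\<close>

lemma tensor_lift_aux:
  "fl \<in> linear_maps FS Z" "\<And>v w. v \<in> carrier V \<Longrightarrow> w \<in> carrier W \<Longrightarrow> fl (delta (v, w)) = \<beta> v w"
  "\<And>n. n \<in> tensor_null V W \<Longrightarrow> fl n = \<zero>\<^bsub>Z\<^esub>"
proof -
  have b: "(\<lambda>p. \<beta> (fst p) (snd p)) \<in> carrier V \<times> carrier W \<rightarrow> carrier Z"
    using bilinear_maps_closed[OF \<beta>] by auto
  show fl: "fl \<in> linear_maps FS Z" by (rule free_lift_linear[OF Z b])
  show dl: "fl (delta (v, w)) = \<beta> v w" if "v \<in> carrier V" "w \<in> carrier W" for v w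
    using free_lift_delta[OF Z b, of "(v, w)"] that by simp
  have diff: "fl (\<lambda>p. s p - t p) = fl s \<ominus>\<^bsub>Z\<^esub> fl t" if "s \<in> carrier FS" "t \<in> carrier FS" for s t
    using lin_minus[OF free_vspace Z fl that] that by (simp add: vs_minus[OF free_vspace])
  have scale: "fl (\<lambda>p. c * t p) = c \<odot>\<^bsub>Z\<^esub> fl t" if "t \<in> carrier FS" for c t
    using lin_smult[OF fl that, of c] by simp
  have sub: "(\<lambda>p. s p - t p) \<in> carrier FS" if "s \<in> carrier FS" "t \<in> carrier FS" for s t
    using vs_add_closed[OF free_vspace that(1) vs_smult_closed[OF free_vspace that(2), of "-1"]] by simp
  have sm: "(\<lambda>p. c * t p) \<in> carrier FS" if "t \<in> carrier FS" for c t
    using vs_smult_closed[OF free_vspace that, of c] by simp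
  have cancel: "x \<oplus>\<^bsub>Z\<^esub> y \<ominus>\<^bsub>Z\<^esub> x \<ominus>\<^bsub>Z\<^esub> y = \<zero>\<^bsub>Z\<^esub>" if "x \<in> carrier Z" "y \<in> carrier Z" for x y
  proof -
    interpret abelian_group Z by (rule vs_abelian[OF Z])
    have "x \<oplus>\<^bsub>Z\<^esub> y \<ominus>\<^bsub>Z\<^esub> x = y" using that by (simp add: a_minus_def a_comm[of x y] a_assoc r_neg)
    then show ?thesis using that by (simp add: a_minus_def r_neg)
  qed
  note bl = lin_add[OF bilinear_mapsD(1)[OF \<beta>]] lin_add[OF bilinear_mapsD(2)[OF \<beta>]]
    lin_smult[OF bilinear_mapsD(1)[OF \<beta>]] lin_smult[OF bilinear_mapsD(2)[OF \<beta>]]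
  have "tensor_null V W \<subseteq> {t \<in> carrier FS. fl t = \<zero>\<^bsub>Z\<^esub>}"
    unfolding tensor_null_def
  proof (rule lin_span_minimal[OF lin_kernel_subspace[OF free_vspace Z fl]], rule subsetI)
    fix r assume r: "r \<in> tensor_relations V W"
    then have "fl r = \<zero>\<^bsub>Z\<^esub>"
      unfolding tensor_relations_def
      by (elim UnE CollectE exE conjE)
         (simp_all add: diff scale sub sm delta_closed dl vs_closed[OF V] vs_closed[OF W] bl cancel
           bilinear_maps_closed[OF \<beta>] vs_minus_eq_zero[OF Z] vs_smult_closed[OF Z])
    then show "r \<in> {t \<in> carrier FS. fl t = \<zero>\<^bsub>Z\<^esub>}" using r tensor_relations_closed by auto
  qed
  then show "fl n = \<zero>\<^bsub>Z\<^esub>" if "n \<in> tensor_null V W" for n using that by blast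
qed

lemma tensor_lift_linear: "tensor_lift Z \<beta> \<in> linear_maps (tensor V W) Z"
  using quot_lift(2)[OF free_vspace tensor_null_subspace Z tensor_lift_aux(1,3)]
  by (simp add: tensor_def tensor_lift_alt[abs_def])

lemma tensor_lift_pure:
  "v \<in> carrier V \<Longrightarrow> w \<in> carrier W \<Longrightarrow> tensor_lift Z \<beta> (pure V W v w) = \<beta> v w"
  using quot_lift(1)[OF free_vspace tensor_null_subspace Z tensor_lift_aux(1,3), of "delta (v, w)"]
    tensor_lift_aux(2)
  by (simp add: pure_def tensor_lift_alt delta_closed)

end

text \<open>Additivity of both maps reduces an identity to pure tensors. The naturality statements
  about tensor products below are checked through this rule.\<close>

lemma tensor_ext:
  assumes "f \<in> linear_maps (tensor V W) Z" "g \<in> linear_maps (tensor V W) Z"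
    and "\<And>v w. v \<in> carrier V \<Longrightarrow> w \<in> carrier W \<Longrightarrow> f (pure V W v w) = g (pure V W v w)"
    and "T \<in> carrier (tensor V W)"
  shows "f T = g T"
  using assms(4) by (rule tensor_induct) (auto simp: assms(3) lin_add[OF assms(1)] lin_add[OF assms(2)])

end

section \<open>Functoriality and associativity of tensor products\<close>

context
  fixes V :: "(complex, 'v, 'm) module_scheme" and W :: "(complex, 'w, 'n) module_scheme"
    and V' :: "(complex, 'v1, 'm1) module_scheme" and W' :: "(complex, 'w1, 'n1) module_scheme"
    and f g
  assumes V: "vspace V" and W: "vspace W" and V': "vspace V'" and W': "vspace W'"
    and f: "f \<in> linear_maps V V'" and g: "g \<in> linear_maps W W'"
begin

lemma tensor_map_linear: "tensor_map V' W' f g \<in> linear_maps (tensor V W) (tensor V' W')"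
  unfolding tensor_map_def
  by (rule tensor_lift_linear[OF V W tensor_vspace[OF V' W']
        bilinear_maps_comp[OF pure_bilinear[OF V' W'] f g]])

lemma tensor_map_pure:
  "v \<in> carrier V \<Longrightarrow> w \<in> carrier W \<Longrightarrow> tensor_map V' W' f g (pure V W v w) = pure V' W' (f v) (g w)"
  unfolding tensor_map_def
  by (rule tensor_lift_pure[OF V W tensor_vspace[OF V' W']
        bilinear_maps_comp[OF pure_bilinear[OF V' W'] f g]])

end

context
  fixes A :: "(complex, 'a, 'm) module_scheme" and B :: "(complex, 'b, 'n) module_scheme"
    and C :: "(complex, 'c, 'o) module_scheme"
  assumes A: "vspace A" and B: "vspace B" and C: "vspace C"
begin

private abbreviation (input) "T3 \<equiv> tensor A (tensor B C)"
private abbreviation (input) "assoc3 c \<equiv> \<lambda>a b. pure A (tensor B C) a (pure B C b c)"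

text \<open>Associativity is a lift of lifts. For fixed c the inner map comes from a bilinear map,
  so it is linear in T; linearity in c has to be proved by induction on T, since there the bilinear
  map itself varies.\<close>

lemma tensor_assoc_aux:
  "c \<in> carrier C \<Longrightarrow> assoc3 c \<in> bilinear_maps A B T3"
  "(\<lambda>T c. tensor_lift T3 (assoc3 c) T) \<in> bilinear_maps (tensor A B) C T3"
proof -
  have BC: "vspace (tensor B C)" by (rule tensor_vspace[OF B C])
  have T3: "vspace T3" by (rule tensor_vspace[OF A BC])
  have p: "pure A (tensor B C) \<in> bilinear_maps A (tensor B C) T3" by (rule pure_bilinear[OF A BC])
  have q: "pure B C \<in> bilinear_maps B C (tensor B C)" by (rule pure_bilinear[OF B C])
  show 1: "assoc3 c \<in> bilinear_maps A B T3" if c: "c \<in> carrier C" for c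
    by (rule bilinear_maps_comp[OF p lin_id bilinear_mapsD(2)[OF q c]])
  have bc: "pure B C b c \<in> carrier (tensor B C)" if "b \<in> carrier B" "c \<in> carrier C" for b c
    using pure_closed[OF B C that] .
  have abc: "assoc3 c a b \<in> carrier T3" if "a \<in> carrier A" "b \<in> carrier B" "c \<in> carrier C" for a b c
    using pure_closed[OF A BC] that bc by blast
  note L = tensor_lift_linear[OF A B T3 1] and P = tensor_lift_pure[OF A B T3 1]
  show "(\<lambda>T c. tensor_lift T3 (assoc3 c) T) \<in> bilinear_maps (tensor A B) C T3"
  proof (rule bilinear_mapsI)
    fix T assume T: "T \<in> carrier (tensor A B)"
    show "(\<lambda>c. tensor_lift T3 (assoc3 c) T) \<in> linear_maps C T3"
      using T
    proof (rule tensor_induct[OF A B])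
      fix a b assume a: "a \<in> carrier A" and b: "b \<in> carrier B"
      have "(\<lambda>c. assoc3 c a b) \<in> linear_maps C T3"
        by (rule lin_comp[OF bilinear_mapsD(1)[OF q b] bilinear_mapsD(1)[OF p a]])
      \<comment> \<open>Linearity involves only values on the carrier, so the closed form of the
        lift at a pure tensor may be substituted for it.\<close>
      then show "(\<lambda>c. tensor_lift T3 (assoc3 c) (pure A B a b)) \<in> linear_maps C T3"
        by (auto simp: linear_maps_def P a b vs_closed[OF C])
    next
      fix S T
      assume "S \<in> carrier (tensor A B)" "T \<in> carrier (tensor A B)"
        and "(\<lambda>c. tensor_lift T3 (assoc3 c) S) \<in> linear_maps C T3"
        and "(\<lambda>c. tensor_lift T3 (assoc3 c) T) \<in> linear_maps C T3"
      then have "(\<lambda>c. tensor_lift T3 (assoc3 c) S \<oplus>\<^bsub>T3\<^esub> tensor_lift T3 (assoc3 c) T) \<in> linear_maps C T3"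
        and *: "\<And>c. c \<in> carrier C \<Longrightarrow> tensor_lift T3 (assoc3 c) (S \<oplus>\<^bsub>tensor A B\<^esub> T) =
          tensor_lift T3 (assoc3 c) S \<oplus>\<^bsub>T3\<^esub> tensor_lift T3 (assoc3 c) T"
        by (auto intro: lin_plus[OF T3] simp: lin_add[OF L])
      then show "(\<lambda>c. tensor_lift T3 (assoc3 c) (S \<oplus>\<^bsub>tensor A B\<^esub> T)) \<in> linear_maps C T3"
        by (auto simp: linear_maps_def vs_closed[OF C])
    qed
  qed (rule L)
qed

lemma tensor_assoc_linear:
  "tensor_assoc A B C \<in> linear_maps (tensor (tensor A B) C) (tensor A (tensor B C))"
  unfolding tensor_assoc_def
  by (rule tensor_lift_linear[OF tensor_vspace[OF A B] C tensor_vspace[OF A tensor_vspace[OF B C]]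
        tensor_assoc_aux(2)])

lemma tensor_assoc_pure:
  assumes "a \<in> carrier A" "b \<in> carrier B" "c \<in> carrier C"
  shows "tensor_assoc A B C (pure (tensor A B) C (pure A B a b) c)
    = pure A (tensor B C) a (pure B C b c)"
  using tensor_lift_pure[OF tensor_vspace[OF A B] C tensor_vspace[OF A tensor_vspace[OF B C]]
      tensor_assoc_aux(2) pure_closed[OF A B assms(1,2)] assms(3)]
    tensor_lift_pure[OF A B tensor_vspace[OF A tensor_vspace[OF B C]]
      tensor_assoc_aux(1)[OF assms(3)] assms(1,2)]
  by (simp add: tensor_assoc_def)

end

section \<open>Enveloping algebras and Verma modules\<close>

lemma free_alg_simps [simp]:
  "carrier (free_alg L) = carrier (free_space (lists (carrier L)))"
  "s \<oplus>\<^bsub>free_alg L\<^esub> t = (\<lambda>w. s w + t w)" "c \<odot>\<^bsub>free_alg L\<^esub> t = (\<lambda>w. c * t w)"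
  "\<zero>\<^bsub>free_alg L\<^esub> = (\<lambda>_. 0)" "\<one>\<^bsub>free_alg L\<^esub> = delta []"
  "s \<otimes>\<^bsub>free_alg L\<^esub> t = (\<lambda>w. \<Sum>k\<le>length w. s (take k w) * t (drop k w))"
  by (simp_all add: free_alg_def free_space_def)

lemma free_alg_vspace: "vspace (free_alg L)"
  by (rule vspace_cong[OF free_vspace[of "lists (carrier L)"]]) (simp_all add: fun_eq_iff)

text \<open>Among all splittings of w into a prefix and a suffix only the one with prefix length
  \<open>length a\<close> can contribute, and only if w is the concatenation.\<close>

lemma delta_mult_delta:
  "delta a \<otimes>\<^bsub>free_alg L\<^esub> delta b = delta (a @ b)"
proof
  fix w
  have "(\<Sum>k\<le>length w. delta a (take k w) * delta b (drop k w)) = (if w = a @ b then 1 else 0)"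
  proof (cases "w = a @ b")
    case True
    have "(\<Sum>k\<le>length w. delta a (take k w) * delta b (drop k w))
        = (\<Sum>k\<in>{length a}. delta a (take k w) * delta b (drop k w))"
    proof (rule sum.mono_neutral_right)
      show "\<forall>i\<in>{..length w} - {length a}. delta a (take i w) * delta b (drop i w) = 0"
      proof
        fix i assume i: "i \<in> {..length w} - {length a}"
        then have "length (take i w) \<noteq> length a" by auto
        then have "take i w \<noteq> a" by metis
        then show "delta a (take i w) * delta b (drop i w) = 0" by (simp add: delta_def)
      qed
    qed (auto simp: True)
    then show ?thesis by (simp add: True delta_def)
  next
    case False
    have "delta a (take k w) * delta b (drop k w) = 0" for k
      using False by (metis append_take_drop_id delta_def mult_eq_0_iff)
    then show ?thesis using False by (auto intro!: sum.neutral)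
  qed
  then show "(delta a \<otimes>\<^bsub>free_alg L\<^esub> delta b) w = delta (a @ b) w"
    by (simp add: delta_def)
qed

text \<open>A nonzero value of the convolution at w exhibits w as a word from one support followed
  by a word from the other, so the support is covered by a finite set of concatenations.\<close>

lemma free_alg_mult_closed:
  assumes "s \<in> carrier (free_alg L)" "t \<in> carrier (free_alg L)"
  shows "s \<otimes>\<^bsub>free_alg L\<^esub> t \<in> carrier (free_alg L)"
proof -
  let ?st = "\<lambda>w. \<Sum>k\<le>length w. s (take k w) * t (drop k w)"
  let ?R = "(\<lambda>(a, b). a @ b) ` ({p. s p \<noteq> 0} \<times> {p. t p \<noteq> 0})"
  have *: "{w. ?st w \<noteq> 0} \<subseteq> ?R"
  proof
    fix w assume "w \<in> {w. ?st w \<noteq> 0}"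
    then obtain k where "s (take k w) * t (drop k w) \<noteq> 0"
      using sum.not_neutral_contains_not_neutral[of "\<lambda>k. s (take k w) * t (drop k w)"] by auto
    then have "(take k w, drop k w) \<in> {p. s p \<noteq> 0} \<times> {p. t p \<noteq> 0}" by auto
    then show "w \<in> ?R" by (intro image_eqI[of _ _ "(take k w, drop k w)"]) auto
  qed
  have "finite ?R" using assms by (auto simp: free_carrier)
  moreover have "?R \<subseteq> lists (carrier L)"
  proof -
    have "x \<in> carrier L" if "s p \<noteq> 0 \<or> t p \<noteq> 0" "x \<in> set p" for p x
      using assms that by (auto simp: free_carrier)
    then show ?thesis by (auto; blast)
  qed
  ultimately show ?thesis using * by (simp add: free_carrier) (meson finite_subset order_trans)
qed

lemma free_alg_mult_assoc:
  "(s \<otimes>\<^bsub>free_alg L\<^esub> t) \<otimes>\<^bsub>free_alg L\<^esub> u = s \<otimes>\<^bsub>free_alg L\<^esub> (t \<otimes>\<^bsub>free_alg L\<^esub> u)"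
proof
  fix w :: "'a list"
  \<comment> \<open>Both bracketings sum over the ways to cut w twice, and the reindexing is that of
    a triple Cauchy product. The third argument of \<open>?f\<close> is a dummy that matches the
    shape of \<open>fps_mult_assoc_lemma\<close>: the last piece is determined by the other
    two.\<close>
  let ?f = "\<lambda>a b (c::nat). s (take a w) * t (take b (drop a w)) * u (drop (a + b) w)"
  let ?n = "length w"
  have "((s \<otimes>\<^bsub>free_alg L\<^esub> t) \<otimes>\<^bsub>free_alg L\<^esub> u) w
      = (\<Sum>k=0..?n. \<Sum>j=0..k. ?f j (k - j) (?n - k))"
    by (auto simp: atMost_atLeast0 sum_distrib_right min.absorb1 min.absorb2 drop_take intro!: sum.cong)
  also have "\<dots> = (\<Sum>j=0..?n. \<Sum>i=0..?n - j. ?f j i (?n - j - i))"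
    by (rule fps_mult_assoc_lemma)
  also have "\<dots> = (s \<otimes>\<^bsub>free_alg L\<^esub> (t \<otimes>\<^bsub>free_alg L\<^esub> u)) w"
    by (auto simp: atMost_atLeast0 sum_distrib_left mult.assoc add.commute intro!: sum.cong)
  finally show "((s \<otimes>\<^bsub>free_alg L\<^esub> t) \<otimes>\<^bsub>free_alg L\<^esub> u) w
      = (s \<otimes>\<^bsub>free_alg L\<^esub> (t \<otimes>\<^bsub>free_alg L\<^esub> u)) w" .
qed

lemma free_alg_scalar_mult:
  "(c \<odot>\<^bsub>free_alg L\<^esub> s) \<otimes>\<^bsub>free_alg L\<^esub> t = c \<odot>\<^bsub>free_alg L\<^esub> (s \<otimes>\<^bsub>free_alg L\<^esub> t)"
  "s \<otimes>\<^bsub>free_alg L\<^esub> (c \<odot>\<^bsub>free_alg L\<^esub> t) = c \<odot>\<^bsub>free_alg L\<^esub> (s \<otimes>\<^bsub>free_alg L\<^esub> t)"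
  by (simp_all add: sum_distrib_left mult.assoc mult.left_commute)

lemma free_alg_distrib:
  "(s \<oplus>\<^bsub>free_alg L\<^esub> s') \<otimes>\<^bsub>free_alg L\<^esub> t = s \<otimes>\<^bsub>free_alg L\<^esub> t \<oplus>\<^bsub>free_alg L\<^esub> s' \<otimes>\<^bsub>free_alg L\<^esub> t"
  "s \<otimes>\<^bsub>free_alg L\<^esub> (t \<oplus>\<^bsub>free_alg L\<^esub> t') = s \<otimes>\<^bsub>free_alg L\<^esub> t \<oplus>\<^bsub>free_alg L\<^esub> s \<otimes>\<^bsub>free_alg L\<^esub> t'"
  by (simp_all add: sum.distrib algebra_simps)

lemma free_alg_one_mult:
  "delta [] \<otimes>\<^bsub>free_alg L\<^esub> t = t" "t \<otimes>\<^bsub>free_alg L\<^esub> delta [] = t"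
proof -
  have "(\<Sum>k\<le>length w. delta [] (take k w) * t (drop k w))
      = (\<Sum>k\<in>{0}. delta [] (take k w) * t (drop k w))" for w
    by (rule sum.mono_neutral_right) (auto simp: delta_def)
  then show "delta [] \<otimes>\<^bsub>free_alg L\<^esub> t = t" by (simp add: delta_def)
  have "(\<Sum>k\<le>length w. t (take k w) * delta [] (drop k w))
      = (\<Sum>k\<in>{length w}. t (take k w) * delta [] (drop k w))" for w
    by (rule sum.mono_neutral_right) (auto simp: delta_def)
  then show "t \<otimes>\<^bsub>free_alg L\<^esub> delta [] = t" by (simp add: delta_def)
qed

lemma free_alg_delta_closed: "w \<in> lists (carrier L) \<Longrightarrow> delta w \<in> carrier (free_alg L)"
  using delta_closed by simp

lemma free_alg_ring: "ring (free_alg L)"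
proof (rule ringI)
  show "abelian_group (free_alg L)" by (rule vs_abelian[OF free_alg_vspace])
  show "Group.monoid (free_alg L)"
  proof (rule monoidI)
    show "\<one>\<^bsub>free_alg L\<^esub> \<in> carrier (free_alg L)"
      using free_alg_delta_closed[of "[]" L] by simp
  qed (simp_all only: free_alg_mult_closed free_alg_mult_assoc free_alg_one_mult free_alg_simps(5))
qed (simp_all only: free_alg_distrib)

section \<open>The enveloping algebra as a quotient\<close>

context
  fixes L :: "('x, 'e) lie_algebra_scheme"
  assumes L: "is_lie_algebra L"
begin

private abbreviation (input) "A \<equiv> free_alg L"
private abbreviation (input) "E \<equiv> env_ideal L"
private abbreviation (input) "U \<equiv> env L"
private abbreviation (input) "e t \<equiv> E +>\<^bsub>A\<^esub> t"

lemma lie_vspace: "vspace L"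
  using L by (simp add: is_lie_algebra_def)

lemma lie_bracket_closed: "x \<in> carrier L \<Longrightarrow> y \<in> carrier L \<Longrightarrow> bracket L x y \<in> carrier L"
  using L lin_closed[of "bracket L x" L L y] by (simp add: is_lie_algebra_def)

lemma env_relations_closed: "env_relations L \<subseteq> carrier A"
proof -
  have sub: "(\<lambda>p. s p - t p) \<in> carrier A" if "s \<in> carrier A" "t \<in> carrier A" for s t
    using vs_add_closed[OF free_alg_vspace that(1) vs_smult_closed[OF free_alg_vspace that(2), of "-1"]] by simp
  have sm: "(\<lambda>p. c * t p) \<in> carrier A" if "t \<in> carrier A" for c t
    using vs_smult_closed[OF free_alg_vspace that, of c] by simp
  show ?thesis
    unfolding env_relations_def
    by (auto simp del: free_alg_simps(1) intro!: sub sm free_alg_delta_closed lie_bracket_closed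
        vs_closed[OF lie_vspace])
qed

lemma env_ideal_ideal: "ideal E A"
  unfolding env_ideal_def by (rule ring.genideal_ideal[OF free_alg_ring env_relations_closed])

lemma env_ideal_subspace: "subspace_of E A"
proof (rule subspaceI[OF free_alg_vspace])
  interpret ideal E A by (rule env_ideal_ideal)
  show "E \<subseteq> carrier A" by (rule a_subset)
  show "\<zero>\<^bsub>A\<^esub> \<in> E" by (rule additive_subgroup.zero_closed[OF is_additive_subgroup])
  show "v \<oplus>\<^bsub>A\<^esub> w \<in> E" if "v \<in> E" "w \<in> E" for v w using that by (rule additive_subgroup.a_closed[OF is_additive_subgroup])
  \<comment> \<open>A ring ideal absorbs scalars here because scaling by c is left multiplication by
    c times the empty word.\<close>
  show "c \<odot>\<^bsub>A\<^esub> v \<in> E" if v: "v \<in> E" for c v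
  proof -
    have "delta [] \<in> carrier A" by (rule free_alg_delta_closed) simp
    from I_l_closed[OF v vs_smult_closed[OF free_alg_vspace this, of c]]
    show ?thesis by (simp only: free_alg_scalar_mult free_alg_one_mult)
  qed
qed

lemma env_vspace: "vspace U"
  unfolding env_def by (rule quot_vspace[OF free_alg_vspace env_ideal_subspace])

lemma env_coset_linear: "(\<lambda>t. e t) \<in> linear_maps A U"
  unfolding env_def by (rule quot_coset_linear[OF free_alg_vspace env_ideal_subspace])

lemma env_carrierE:
  assumes "u \<in> carrier U" obtains t where "t \<in> carrier A" "u = e t"
  using assms quot_carrier[OF free_alg_vspace env_ideal_subspace] by (auto simp: env_def)

lemma env_mult:
  assumes "s \<in> carrier A" "t \<in> carrier A"
  shows "e s \<otimes>\<^bsub>U\<^esub> e t = e (s \<otimes>\<^bsub>A\<^esub> t)"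
  using ideal.rcoset_mult_add[OF env_ideal_ideal assms]
  by (simp add: env_def quotient_def ring.defs module.defs FactRing_def del: free_alg_simps)

lemma env_one: "\<one>\<^bsub>U\<^esub> = e (delta [])"
  by (simp add: env_def quotient_def ring.defs module.defs FactRing_def)

lemma env_one_closed: "\<one>\<^bsub>U\<^esub> \<in> carrier U"
  unfolding env_one by (rule lin_closed[OF env_coset_linear free_alg_delta_closed]) simp

lemma env_word_closed: "w \<in> lists (carrier L) \<Longrightarrow> env_word L w \<in> carrier U"
  unfolding env_word_def by (rule lin_closed[OF env_coset_linear free_alg_delta_closed])

lemma env_mult_closed:
  assumes "u \<in> carrier U" "v \<in> carrier U" shows "u \<otimes>\<^bsub>U\<^esub> v \<in> carrier U"
proof -
  obtain s where s: "s \<in> carrier A" "u = e s" using assms(1) by (rule env_carrierE)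
  obtain t where t: "t \<in> carrier A" "v = e t" using assms(2) by (rule env_carrierE)
  show ?thesis
    unfolding s t env_mult[OF s(1) t(1)]
    by (rule lin_closed[OF env_coset_linear free_alg_mult_closed[OF s(1) t(1)]])
qed

lemma env_mult_assoc:
  assumes "u \<in> carrier U" "v \<in> carrier U" "w \<in> carrier U"
  shows "(u \<otimes>\<^bsub>U\<^esub> v) \<otimes>\<^bsub>U\<^esub> w = u \<otimes>\<^bsub>U\<^esub> (v \<otimes>\<^bsub>U\<^esub> w)"
proof -
  obtain r where r: "r \<in> carrier A" "u = e r" using assms(1) by (rule env_carrierE)
  obtain s where s: "s \<in> carrier A" "v = e s" using assms(2) by (rule env_carrierE)
  obtain t where t: "t \<in> carrier A" "w = e t" using assms(3) by (rule env_carrierE)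
  show ?thesis
    unfolding r s t env_mult[OF r(1) s(1)] env_mult[OF s(1) t(1)]
      env_mult[OF free_alg_mult_closed[OF r(1) s(1)] t(1)]
      env_mult[OF r(1) free_alg_mult_closed[OF s(1) t(1)]] free_alg_mult_assoc ..
qed

lemma env_mult_linear_right:
  assumes "u \<in> carrier U" shows "(\<lambda>v. u \<otimes>\<^bsub>U\<^esub> v) \<in> linear_maps U U"
proof (rule linear_mapsI)
  obtain r where r: "r \<in> carrier A" "u = e r" using assms by (rule env_carrierE)
  note c = lin_add[OF env_coset_linear, symmetric] lin_smult[OF env_coset_linear, symmetric]
  show "u \<otimes>\<^bsub>U\<^esub> v \<in> carrier U" if "v \<in> carrier U" for v using env_mult_closed[OF assms that] .
  fix v assume v: "v \<in> carrier U"
  obtain s where s: "s \<in> carrier A" "v = e s" using v by (rule env_carrierE)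
  show "u \<otimes>\<^bsub>U\<^esub> (k \<odot>\<^bsub>U\<^esub> v) = k \<odot>\<^bsub>U\<^esub> (u \<otimes>\<^bsub>U\<^esub> v)" for k
    unfolding r s c(2)[OF s(1)] env_mult[OF r(1) s(1)] c(2)[OF free_alg_mult_closed[OF r(1) s(1)]]
      env_mult[OF r(1) vs_smult_closed[OF free_alg_vspace s(1)]] free_alg_scalar_mult ..
  fix w assume w: "w \<in> carrier U"
  obtain t where t: "t \<in> carrier A" "w = e t" using w by (rule env_carrierE)
  show "u \<otimes>\<^bsub>U\<^esub> (v \<oplus>\<^bsub>U\<^esub> w) = u \<otimes>\<^bsub>U\<^esub> v \<oplus>\<^bsub>U\<^esub> u \<otimes>\<^bsub>U\<^esub> w"
    unfolding r s t c(1)[OF s(1) t(1)] env_mult[OF r(1) s(1)] env_mult[OF r(1) t(1)]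
      c(1)[OF free_alg_mult_closed[OF r(1) s(1)] free_alg_mult_closed[OF r(1) t(1)]]
      env_mult[OF r(1) vs_add_closed[OF free_alg_vspace s(1) t(1)]] free_alg_distrib ..
qed

lemma env_one_mult:
  assumes "u \<in> carrier U" shows "\<one>\<^bsub>U\<^esub> \<otimes>\<^bsub>U\<^esub> u = u" "u \<otimes>\<^bsub>U\<^esub> \<one>\<^bsub>U\<^esub> = u"
proof -
  obtain s where s: "s \<in> carrier A" "u = e s" using assms by (rule env_carrierE)
  have o: "delta [] \<in> carrier A" by (rule free_alg_delta_closed) simp
  show "\<one>\<^bsub>U\<^esub> \<otimes>\<^bsub>U\<^esub> u = u" "u \<otimes>\<^bsub>U\<^esub> \<one>\<^bsub>U\<^esub> = u"
    unfolding s env_one env_mult[OF o s(1)] env_mult[OF s(1) o] free_alg_one_mult by (rule refl)+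
qed

text \<open>The ideal is two-sided, so a relation s - t may be multiplied on the right by any r.
  With r a representative of a vector of the Verma module this turns relations of the enveloping
  algebra into identities of the action.\<close>

lemma env_relation_mult:
  assumes "s - t \<in> env_relations L" "s \<in> carrier A" "t \<in> carrier A" "r \<in> carrier A"
  shows "e (s \<otimes>\<^bsub>A\<^esub> r) = e (t \<otimes>\<^bsub>A\<^esub> r)"
proof -
  interpret ideal E A by (rule env_ideal_ideal)
  have "s - t \<in> E"
    using ring.genideal_self[OF free_alg_ring env_relations_closed] assms(1) by (auto simp: env_ideal_def)
  then have "s \<ominus>\<^bsub>A\<^esub> t \<in> E"
    using assms by (simp add: vs_minus[OF free_alg_vspace] fun_diff_def)
  then have "(s \<ominus>\<^bsub>A\<^esub> t) \<otimes>\<^bsub>A\<^esub> r \<in> E" using assms(4) by (rule I_r_closed)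
  then have "(s \<otimes>\<^bsub>A\<^esub> r) \<ominus>\<^bsub>A\<^esub> (t \<otimes>\<^bsub>A\<^esub> r) \<in> E"
    using free_alg_distrib(1)[of L s "(-1) \<odot>\<^bsub>A\<^esub> t" r]
    by (simp only: vs_minus[OF free_alg_vspace assms(2,3)] free_alg_scalar_mult
        vs_minus[OF free_alg_vspace free_alg_mult_closed[OF assms(2,4)] free_alg_mult_closed[OF assms(3,4)]])
  then show ?thesis
    using quot_eq_iff[OF free_alg_vspace env_ideal_subspace
        free_alg_mult_closed[OF assms(2,4)] free_alg_mult_closed[OF assms(3,4)]] by blast
qed

section \<open>Verma modules: action, cyclicity, highest weight vector\<close>

context
  fixes \<hh> np :: "'x set" and \<Lambda> :: "'x \<Rightarrow> complex"
  assumes \<hh>: "\<hh> \<subseteq> carrier L" and np: "np \<subseteq> carrier L"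
begin

private abbreviation (input) "N \<equiv> verma_ideal L \<hh> np \<Lambda>"
private abbreviation (input) "M \<equiv> verma L \<hh> np \<Lambda>"
private abbreviation (input) "p u \<equiv> N +>\<^bsub>U\<^esub> u"
private abbreviation (input) "g x \<equiv> env_gen L x"
private abbreviation (input) "SS \<equiv> g ` np \<union> (\<lambda>t. g t \<ominus>\<^bsub>U\<^esub> (\<Lambda> t \<odot>\<^bsub>U\<^esub> \<one>\<^bsub>U\<^esub>)) ` \<hh>"

lemma env_gen_closed: "x \<in> carrier L \<Longrightarrow> g x \<in> carrier U"
  by (rule env_word_closed) simp

lemma verma_generators_closed: "SS \<subseteq> carrier U"
  using \<hh> np by (auto intro!: env_gen_closed vs_minus_closed[OF env_vspace]
      vs_smult_closed[OF env_vspace] env_one_closed)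

lemma verma_generators_closed':
  "{u \<otimes>\<^bsub>U\<^esub> s | u s. u \<in> carrier U \<and> s \<in> SS} \<subseteq> carrier U"
proof
  fix v assume "v \<in> {u \<otimes>\<^bsub>U\<^esub> s | u s. u \<in> carrier U \<and> s \<in> SS}"
  then obtain u s where "v = u \<otimes>\<^bsub>U\<^esub> s" "u \<in> carrier U" "s \<in> SS" by blast
  then show "v \<in> carrier U" using env_mult_closed subsetD[OF verma_generators_closed] by simp
qed

lemma verma_ideal_subspace: "subspace_of N U"
  unfolding verma_ideal_def by (rule lin_span_subspace[OF env_vspace verma_generators_closed'])

lemma verma_ideal_generator:
  assumes "s \<in> SS" shows "s \<in> N"
proof -
  have "\<one>\<^bsub>U\<^esub> \<otimes>\<^bsub>U\<^esub> s = s" by (rule env_one_mult(1)[OF subsetD[OF verma_generators_closed assms]])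
  then have "s \<in> {u \<otimes>\<^bsub>U\<^esub> s | u s. u \<in> carrier U \<and> s \<in> SS}"
    using assms env_one_closed by (intro CollectI exI[of _ "\<one>\<^bsub>U\<^esub>"] exI[of _ s] conjI) simp_all
  then show ?thesis unfolding verma_ideal_def by (rule lin_span_base)
qed

text \<open>Left multiples are built into the generating set, so multiplying a generator by u only
  changes its first factor. This is what makes the action on the quotient well defined.\<close>

lemma verma_ideal_left:
  assumes u: "u \<in> carrier U" and n: "n \<in> N" shows "u \<otimes>\<^bsub>U\<^esub> n \<in> N"
  using n[unfolded verma_ideal_def]
proof (rule lin_span_induct[OF env_vspace verma_generators_closed'])
  note l = env_mult_linear_right[OF u]
  show "u \<otimes>\<^bsub>U\<^esub> \<zero>\<^bsub>U\<^esub> \<in> N"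
    unfolding lin_zero[OF env_vspace env_vspace l] by (rule subspace_zero[OF env_vspace verma_ideal_subspace])
  fix s assume "s \<in> {u \<otimes>\<^bsub>U\<^esub> s | u s. u \<in> carrier U \<and> s \<in> SS}"
  then obtain v r where vr: "v \<in> carrier U" "r \<in> SS" "s = v \<otimes>\<^bsub>U\<^esub> r" by blast
  then have "u \<otimes>\<^bsub>U\<^esub> s = (u \<otimes>\<^bsub>U\<^esub> v) \<otimes>\<^bsub>U\<^esub> r"
    using env_mult_assoc[OF u vr(1) subsetD[OF verma_generators_closed vr(2)]] by simp
  moreover have "u \<otimes>\<^bsub>U\<^esub> v \<in> carrier U" using env_mult_closed[OF u] vr by blast
  ultimately have "u \<otimes>\<^bsub>U\<^esub> s \<in> {u \<otimes>\<^bsub>U\<^esub> s | u s. u \<in> carrier U \<and> s \<in> SS}"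
    using vr(2) by (intro CollectI exI[of _ "u \<otimes>\<^bsub>U\<^esub> v"] exI[of _ r] conjI)
  then show "u \<otimes>\<^bsub>U\<^esub> s \<in> N" unfolding verma_ideal_def by (rule lin_span_base)
next
  note l = env_mult_linear_right[OF u]
  fix v assume v: "v \<in> carrier U" and uv: "u \<otimes>\<^bsub>U\<^esub> v \<in> N"
  show "u \<otimes>\<^bsub>U\<^esub> (c \<odot>\<^bsub>U\<^esub> v) \<in> N" for c
    unfolding lin_smult[OF l v] by (rule subspace_smult[OF env_vspace verma_ideal_subspace uv])
  fix w assume w: "w \<in> carrier U" and uw: "u \<otimes>\<^bsub>U\<^esub> w \<in> N"
  show "u \<otimes>\<^bsub>U\<^esub> (v \<oplus>\<^bsub>U\<^esub> w) \<in> N"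
    unfolding lin_add[OF l v w] by (rule subspace_add[OF env_vspace verma_ideal_subspace uv uw])
qed

lemma verma_simps:
  "carrier M = carrier (quotient U N)" "add M = add (quotient U N)" "zero M = zero (quotient U N)"
  "smult M = smult (quotient U N)"
  by (simp_all add: verma_def module.defs lie_module.defs)

lemma verma_vspace: "vspace M"
  by (rule vspace_cong[OF quot_vspace[OF env_vspace verma_ideal_subspace]]) (simp_all add: verma_simps)

lemma verma_coset_linear: "(\<lambda>u. p u) \<in> linear_maps U M"
  using quot_coset_linear[OF env_vspace verma_ideal_subspace]
  by (simp add: linear_maps_def verma_simps)

lemma verma_carrierE:
  assumes "m \<in> carrier M" obtains u where "u \<in> carrier U" "m = p u"
  using assms quot_carrier[OF env_vspace verma_ideal_subspace] by (auto simp: verma_simps)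

lemma verma_act:
  assumes x: "x \<in> carrier L" and u: "u \<in> carrier U"
  shows "act M x (p u) = p (g x \<otimes>\<^bsub>U\<^esub> u)"
proof -
  note l = env_mult_linear_right[OF env_gen_closed[OF x]]
  have *: "p (g x \<otimes>\<^bsub>U\<^esub> v) = p (g x \<otimes>\<^bsub>U\<^esub> u)" if "v \<in> p u" for v
  proof -
    have v: "v \<in> carrier U" "v \<ominus>\<^bsub>U\<^esub> u \<in> N"
      using that quot_mem_iff[OF env_vspace verma_ideal_subspace u]
        quot_eq_iff[OF env_vspace verma_ideal_subspace _ u] by blast+
    then have "g x \<otimes>\<^bsub>U\<^esub> (v \<ominus>\<^bsub>U\<^esub> u) \<in> N" using verma_ideal_left[OF env_gen_closed[OF x]] by blast
    then have "g x \<otimes>\<^bsub>U\<^esub> v \<ominus>\<^bsub>U\<^esub> g x \<otimes>\<^bsub>U\<^esub> u \<in> N"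
      using lin_minus[OF env_vspace env_vspace l v(1) u] by simp
    then show ?thesis
      using quot_eq_iff[OF env_vspace verma_ideal_subspace] env_mult_closed[OF env_gen_closed[OF x]] u v(1)
      by blast
  qed
  have "u \<in> p u" using quot_mem_iff[OF env_vspace verma_ideal_subspace u] u by blast
  then have "(\<Union>v\<in>p u. p (g x \<otimes>\<^bsub>U\<^esub> v)) = p (g x \<otimes>\<^bsub>U\<^esub> u)" using * by blast
  then show ?thesis by (simp add: verma_def module.defs lie_module.defs)
qed

private abbreviation (input) "q t \<equiv> p (e t)"

lemma verma_free_linear: "(\<lambda>t. q t) \<in> linear_maps A M"
  by (rule lin_comp[OF env_coset_linear verma_coset_linear])

lemma verma_freeE:
  assumes "m \<in> carrier M" obtains t where "t \<in> carrier A" "m = q t"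
  using assms verma_carrierE env_carrierE by metis

text \<open>The quotients by \<open>env_ideal\<close> and by \<open>verma_ideal\<close> are treated
  as one map from the free algebra. Through it a Lie algebra element acts by left multiplication
  with its letter, and the module axioms become computations with words.\<close>

lemma verma_act_free:
  assumes "x \<in> carrier L" "t \<in> carrier A"
  shows "act M x (q t) = q (delta [x] \<otimes>\<^bsub>A\<^esub> t)"
proof -
  have d: "delta [x] \<in> carrier A" using assms(1) by (intro free_alg_delta_closed) simp
  show ?thesis
    using verma_act[OF assms(1) lin_closed[OF env_coset_linear assms(2)]] env_mult[OF d assms(2)]
    by (simp only: env_word_def)
qed

lemma verma_vec_eq: "verma_vec L \<hh> np \<Lambda> = q (delta [])"
  by (simp add: verma_vec_def env_one)

lemma verma_vec_closed: "verma_vec L \<hh> np \<Lambda> \<in> carrier M"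
  unfolding verma_vec_def by (rule lin_closed[OF verma_coset_linear env_one_closed])

text \<open>Linearity in the vector is linearity of the product in the free algebra. Linearity in
  the Lie algebra element and the bracket rule come from the three families in
  \<open>env_relations\<close>, each multiplied by a representative of the vector.\<close>

lemma verma_lie_module: "is_lie_module L M"
  unfolding is_lie_module_def
proof (intro conjI ballI)
  show "vspace M" by (rule verma_vspace)
  have d: "delta [x] \<in> carrier A" if "x \<in> carrier L" for x
    using that by (intro free_alg_delta_closed) simp
  note M_add = lin_add[OF verma_free_linear] and M_smult = lin_smult[OF verma_free_linear]
  have closed: "act M x m \<in> carrier M" if "x \<in> carrier L" "m \<in> carrier M" for x m
    using that verma_act_free lin_closed[OF verma_free_linear free_alg_mult_closed[OF d]]
    by (metis verma_freeE)
  fix x assume x: "x \<in> carrier L"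
  show "act M x \<in> linear_maps M M"
  proof (rule linear_mapsI)
    show "act M x m \<in> carrier M" if "m \<in> carrier M" for m using closed[OF x that] .
    fix m assume m: "m \<in> carrier M"
    obtain s where s: "s \<in> carrier A" "m = q s" using m by (rule verma_freeE)
    note ds = free_alg_mult_closed[OF d[OF x] s(1)]
    show "act M x (c \<odot>\<^bsub>M\<^esub> m) = c \<odot>\<^bsub>M\<^esub> act M x m" for c
      unfolding s M_smult[OF s(1), symmetric] verma_act_free[OF x s(1)] M_smult[OF ds, symmetric]
        verma_act_free[OF x vs_smult_closed[OF free_alg_vspace s(1)]] free_alg_scalar_mult ..
    fix m' assume m': "m' \<in> carrier M"
    obtain t where t: "t \<in> carrier A" "m' = q t" using m' by (rule verma_freeE)
    note dt = free_alg_mult_closed[OF d[OF x] t(1)]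
    show "act M x (m \<oplus>\<^bsub>M\<^esub> m') = act M x m \<oplus>\<^bsub>M\<^esub> act M x m'"
      unfolding s t M_add[OF s(1) t(1), symmetric] verma_act_free[OF x s(1)] verma_act_free[OF x t(1)]
        M_add[OF ds dt, symmetric]
        verma_act_free[OF x vs_add_closed[OF free_alg_vspace s(1) t(1)]] free_alg_distrib ..
  qed
next
  have d: "delta w \<in> carrier A" if "w \<in> lists (carrier L)" for w
    using that by (intro free_alg_delta_closed) simp
  note M_add = lin_add[OF verma_free_linear] and M_smult = lin_smult[OF verma_free_linear]
  fix m assume m: "m \<in> carrier M"
  obtain t where t: "t \<in> carrier A" "m = q t" using m by (rule verma_freeE)
  have act_m: "act M x m = q (delta [x] \<otimes>\<^bsub>A\<^esub> t)" if "x \<in> carrier L" for x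
    unfolding t by (rule verma_act_free[OF that t(1)])
  show "(\<lambda>x. act M x m) \<in> linear_maps L M"
  proof (rule linear_mapsI)
    fix x assume x: "x \<in> carrier L"
    then have dx: "delta [x] \<in> carrier A" by (intro d) simp
    note dxt = free_alg_mult_closed[OF dx t(1)]
    show "act M x m \<in> carrier M"
      unfolding act_m[OF x] by (rule lin_closed[OF verma_free_linear dxt])
    fix c
    have cx: "c \<odot>\<^bsub>L\<^esub> x \<in> carrier L" by (rule vs_smult_closed[OF lie_vspace x])
    have dcx: "delta [c \<odot>\<^bsub>L\<^esub> x] \<in> carrier A" using cx by (intro d) simp
    have "delta [c \<odot>\<^bsub>L\<^esub> x] - c \<odot>\<^bsub>A\<^esub> delta [x] \<in> env_relations L"
      unfolding env_relations_def fun_diff_def using x by auto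
    from env_relation_mult[OF this dcx vs_smult_closed[OF free_alg_vspace dx] t(1)]
    show "act M (c \<odot>\<^bsub>L\<^esub> x) m = c \<odot>\<^bsub>M\<^esub> act M x m"
      unfolding act_m[OF cx] act_m[OF x] M_smult[OF dxt, symmetric] free_alg_scalar_mult by simp
  next
    fix x y assume x: "x \<in> carrier L" and y: "y \<in> carrier L"
    then have xy: "x \<oplus>\<^bsub>L\<^esub> y \<in> carrier L" by (rule vs_add_closed[OF lie_vspace])
    have D: "delta [x] \<in> carrier A" "delta [y] \<in> carrier A" "delta [x \<oplus>\<^bsub>L\<^esub> y] \<in> carrier A"
      using x y xy by (auto intro!: d simp del: free_alg_simps(1))
    have "delta [x \<oplus>\<^bsub>L\<^esub> y] - (delta [x] \<oplus>\<^bsub>A\<^esub> delta [y]) \<in> env_relations L"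
      unfolding env_relations_def fun_diff_def using x y
      by (intro UnI1 CollectI exI[of _ x] exI[of _ y]) (auto simp: fun_eq_iff)
    from env_relation_mult[OF this D(3) vs_add_closed[OF free_alg_vspace D(1,2)] t(1)]
    show "act M (x \<oplus>\<^bsub>L\<^esub> y) m = act M x m \<oplus>\<^bsub>M\<^esub> act M y m"
      unfolding act_m[OF xy] act_m[OF x] act_m[OF y] free_alg_distrib
        M_add[OF free_alg_mult_closed[OF D(1) t(1)] free_alg_mult_closed[OF D(2) t(1)], symmetric]
      by simp
  qed
next
  have d: "delta w \<in> carrier A" if "w \<in> lists (carrier L)" for w
    using that by (intro free_alg_delta_closed) simp
  fix x y m assume x: "x \<in> carrier L" and y: "y \<in> carrier L" and m: "m \<in> carrier M"
  obtain t where t: "t \<in> carrier A" "m = q t" using m by (rule verma_freeE)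
  let ?z = "bracket L x y"
  have z: "?z \<in> carrier L" by (rule lie_bracket_closed[OF x y])
  have D: "delta [x] \<in> carrier A" "delta [y] \<in> carrier A" "delta [?z] \<in> carrier A"
    "delta [x, y] \<in> carrier A" "delta [y, x] \<in> carrier A"
    using x y z by (auto intro!: d simp del: free_alg_simps(1))
  have act_t: "act M a (act M b m) = q (delta [a, b] \<otimes>\<^bsub>A\<^esub> t)" if "a \<in> carrier L" "b \<in> carrier L" for a b
  proof -
    have "delta [b] \<in> carrier A" using that by (intro d) simp
    then have "act M a (act M b m) = q (delta [a] \<otimes>\<^bsub>A\<^esub> (delta [b] \<otimes>\<^bsub>A\<^esub> t))"
      unfolding t verma_act_free[OF that(2) t(1)]
      by (rule verma_act_free[OF that(1) free_alg_mult_closed[OF _ t(1)]])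
    also have "\<dots> = q (delta [a, b] \<otimes>\<^bsub>A\<^esub> t)"
      unfolding free_alg_mult_assoc[symmetric] delta_mult_delta by simp
    finally show ?thesis .
  qed
  \<comment> \<open>The relation xy - yx = [x, y], arranged as a single difference so that
    \<open>env_relation_mult\<close> applies.\<close>
  have "(delta [x, y] \<oplus>\<^bsub>A\<^esub> (-1) \<odot>\<^bsub>A\<^esub> delta [y, x]) - delta [?z] \<in> env_relations L"
    unfolding env_relations_def fun_diff_def using x y
    by (intro UnI2 CollectI exI[of _ x] exI[of _ y]) (auto simp: fun_eq_iff)
  from env_relation_mult[OF this vs_add_closed[OF free_alg_vspace D(4) vs_smult_closed[OF free_alg_vspace D(5)]] D(3) t(1)]
  have "q (delta [?z] \<otimes>\<^bsub>A\<^esub> t) = q ((delta [x, y] \<oplus>\<^bsub>A\<^esub> (-1) \<odot>\<^bsub>A\<^esub> delta [y, x]) \<otimes>\<^bsub>A\<^esub> t)" by simp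
  also have "\<dots> = q (delta [x, y] \<otimes>\<^bsub>A\<^esub> t) \<oplus>\<^bsub>M\<^esub> (-1) \<odot>\<^bsub>M\<^esub> q (delta [y, x] \<otimes>\<^bsub>A\<^esub> t)"
    unfolding free_alg_distrib free_alg_scalar_mult
      lin_add[OF verma_free_linear free_alg_mult_closed[OF D(4) t(1)]
        vs_smult_closed[OF free_alg_vspace free_alg_mult_closed[OF D(5) t(1)]]]
      lin_smult[OF verma_free_linear free_alg_mult_closed[OF D(5) t(1)]] ..
  also have "\<dots> = q (delta [x, y] \<otimes>\<^bsub>A\<^esub> t) \<ominus>\<^bsub>M\<^esub> q (delta [y, x] \<otimes>\<^bsub>A\<^esub> t)"
    by (rule vs_minus[OF verma_vspace, symmetric])
       (rule lin_closed[OF verma_free_linear free_alg_mult_closed[OF _ t(1)]], rule D)+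
  finally show "act M ?z m = act M x (act M y m) \<ominus>\<^bsub>M\<^esub> act M y (act M x m)"
    using verma_act_free[OF z t(1)] by (simp only: act_t[OF x y] act_t[OF y x] t(2)[symmetric])
qed

text \<open>Words applied to the highest weight vector span the module, and a stable subspace
  containing that vector contains them all, by induction on the word. It serves to extend properties
  from the highest weight vector to all of \<open>M\<close>.\<close>

lemma verma_cyclic:
  assumes K: "subspace_of K M" and stable: "\<And>x m. x \<in> carrier L \<Longrightarrow> m \<in> K \<Longrightarrow> act M x m \<in> K"
    and I: "verma_vec L \<hh> np \<Lambda> \<in> K"
  shows "K = carrier M"
proof
  show "K \<subseteq> carrier M" by (rule subspace_subset[OF verma_vspace K])
  have word: "q (delta w) \<in> K" if "w \<in> lists (carrier L)" for w
    using that
  proof (induction w)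
    case Nil
    then show ?case using I by (simp add: verma_vec_eq)
  next
    case (Cons x w)
    then have "act M x (q (delta w)) \<in> K" by (intro stable) auto
    then show ?case
      using verma_act_free[of x "delta w"] free_alg_delta_closed[of w L] Cons
      by (simp only: delta_mult_delta) (auto simp: delta_mult_delta)
  qed
  show "carrier M \<subseteq> K"
  proof
    fix m assume "m \<in> carrier M"
    then obtain t where t: "t \<in> carrier A" "m = q t" by (rule verma_freeE)
    have "q t \<in> K" using t(1)[unfolded free_alg_simps]
    proof (rule free_induct)
      show "q (\<lambda>_. 0) \<in> K"
        using lin_zero[OF free_alg_vspace verma_vspace verma_free_linear]
          subspace_zero[OF verma_vspace K] by simp
      fix c w t assume w: "w \<in> lists (carrier L)" and t: "t \<in> carrier (free_space (lists (carrier L)))"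
        and qt: "q t \<in> K"
      have dw: "delta w \<in> carrier A" and t': "t \<in> carrier A"
        using free_alg_delta_closed[OF w] t by simp_all
      have "q (c \<odot>\<^bsub>A\<^esub> delta w \<oplus>\<^bsub>A\<^esub> t) = c \<odot>\<^bsub>M\<^esub> q (delta w) \<oplus>\<^bsub>M\<^esub> q t"
        using lin_add[OF verma_free_linear vs_smult_closed[OF free_alg_vspace dw] t', of c]
          lin_smult[OF verma_free_linear dw, of c] by (simp only:)
      also have "\<dots> \<in> K"
        by (rule subspace_add[OF verma_vspace K subspace_smult[OF verma_vspace K word[OF w]] qt])
      finally show "q (\<lambda>v. c * delta w v + t v) \<in> K" by simp
    qed
    then show "m \<in> K" using t by simp
  qed
qed

lemma verma_highest_np:
  assumes x: "x \<in> np" shows "act M x (verma_vec L \<hh> np \<Lambda>) = \<zero>\<^bsub>M\<^esub>"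
proof -
  have xL: "x \<in> carrier L" using x np by auto
  have "g x \<in> N" by (rule verma_ideal_generator) (use x in auto)
  then have "p (g x) = \<zero>\<^bsub>M\<^esub>"
    using quot_eq_zero_iff[OF env_vspace verma_ideal_subspace env_gen_closed[OF xL]]
    by (simp add: verma_simps)
  then show ?thesis
    unfolding verma_vec_def verma_act[OF xL env_one_closed] env_one_mult(2)[OF env_gen_closed[OF xL]] .
qed

lemma verma_highest_weight:
  assumes x: "x \<in> \<hh>" shows "act M x (verma_vec L \<hh> np \<Lambda>) = \<Lambda> x \<odot>\<^bsub>M\<^esub> verma_vec L \<hh> np \<Lambda>"
proof -
  have xL: "x \<in> carrier L" using x \<hh> by auto
  have "g x \<ominus>\<^bsub>U\<^esub> (\<Lambda> x \<odot>\<^bsub>U\<^esub> \<one>\<^bsub>U\<^esub>) \<in> N" by (rule verma_ideal_generator) (use x in auto)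
  then have "p (g x) = p (\<Lambda> x \<odot>\<^bsub>U\<^esub> \<one>\<^bsub>U\<^esub>)"
    using quot_eq_iff[OF env_vspace verma_ideal_subspace env_gen_closed[OF xL]
        vs_smult_closed[OF env_vspace env_one_closed]] by blast
  then show ?thesis
    unfolding verma_vec_def verma_act[OF xL env_one_closed] env_one_mult(2)[OF env_gen_closed[OF xL]]
      lin_smult[OF verma_coset_linear env_one_closed] .
qed

end

end

section \<open>Weights of Verma modules and leading terms\<close>

text \<open>Finitely many of the operators T - d with d \<noteq> c compose to one that annihilates
  x: each generator occurring in x is killed by one of them, and they commute. On x itself the
  composite is multiplication by the product of the c - d, a nonzero scalar.\<close>

lemma eigenvectors_independent:
  assumes V: "vspace V" and T: "T \<in> linear_maps V V" and S: "S \<subseteq> carrier V"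
    and eigen: "\<And>s. s \<in> S \<Longrightarrow> \<exists>d. d \<noteq> c \<and> T s = d \<odot>\<^bsub>V\<^esub> s"
    and x: "x \<in> lin_span V S" and Tx: "T x = c \<odot>\<^bsub>V\<^esub> x"
  shows "x = \<zero>\<^bsub>V\<^esub>"
proof -
  \<comment> \<open>\<open>step d\<close> is T - d, and \<open>D ds\<close> is the product over a
    list of eigenvalues; x determines which finite list is used.\<close>
  define step where "step = (\<lambda>d v. T v \<oplus>\<^bsub>V\<^esub> (- d) \<odot>\<^bsub>V\<^esub> v)"
  define D where "D = (\<lambda>ds v. foldr step ds v)"
  have lin: "step d \<in> linear_maps V V" for d
    unfolding step_def by (rule lin_plus[OF V T lin_scale[OF V lin_id]])
  have D_lin: "D ds \<in> linear_maps V V" for ds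
  proof (induction ds)
    case Nil
    then show ?case using lin_id by (simp add: D_def)
  next
    case (Cons d ds)
    from lin_comp[OF Cons.IH lin] show ?case by (simp add: D_def)
  qed
  have comm: "step d (step e v) = step e (step d v)" if "v \<in> carrier V" for d e v
    using that
    by (simp add: step_def lin_closed[OF T] lin_add[OF T] lin_smult[OF T] vs_closed[OF V]
        vs_simps[OF V] mult.commute)
  have comm1: "D ds (step e v) = step e (D ds v)" if "v \<in> carrier V" for ds e v
    by (induction ds) (simp_all add: D_def that comm lin_closed[OF D_lin[unfolded D_def]])
  have comm2: "D ds (D es v) = D es (D ds v)" if v: "v \<in> carrier V" for ds es v
  proof (induction es)
    case (Cons e es)
    have "D ds (D (e # es) v) = step e (D ds (D es v))"
      using comm1[OF lin_closed[OF D_lin v]] by (simp add: D_def)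
    then show ?case using Cons by (simp add: D_def)
  qed (simp add: D_def)
  have app: "D (ds @ es) v = D ds (D es v)" for ds es v by (simp add: D_def)
  have zero: "D ds \<zero>\<^bsub>V\<^esub> = \<zero>\<^bsub>V\<^esub>" for ds by (rule lin_zero[OF V V D_lin])
  have sub: "lin_span V S \<subseteq> carrier V" by (rule subspace_subset[OF V lin_span_subspace[OF V S]])
  have "\<exists>ds. c \<notin> set ds \<and> D ds x = \<zero>\<^bsub>V\<^esub>"
    using x
  proof (rule lin_span_induct[OF V S])
    show "\<exists>ds. c \<notin> set ds \<and> D ds \<zero>\<^bsub>V\<^esub> = \<zero>\<^bsub>V\<^esub>" by (rule exI[of _ "[]"]) (simp add: D_def)
    fix s assume s: "s \<in> S"
    obtain d where d: "d \<noteq> c" "T s = d \<odot>\<^bsub>V\<^esub> s" using eigen[OF s] by blast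
    have "s \<in> carrier V" using s S by auto
    then have "D [d] s = \<zero>\<^bsub>V\<^esub>"
      using d(2) vs_smult_l[OF V, of s d "-d"] by (simp add: D_def step_def vs_simps[OF V])
    then show "\<exists>ds. c \<notin> set ds \<and> D ds s = \<zero>\<^bsub>V\<^esub>" using d(1) by (intro exI[of _ "[d]"]) auto
  next
    fix v w assume v: "v \<in> carrier V" and w: "w \<in> carrier V"
      and "\<exists>ds. c \<notin> set ds \<and> D ds v = \<zero>\<^bsub>V\<^esub>" "\<exists>ds. c \<notin> set ds \<and> D ds w = \<zero>\<^bsub>V\<^esub>"
    then obtain ds es where ds: "c \<notin> set ds" "D ds v = \<zero>\<^bsub>V\<^esub>" and es: "c \<notin> set es" "D es w = \<zero>\<^bsub>V\<^esub>"
      by blast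
    \<comment> \<open>The concatenated list kills both summands: the operators commute, so the
      product that annihilates a summand can be applied to it first.\<close>
    have "D (ds @ es) (v \<oplus>\<^bsub>V\<^esub> w) = D es (D ds v) \<oplus>\<^bsub>V\<^esub> D ds (D es w)"
      using lin_add[OF D_lin v w, of "ds @ es"] by (simp add: app comm2[OF v, of ds es])
    then have "D (ds @ es) (v \<oplus>\<^bsub>V\<^esub> w) = \<zero>\<^bsub>V\<^esub>"
      by (simp add: ds es zero vs_zero_l[OF V] vs_zero_closed[OF V])
    then show "\<exists>ds. c \<notin> set ds \<and> D ds (v \<oplus>\<^bsub>V\<^esub> w) = \<zero>\<^bsub>V\<^esub>"
      using ds es by (intro exI[of _ "ds @ es"]) auto
  next
    fix k v assume "v \<in> carrier V" "\<exists>ds. c \<notin> set ds \<and> D ds v = \<zero>\<^bsub>V\<^esub>"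
    then show "\<exists>ds. c \<notin> set ds \<and> D ds (k \<odot>\<^bsub>V\<^esub> v) = \<zero>\<^bsub>V\<^esub>"
      using lin_smult[OF D_lin] vs_smult_zero_r[OF V] by metis
  qed
  then obtain ds where ds: "c \<notin> set ds" "D ds x = \<zero>\<^bsub>V\<^esub>" by blast
  have xV: "x \<in> carrier V" using x sub by blast
  \<comment> \<open>The witness is the product of the differences c - d over the list; it is nonzero
    because c does not occur there.\<close>
  have "\<exists>k. k \<noteq> 0 \<and> D ds x = k \<odot>\<^bsub>V\<^esub> x" using ds(1)
  proof (induction ds)
    case Nil
    show ?case by (rule exI[of _ 1]) (simp add: D_def vs_one[OF V xV])
  next
    case (Cons d ds)
    then obtain k where k: "k \<noteq> 0" "D ds x = k \<odot>\<^bsub>V\<^esub> x" by auto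
    have "D (d # ds) x = step d (k \<odot>\<^bsub>V\<^esub> x)" using k(2) by (simp add: D_def)
    also have "\<dots> = ((c - d) * k) \<odot>\<^bsub>V\<^esub> x"
      using vs_smult_l[OF V xV, of "k * c" "- (d * k)"]
      by (simp add: step_def lin_smult[OF T xV] Tx vs_smult_assoc[OF V xV] algebra_simps)
    finally show ?case using Cons.prems k(1) by (intro exI[of _ "(c - d) * k"]) auto
  qed
  then obtain k where k: "k \<noteq> 0" "k \<odot>\<^bsub>V\<^esub> x = \<zero>\<^bsub>V\<^esub>" using ds(2) by auto
  then have "(1 / k) \<odot>\<^bsub>V\<^esub> (k \<odot>\<^bsub>V\<^esub> x) = \<zero>\<^bsub>V\<^esub>" by (simp add: vs_smult_zero_r[OF V])
  then show ?thesis using k(1) by (simp add: vs_smult_assoc[OF V xV] vs_one[OF V xV])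
qed

lemma
  assumes "is_lie_module L V"
  shows lm_act_linear: "\<And>x. x \<in> carrier L \<Longrightarrow> act V x \<in> linear_maps V V"
    and lm_act_linear_left: "\<And>v. v \<in> carrier V \<Longrightarrow> (\<lambda>x. act V x v) \<in> linear_maps L V"
    and lm_bracket: "\<And>x y v. x \<in> carrier L \<Longrightarrow> y \<in> carrier L \<Longrightarrow> v \<in> carrier V \<Longrightarrow>
      act V (bracket L x y) v = act V x (act V y v) \<ominus>\<^bsub>V\<^esub> act V y (act V x v)"
  using assms by (auto simp: is_lie_module_def)

lemma root_space_subset: "root_space L \<hh> \<alpha> \<subseteq> carrier L"
  by (auto simp: root_space_def)

lemma triangularE:
  assumes "is_lie_algebra L" "triangular_decomposition L \<hh> np nm"
  obtains t P where "t \<in> \<hh>" "\<forall>\<alpha>\<in>roots L \<hh>. \<alpha> t \<in> \<real> \<and> \<alpha> t \<noteq> 0"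
    "P = {\<alpha> \<in> roots L \<hh>. Re (\<alpha> t) > 0}"
    "np = lin_span L (\<Union>\<alpha>\<in>P. root_space L \<hh> \<alpha>)"
    "nm = lin_span L (\<Union>\<alpha>\<in>P. root_space L \<hh> (\<lambda>t. - \<alpha> t))"
    "np \<subseteq> carrier L" "nm \<subseteq> carrier L"
    "\<forall>x\<in>carrier L. \<exists>a\<in>np. \<exists>t\<in>\<hh>. \<exists>b\<in>nm. x = a \<oplus>\<^bsub>L\<^esub> t \<oplus>\<^bsub>L\<^esub> b"
proof -
  note tri = assms(2)[unfolded triangular_decomposition_def]
  obtain P where "positive_system L \<hh> P \<and> np = lin_span L (\<Union>\<alpha>\<in>P. root_space L \<hh> \<alpha>) \<and>
    nm = lin_span L (\<Union>\<alpha>\<in>P. root_space L \<hh> (\<lambda>t. - \<alpha> t))"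
    using conjunct1[OF tri] by (elim exE)
  note P = conjunct1[OF this] conjunct1[OF conjunct2[OF this]] conjunct2[OF conjunct2[OF this]]
  obtain t where t: "t \<in> \<hh>" "\<forall>\<alpha>\<in>roots L \<hh>. \<alpha> t \<in> \<real> \<and> \<alpha> t \<noteq> 0" and PP: "P = {\<alpha> \<in> roots L \<hh>. Re (\<alpha> t) > 0}"
    using P(1) unfolding positive_system_def by (elim bexE conjE)
  have dec: "\<exists>a\<in>np. \<exists>t\<in>\<hh>. \<exists>b\<in>nm. x = a \<oplus>\<^bsub>L\<^esub> t \<oplus>\<^bsub>L\<^esub> b" if x: "x \<in> carrier L" for x
  proof -
    obtain p where "case p of (a, t, b) \<Rightarrow> a \<in> np \<and> t \<in> \<hh> \<and> b \<in> nm \<and> x = a \<oplus>\<^bsub>L\<^esub> t \<oplus>\<^bsub>L\<^esub> b"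
      using ex1_implies_ex[OF bspec[OF conjunct2[OF tri] x]] by (elim exE)
    then show ?thesis by (cases p) auto
  qed
  have sub: "lin_span L S \<subseteq> carrier L" if "S \<subseteq> carrier L" for S
    by (rule subspace_subset[OF lie_vspace[OF assms(1)] lin_span_subspace[OF lie_vspace[OF assms(1)] that]])
  have np_nm: "np \<subseteq> carrier L" "nm \<subseteq> carrier L"
    unfolding P by (rule sub, rule UN_least, rule root_space_subset)+
  show ?thesis
    by (rule that[OF t PP P(2,3) np_nm]) (rule ballI, rule dec)
qed

text \<open>The regular element t that defines the positive roots has positive real part on every
  nonzero element of the cone. So comparable distinct weights differ already at t, and weight
  vectors are separated by the single operator of t. The last clause later keeps the weight of a
  nonempty monomial strictly below \<Lambda>.\<close>

lemma weight_less_separated: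
  assumes L: "is_lie_algebra L" and \<hh>: "\<hh> \<subseteq> carrier L" and tri: "triangular_decomposition L \<hh> np nm"
  obtains t where "t \<in> \<hh>" "\<forall>\<mu> \<Lambda>. weight_less L \<hh> np \<mu> \<Lambda> \<longrightarrow> \<mu> t \<noteq> \<Lambda> t"
    "\<forall>\<beta>\<in>positive_cone L \<hh> np. \<forall>\<alpha>\<in>roots L \<hh>. root_space L \<hh> \<alpha> \<subseteq> np \<longrightarrow> \<beta> t + \<alpha> t \<noteq> 0"
proof -
  note V = lie_vspace[OF L]
  obtain t P where t: "t \<in> \<hh>" "\<forall>\<alpha>\<in>roots L \<hh>. \<alpha> t \<in> \<real> \<and> \<alpha> t \<noteq> 0"
    and P: "P = {\<alpha> \<in> roots L \<hh>. Re (\<alpha> t) > 0}"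
    and np: "np = lin_span L (\<Union>\<alpha>\<in>P. root_space L \<hh> \<alpha>)"
    and nm: "nm = lin_span L (\<Union>\<alpha>\<in>P. root_space L \<hh> (\<lambda>t. - \<alpha> t))"
    and npL: "np \<subseteq> carrier L" and nmL: "nm \<subseteq> carrier L"
    and dec: "\<forall>x\<in>carrier L. \<exists>a\<in>np. \<exists>t\<in>\<hh>. \<exists>b\<in>nm. x = a \<oplus>\<^bsub>L\<^esub> t \<oplus>\<^bsub>L\<^esub> b"
    by (rule triangularE[OF L tri])
  have tL: "t \<in> carrier L" using t(1) \<hh> by auto
  have T: "bracket L t \<in> linear_maps L L" using L tL by (simp add: is_lie_algebra_def)
  \<comment> \<open>The cone is generated by the roots whose root space lies in \<open>np\<close>,
    whereas P is defined by the sign at t. A root of the wrong sign would give a nonzero eigenvector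
    of t in a span of eigenvectors with other eigenvalues.\<close>
  have pos: "Re (\<alpha> t) > 0" if \<alpha>: "\<alpha> \<in> roots L \<hh>" and sub: "root_space L \<hh> \<alpha> \<subseteq> np" for \<alpha>
  proof (rule ccontr)
    assume neg: "\<not> Re (\<alpha> t) > 0"
    have br0: "bracket L s \<zero>\<^bsub>L\<^esub> = \<zero>\<^bsub>L\<^esub>" if "s \<in> \<hh>" for s
      using L \<hh> that lin_zero[OF V V, of "bracket L s"] by (auto simp: is_lie_algebra_def)
    then have "\<zero>\<^bsub>L\<^esub> \<in> root_space L \<hh> \<alpha>"
      by (simp add: root_space_def vs_zero_closed[OF V] vs_smult_zero_r[OF V])
    then obtain x where x: "x \<in> root_space L \<hh> \<alpha>" "x \<noteq> \<zero>\<^bsub>L\<^esub>"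
      using \<alpha> unfolding roots_def by blast
    have "x = \<zero>\<^bsub>L\<^esub>"
    proof (rule eigenvectors_independent[OF V T])
      show "(\<Union>\<alpha>\<in>P. root_space L \<hh> \<alpha>) \<subseteq> carrier L" by (rule UN_least[OF root_space_subset])
      show "x \<in> lin_span L (\<Union>\<alpha>\<in>P. root_space L \<hh> \<alpha>)" using x(1) sub np by blast
      show "bracket L t x = \<alpha> t \<odot>\<^bsub>L\<^esub> x" using x(1) t(1) by (simp add: root_space_def)
      fix s assume "s \<in> (\<Union>\<alpha>\<in>P. root_space L \<hh> \<alpha>)"
      then obtain \<beta> where "\<beta> \<in> P" "s \<in> root_space L \<hh> \<beta>" by blast
      then have "Re (\<beta> t) > 0" "bracket L t s = \<beta> t \<odot>\<^bsub>L\<^esub> s"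
        using t(1) by (auto simp: P root_space_def)
      then show "\<exists>d. d \<noteq> \<alpha> t \<and> bracket L t s = d \<odot>\<^bsub>L\<^esub> s"
        using neg by (intro exI[of _ "\<beta> t"]) auto
    qed
    then show False using x(2) by blast
  qed
  \<comment> \<open>The alternative on the left is the empty sum of roots; any further root makes
    the real part positive.\<close>
  have cone: "\<beta> = (\<lambda>_. 0) \<or> Re (\<beta> t) > 0" if "\<beta> \<in> positive_cone L \<hh> np" for \<beta>
    using that by induction (auto dest: pos)
  show ?thesis
  proof (rule that[OF t(1)])
    have "\<mu> t \<noteq> \<Lambda> t" if "weight_less L \<hh> np \<mu> \<Lambda>" for \<mu> \<Lambda>
      using that cone[of "\<lambda>t. \<Lambda> t - \<mu> t"] unfolding weight_less_def
      by (auto simp: fun_eq_iff)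
    then show "\<forall>\<mu> \<Lambda>. weight_less L \<hh> np \<mu> \<Lambda> \<longrightarrow> \<mu> t \<noteq> \<Lambda> t" by blast
    have "\<beta> t + \<alpha> t \<noteq> 0"
      if "\<beta> \<in> positive_cone L \<hh> np" "\<alpha> \<in> roots L \<hh>" "root_space L \<hh> \<alpha> \<subseteq> np" for \<beta> \<alpha>
    proof -
      have "Re (\<beta> t + \<alpha> t) > 0" using cone[OF that(1)] pos[OF that(2,3)] by auto
      then show ?thesis by (metis less_irrefl zero_complex.sel(1))
    qed
    then show "\<forall>\<beta>\<in>positive_cone L \<hh> np. \<forall>\<alpha>\<in>roots L \<hh>.
        root_space L \<hh> \<alpha> \<subseteq> np \<longrightarrow> \<beta> t + \<alpha> t \<noteq> 0" by blast
  qed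
qed

section \<open>The irreducible Verma module and its weights\<close>

locale irreducible_verma =
  fixes L :: "('x, 'e) lie_algebra_scheme" and \<hh> np nm :: "'x set" and \<Lambda> :: "'x \<Rightarrow> complex"
  assumes L: "is_lie_algebra L" and \<hh>: "\<hh> \<subseteq> carrier L"
    and tri: "triangular_decomposition L \<hh> np nm" and \<Lambda>: "\<Lambda> \<in> dual L \<hh>"
    and irr: "irreducible_module L (verma L \<hh> np \<Lambda>)"
begin

abbreviation (input) "M \<equiv> verma L \<hh> np \<Lambda>"
abbreviation (input) "I \<equiv> verma_vec L \<hh> np \<Lambda>"

definition lower_weight_vectors where
  "lower_weight_vectors =
    {v. \<exists>\<mu>. \<mu> \<in> dual L \<hh> \<and> weight_less L \<hh> np \<mu> \<Lambda> \<and> v \<in> weight_space \<hh> M \<mu>}"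

lemma np_closed: "np \<subseteq> carrier L"
  by (rule triangularE[OF L tri])

lemmas M_lie_module = verma_lie_module[OF L \<hh> np_closed, of \<Lambda>]
lemmas M_vspace = verma_vspace[OF L \<hh> np_closed, of \<Lambda>]
lemmas I_closed = verma_vec_closed[OF L \<hh> np_closed, of \<Lambda>]
lemmas M_act_linear = lm_act_linear[OF M_lie_module]

lemma I_nonzero: "I \<noteq> \<zero>\<^bsub>M\<^esub>"
proof
  assume I: "I = \<zero>\<^bsub>M\<^esub>"
  have "{\<zero>\<^bsub>M\<^esub>} = carrier M"
  proof (rule verma_cyclic[OF L \<hh> np_closed])
    show "subspace_of {\<zero>\<^bsub>M\<^esub>} M"
      by (rule subspaceI[OF M_vspace]) (auto simp: vs_closed[OF M_vspace] vs_simps[OF M_vspace])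
    show "act M x m \<in> {\<zero>\<^bsub>M\<^esub>}" if "x \<in> carrier L" "m \<in> {\<zero>\<^bsub>M\<^esub>}" for x m
      using that lin_zero[OF M_vspace M_vspace M_act_linear] by auto
  qed (simp add: I)
  then show False using irr by (simp add: irreducible_module_def)
qed

lemma lower_weight_vectors_closed: "lower_weight_vectors \<subseteq> carrier M"
  by (auto simp: lower_weight_vectors_def weight_space_def)

lemma act_I: "t \<in> \<hh> \<Longrightarrow> act M t I = \<Lambda> t \<odot>\<^bsub>M\<^esub> I"
  by (rule verma_highest_weight[OF L \<hh> np_closed])

text \<open>Only the spanning half of the PBW theorem is needed: monomials in root vectors of \<open>nm\<close>, applied
  to the highest weight vector, span.\<close>

lemma M_span: "carrier M = lin_span M (insert I lower_weight_vectors)"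
proof
  show "lin_span M (insert I lower_weight_vectors) \<subseteq> carrier M"
    by (rule subspace_subset[OF M_vspace lin_span_subspace[OF M_vspace]])
       (use I_closed lower_weight_vectors_closed in auto)
  note V = lie_vspace[OF L]
  obtain t0 P where t0: "t0 \<in> \<hh>" "\<forall>\<alpha>\<in>roots L \<hh>. \<alpha> t0 \<in> \<real> \<and> \<alpha> t0 \<noteq> 0"
    and P: "P = {\<alpha> \<in> roots L \<hh>. Re (\<alpha> t0) > 0}"
    and np: "np = lin_span L (\<Union>\<alpha>\<in>P. root_space L \<hh> \<alpha>)"
    and nm: "nm = lin_span L (\<Union>\<alpha>\<in>P. root_space L \<hh> (\<lambda>t. - \<alpha> t))"
    and npL: "np \<subseteq> carrier L" and nmL: "nm \<subseteq> carrier L"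
    and dec: "\<forall>x\<in>carrier L. \<exists>a\<in>np. \<exists>t\<in>\<hh>. \<exists>b\<in>nm. x = a \<oplus>\<^bsub>L\<^esub> t \<oplus>\<^bsub>L\<^esub> b"
    by (rule triangularE[OF L tri])
  obtain t1 where t1: "t1 \<in> \<hh>" "\<forall>\<mu> \<Lambda>. weight_less L \<hh> np \<mu> \<Lambda> \<longrightarrow> \<mu> t1 \<noteq> \<Lambda> t1"
    "\<forall>\<beta>\<in>positive_cone L \<hh> np. \<forall>\<alpha>\<in>roots L \<hh>. root_space L \<hh> \<alpha> \<subseteq> np \<longrightarrow> \<beta> t1 + \<alpha> t1 \<noteq> 0"
    by (rule weight_less_separated[OF L \<hh> tri])
  \<comment> \<open>Root vectors instead of arbitrary elements of \<open>nm\<close>, so that every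
    monomial is a weight vector.\<close>
  define Y where "Y = (\<Union>\<alpha>\<in>P. root_space L \<hh> (\<lambda>t. - \<alpha> t))"
  have Y: "Y \<subseteq> carrier L" unfolding Y_def by (rule UN_least[OF root_space_subset])
  define mon where "mon = (\<lambda>ys. foldr (act M) ys I)"
  have mon_Cons: "mon (y # ys) = act M y (mon ys)" and mon_Nil: "mon [] = I" for y ys
    by (simp_all add: mon_def)
  have mon_closed: "mon ys \<in> carrier M" if "ys \<in> lists Y" for ys
    using that
  proof (induction ys)
    case Nil
    show ?case unfolding mon_Nil by (rule I_closed)
  next
    case (Cons y ys)
    then show ?case unfolding mon_Cons using Y by (intro lin_closed[OF M_act_linear]) auto
  qed
  define W where "W = lin_span M (mon ` lists Y)"
  have mons: "mon ` lists Y \<subseteq> carrier M" using mon_closed by auto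
  have W: "subspace_of W M" unfolding W_def by (rule lin_span_subspace[OF M_vspace mons])
  have WM: "W \<subseteq> carrier M" by (rule subspace_subset[OF M_vspace W])
  have stableI: "act M x m \<in> W"
    if x: "x \<in> carrier L" and *: "\<And>ys. ys \<in> lists Y \<Longrightarrow> act M x (mon ys) \<in> W" and m: "m \<in> W" for x m
    using m[unfolded W_def]
  proof (rule lin_span_induct[OF M_vspace mons])
    note l = M_act_linear[OF x]
    show "act M x \<zero>\<^bsub>M\<^esub> \<in> W"
      unfolding lin_zero[OF M_vspace M_vspace l] by (rule subspace_zero[OF M_vspace W])
    show "act M x s \<in> W" if "s \<in> mon ` lists Y" for s using that * by blast
    fix v assume v: "v \<in> carrier M" and av: "act M x v \<in> W"
    show "act M x (c \<odot>\<^bsub>M\<^esub> v) \<in> W" for c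
      unfolding lin_smult[OF l v] by (rule subspace_smult[OF M_vspace W av])
    fix w assume w: "w \<in> carrier M" and aw: "act M x w \<in> W"
    show "act M x (v \<oplus>\<^bsub>M\<^esub> w) \<in> W"
      unfolding lin_add[OF l v w] by (rule subspace_add[OF M_vspace W av aw])
  qed
  have mon_W: "mon ys \<in> W" if "ys \<in> lists Y" for ys
    unfolding W_def using that by (intro lin_span_base) auto
  have Y_stable: "act M y m \<in> W" if y: "y \<in> Y" and m: "m \<in> W" for y m
  proof (rule stableI[OF _ _ m])
    show "y \<in> carrier L" using y Y by auto
    show "act M y (mon ys) \<in> W" if "ys \<in> lists Y" for ys
      using mon_W[of "y # ys"] that y by (simp add: mon_Cons)
  qed
  have nm_stable: "act M b m \<in> W" if b: "b \<in> nm" and m: "m \<in> W" for b m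
    using b[unfolded nm, folded Y_def]
  proof (rule lin_span_induct[OF V Y])
    have mM: "m \<in> carrier M" using m WM by auto
    note l = lm_act_linear_left[OF M_lie_module mM]
    show "act M \<zero>\<^bsub>L\<^esub> m \<in> W"
      using lin_zero[OF V M_vspace l] subspace_zero[OF M_vspace W] by simp
    show "act M s m \<in> W" if "s \<in> Y" for s by (rule Y_stable[OF that m])
    fix v assume v: "v \<in> carrier L" and av: "act M v m \<in> W"
    show "act M (c \<odot>\<^bsub>L\<^esub> v) m \<in> W" for c
      unfolding lin_smult[OF l v] by (rule subspace_smult[OF M_vspace W av])
    fix w assume w: "w \<in> carrier L" and aw: "act M w m \<in> W"
    show "act M (v \<oplus>\<^bsub>L\<^esub> w) m \<in> W"
      unfolding lin_add[OF l v w] by (rule subspace_add[OF M_vspace W av aw])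
  qed
  \<comment> \<open>The element x is moved to the right through the monomial: x y m = y x m + [x, y]
    m. The bracket is a new element of \<open>L\<close>, so the induction on the monomial keeps x
    arbitrary.\<close>
  have mon_stable: "act M x (mon ys) \<in> W" if "ys \<in> lists Y" "x \<in> carrier L" for x ys
    using that
  proof (induction ys arbitrary: x)
    case Nil
    \<comment> \<open>On the highest weight vector the part in \<open>np\<close> acts by zero, the
      part in \<hh> by a scalar, and the part in \<open>nm\<close> stays inside W.\<close>
    obtain a t b where x: "a \<in> np" "t \<in> \<hh>" "b \<in> nm" "x = a \<oplus>\<^bsub>L\<^esub> t \<oplus>\<^bsub>L\<^esub> b" using bspec[OF dec Nil] by blast
    then have xL: "a \<in> carrier L" "t \<in> carrier L" "b \<in> carrier L" using np_closed \<hh> nmL by auto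
    note l = lm_act_linear_left[OF M_lie_module I_closed]
    have I_W: "I \<in> W" using mon_W[of "[]"] by (simp add: mon_Nil)
    have "act M x I = (act M a I \<oplus>\<^bsub>M\<^esub> act M t I) \<oplus>\<^bsub>M\<^esub> act M b I"
      unfolding x(4) lin_add[OF l vs_add_closed[OF V xL(1,2)] xL(3)] lin_add[OF l xL(1,2)] ..
    also have "\<dots> \<in> W"
      unfolding verma_highest_np[OF L \<hh> np_closed x(1)] act_I[OF x(2)]
      by (intro subspace_add[OF M_vspace W] subspace_zero[OF M_vspace W] subspace_smult[OF M_vspace W]
          I_W nm_stable[OF x(3)])
    finally show ?case by (simp add: mon_Nil)
  next
    case (Cons y ys)
    then have y: "y \<in> Y" "y \<in> carrier L" using Y by auto
    have m: "mon ys \<in> carrier M" using mon_closed Cons by auto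
    have br: "bracket L x y \<in> carrier L" by (rule lie_bracket_closed[OF L Cons.prems y(2)])
    have c1: "act M y (act M x (mon ys)) \<in> carrier M" and c2: "act M x (act M y (mon ys)) \<in> carrier M"
      using lin_closed[OF M_act_linear] m y(2) Cons.prems by blast+
    have "act M x (mon (y # ys)) = act M y (act M x (mon ys)) \<oplus>\<^bsub>M\<^esub> act M (bracket L x y) (mon ys)"
      unfolding lm_bracket[OF M_lie_module Cons.prems y(2) m] mon_Cons
      by (rule vs_add_minus_cancel[OF M_vspace c1 c2, symmetric])
    also have "\<dots> \<in> W"
      by (intro subspace_add[OF M_vspace W] Y_stable[OF y(1)] Cons.IH Cons.prems br)
    finally show ?case .
  qed
  have "W = carrier M"
  proof (rule verma_cyclic[OF L \<hh> np_closed W])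
    show "act M x m \<in> W" if "x \<in> carrier L" "m \<in> W" for x m
      using stableI[OF that(1) mon_stable that(2)] that(1) by blast
    show "I \<in> W" using mon_W[of "[]"] by (simp add: mon_Nil)
  qed
  \<comment> \<open>The weight is written as \<Lambda> - \<beta> with \<beta> in the cone, the form
    in which \<open>weight_less\<close> tests it. That \<beta> is nonzero for a nonempty monomial is
    recorded through its value at t1.\<close>
  moreover have weights: "\<exists>\<beta>\<in>positive_cone L \<hh> np. (\<lambda>t. \<Lambda> t - \<beta> t) \<in> dual L \<hh> \<and>
      mon ys \<in> weight_space \<hh> M (\<lambda>t. \<Lambda> t - \<beta> t) \<and> (ys \<noteq> [] \<longrightarrow> \<beta> t1 \<noteq> 0)" if "ys \<in> lists Y" for ys
    using that
  proof (induction ys)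
    case Nil
    show ?case
      by (rule bexI[of _ "\<lambda>_. 0"])
         (use \<Lambda> act_I I_closed in \<open>auto simp: mon_Nil weight_space_def intro: positive_cone.zero\<close>)
  next
    case (Cons y ys)
    then obtain \<beta> where \<beta>: "\<beta> \<in> positive_cone L \<hh> np" "(\<lambda>t. \<Lambda> t - \<beta> t) \<in> dual L \<hh>"
      "mon ys \<in> weight_space \<hh> M (\<lambda>t. \<Lambda> t - \<beta> t)" by auto
    obtain \<alpha> where \<alpha>: "\<alpha> \<in> P" "y \<in> root_space L \<hh> (\<lambda>t. - \<alpha> t)" using Cons by (auto simp: Y_def)
    have \<alpha>r: "\<alpha> \<in> roots L \<hh>" using \<alpha>(1) P by blast
    have sub: "root_space L \<hh> \<alpha> \<subseteq> np" unfolding np using \<alpha>(1) by (auto intro: lin_span_base)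
    have yL: "y \<in> carrier L" using Cons Y by auto
    have m: "mon ys \<in> carrier M" using mon_closed Cons by auto
    have ym: "act M y (mon ys) \<in> carrier M" by (rule lin_closed[OF M_act_linear[OF yL] m])
    show ?case
    proof (intro bexI conjI)
      show "(\<lambda>t. \<beta> t + \<alpha> t) \<in> positive_cone L \<hh> np" by (rule positive_cone.add[OF \<beta>(1) \<alpha>r sub])
      have "\<alpha> \<in> dual L \<hh>" using \<alpha>r by (simp add: roots_def)
      then show "(\<lambda>t. \<Lambda> t - (\<beta> t + \<alpha> t)) \<in> dual L \<hh>"
        using \<beta>(2) by (simp add: dual_def algebra_simps)
      show "y # ys \<noteq> [] \<longrightarrow> \<beta> t1 + \<alpha> t1 \<noteq> 0" using t1(3) \<beta>(1) \<alpha>r sub by blast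
      show "mon (y # ys) \<in> weight_space \<hh> M (\<lambda>t. \<Lambda> t - (\<beta> t + \<alpha> t))"
        unfolding weight_space_def mon_Cons
      proof (intro CollectI conjI ballI ym)
        fix t assume t: "t \<in> \<hh>"
        then have tL: "t \<in> carrier L" using \<hh> by auto
        have c1: "act M t (act M y (mon ys)) \<in> carrier M" by (rule lin_closed[OF M_act_linear[OF tL] ym])
        have tm: "act M t (mon ys) = (\<Lambda> t - \<beta> t) \<odot>\<^bsub>M\<^esub> mon ys"
          using \<beta>(3) t by (simp add: weight_space_def)
        \<comment> \<open>The bracket rule gives t y m - y t m; in the second term t acts on m by
          its weight, and [t, y] is -\<alpha>(t) times y.\<close>
        have "act M t (act M y (mon ys)) \<ominus>\<^bsub>M\<^esub> (\<Lambda> t - \<beta> t) \<odot>\<^bsub>M\<^esub> act M y (mon ys)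
            = act M (bracket L t y) (mon ys)"
          unfolding lm_bracket[OF M_lie_module tL yL m] tm lin_smult[OF M_act_linear[OF yL] m] ..
        also have "\<dots> = (- \<alpha> t) \<odot>\<^bsub>M\<^esub> act M y (mon ys)"
          using \<alpha>(2) t lin_smult[OF lm_act_linear_left[OF M_lie_module m] yL] by (simp add: root_space_def)
        finally have "act M t (act M y (mon ys)) = (\<Lambda> t - \<beta> t + - \<alpha> t) \<odot>\<^bsub>M\<^esub> act M y (mon ys)"
          by (rule vs_smult_from_minus[OF M_vspace ym c1])
        also have "\<Lambda> t - \<beta> t + - \<alpha> t = \<Lambda> t - (\<beta> t + \<alpha> t)" by simp
        finally show "act M t (act M y (mon ys)) = (\<Lambda> t - (\<beta> t + \<alpha> t)) \<odot>\<^bsub>M\<^esub> act M y (mon ys)" .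
      qed
    qed
  qed
  have "mon ` lists Y \<subseteq> insert I lower_weight_vectors"
  proof
    fix m assume "m \<in> mon ` lists Y"
    then obtain ys where ys: "ys \<in> lists Y" "m = mon ys" by blast
    obtain \<beta> where \<beta>: "\<beta> \<in> positive_cone L \<hh> np" "(\<lambda>t. \<Lambda> t - \<beta> t) \<in> dual L \<hh>"
      "m \<in> weight_space \<hh> M (\<lambda>t. \<Lambda> t - \<beta> t)" "ys \<noteq> [] \<longrightarrow> \<beta> t1 \<noteq> 0"
      using weights[OF ys(1)] ys(2) by blast
    show "m \<in> insert I lower_weight_vectors"
    proof (cases "ys = []")
      case True
      then show ?thesis using ys by (simp add: mon_Nil)
    next
      case False
      have eq: "(\<lambda>t. \<Lambda> t - (\<Lambda> t - \<beta> t)) = \<beta>" by (simp add: fun_eq_iff)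
      have "(\<lambda>t. \<Lambda> t - \<beta> t) \<noteq> \<Lambda>" using False \<beta>(4) by (auto simp: fun_eq_iff)
      then have "weight_less L \<hh> np (\<lambda>t. \<Lambda> t - \<beta> t) \<Lambda>"
        unfolding weight_less_def eq using \<beta>(1) by blast
      then show ?thesis using \<beta>(2,3) unfolding lower_weight_vectors_def by blast
    qed
  qed
  then have "W \<subseteq> lin_span M (insert I lower_weight_vectors)"
    unfolding W_def by (rule lin_span_mono)
  ultimately show "carrier M \<subseteq> lin_span M (insert I lower_weight_vectors)" by simp
qed

section \<open>The linear form dual to the highest weight vector\<close>

definition is_highest_coefficient :: "(('x list \<Rightarrow> complex) set set \<Rightarrow> complex) \<Rightarrow> bool" where
  "is_highest_coefficient \<xi> \<longleftrightarrow>
    (\<forall>m\<in>carrier M. \<forall>m'\<in>carrier M. \<xi> (m \<oplus>\<^bsub>M\<^esub> m') = \<xi> m + \<xi> m') \<and>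
    (\<forall>c. \<forall>m\<in>carrier M. \<xi> (c \<odot>\<^bsub>M\<^esub> m) = c * \<xi> m) \<and>
    \<xi> I = 1 \<and> (\<forall>m\<in>lower_weight_vectors. \<xi> m = 0) \<and>
    (\<forall>m\<in>carrier M. m \<ominus>\<^bsub>M\<^esub> \<xi> m \<odot>\<^bsub>M\<^esub> I \<in> lin_span M lower_weight_vectors) \<and>
    (\<forall>t\<in>\<hh>. \<forall>m\<in>carrier M. \<xi> (act M t m) = \<Lambda> t * \<xi> m)"

text \<open>\<open>M\<close> is the line through the highest weight vector plus the span of the
  lower weight vectors. The sum is direct, since a nonzero multiple of the highest weight vector in
  that span would be an eigenvector of t0 inside a span of eigenvectors with other eigenvalues. The
  form is the coordinate on the line. Its clause on differences later yields existence of a leading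
  term, and its clause on the action of \<hh> the weight zero of that term.\<close>

lemma highest_coefficient_exists: "\<exists>\<xi>. is_highest_coefficient \<xi>"
proof -
  let ?N = "lin_span M lower_weight_vectors"
  have N: "subspace_of ?N M" by (rule lin_span_subspace[OF M_vspace lower_weight_vectors_closed])
  have NM: "?N \<subseteq> carrier M" by (rule subspace_subset[OF M_vspace N])
  have span: "insert I lower_weight_vectors \<subseteq> carrier M"
    using I_closed lower_weight_vectors_closed by auto
  obtain t0 where t0: "t0 \<in> \<hh>" "\<forall>\<mu> \<Lambda>. weight_less L \<hh> np \<mu> \<Lambda> \<longrightarrow> \<mu> t0 \<noteq> \<Lambda> t0"
    by (rule weight_less_separated[OF L \<hh> tri])
  have t0L: "t0 \<in> carrier L" using t0 \<hh> by auto
  have unique0: "c = 0" if "c \<odot>\<^bsub>M\<^esub> I \<in> ?N" for c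
  proof -
    have "c \<odot>\<^bsub>M\<^esub> I = \<zero>\<^bsub>M\<^esub>"
    proof (rule eigenvectors_independent[OF M_vspace M_act_linear[OF t0L] lower_weight_vectors_closed _ that])
      show "act M t0 (c \<odot>\<^bsub>M\<^esub> I) = \<Lambda> t0 \<odot>\<^bsub>M\<^esub> (c \<odot>\<^bsub>M\<^esub> I)"
        using lin_smult[OF M_act_linear[OF t0L] I_closed, of c] act_I[OF t0(1)]
        by (simp add: vs_smult_assoc[OF M_vspace I_closed] mult.commute)
      show "\<exists>d. d \<noteq> \<Lambda> t0 \<and> act M t0 s = d \<odot>\<^bsub>M\<^esub> s" if "s \<in> lower_weight_vectors" for s
        using that t0 unfolding lower_weight_vectors_def weight_space_def by blast
    qed
    then show ?thesis using vs_smult_eq_zeroD[OF M_vspace I_closed _ I_nonzero] by blast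
  qed
  note vs = vs_simps[OF M_vspace] vs_closed[OF M_vspace]
  have unique: "c = d" if "m \<ominus>\<^bsub>M\<^esub> c \<odot>\<^bsub>M\<^esub> I \<in> ?N" "m \<ominus>\<^bsub>M\<^esub> d \<odot>\<^bsub>M\<^esub> I \<in> ?N" "m \<in> carrier M" for c d m
  proof -
    have "(m \<ominus>\<^bsub>M\<^esub> c \<odot>\<^bsub>M\<^esub> I) \<ominus>\<^bsub>M\<^esub> (m \<ominus>\<^bsub>M\<^esub> d \<odot>\<^bsub>M\<^esub> I) = (d - c) \<odot>\<^bsub>M\<^esub> I"
    proof -
      \<comment> \<open>The two occurrences of m are displayed with coefficients 1 and -1, so that
        merging coefficients cancels them.\<close>
      have "(m \<ominus>\<^bsub>M\<^esub> c \<odot>\<^bsub>M\<^esub> I) \<ominus>\<^bsub>M\<^esub> (m \<ominus>\<^bsub>M\<^esub> d \<odot>\<^bsub>M\<^esub> I)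
          = (1 \<odot>\<^bsub>M\<^esub> m \<oplus>\<^bsub>M\<^esub> (-1) \<odot>\<^bsub>M\<^esub> m) \<oplus>\<^bsub>M\<^esub> (d \<odot>\<^bsub>M\<^esub> I \<oplus>\<^bsub>M\<^esub> (- c) \<odot>\<^bsub>M\<^esub> I)"
        using that(3) I_closed by (simp add: vs)
      also have "\<dots> = (d - c) \<odot>\<^bsub>M\<^esub> I"
        unfolding vs_smult_l[OF M_vspace that(3), symmetric] vs_smult_l[OF M_vspace I_closed, symmetric]
        using that(3) I_closed by (simp add: vs)
      finally show ?thesis .
    qed
    then have "(d - c) \<odot>\<^bsub>M\<^esub> I \<in> ?N" using subspace_minus[OF M_vspace N that(1,2)] by simp
    then have "d - c = 0" by (rule unique0)
    then show ?thesis by simp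
  qed
  define \<xi> where "\<xi> = (\<lambda>m. THE c. m \<ominus>\<^bsub>M\<^esub> c \<odot>\<^bsub>M\<^esub> I \<in> ?N)"
  have \<xi>_eq: "\<xi> m = c" if "m \<ominus>\<^bsub>M\<^esub> c \<odot>\<^bsub>M\<^esub> I \<in> ?N" "m \<in> carrier M" for m c
    unfolding \<xi>_def by (rule the_equality) (use that unique in blast)+
  have add: "(m \<oplus>\<^bsub>M\<^esub> m') \<ominus>\<^bsub>M\<^esub> (c + d) \<odot>\<^bsub>M\<^esub> I \<in> ?N"
    if "m \<ominus>\<^bsub>M\<^esub> c \<odot>\<^bsub>M\<^esub> I \<in> ?N" "m' \<ominus>\<^bsub>M\<^esub> d \<odot>\<^bsub>M\<^esub> I \<in> ?N" "m \<in> carrier M" "m' \<in> carrier M" for m m' c d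
    using subspace_add[OF M_vspace N that(1,2)] that(3,4) I_closed
    by (simp add: vs vs_smult_l[OF M_vspace])
  have smult: "(k \<odot>\<^bsub>M\<^esub> m) \<ominus>\<^bsub>M\<^esub> (k * c) \<odot>\<^bsub>M\<^esub> I \<in> ?N"
    if "m \<ominus>\<^bsub>M\<^esub> c \<odot>\<^bsub>M\<^esub> I \<in> ?N" "m \<in> carrier M" for m c k
    using subspace_smult[OF M_vspace N that(1), of k] that(2) I_closed
    by (simp add: vs)
  have low: "m \<ominus>\<^bsub>M\<^esub> 0 \<odot>\<^bsub>M\<^esub> I \<in> ?N" if "m \<in> ?N" for m
    using that NM I_closed by (simp add: vs subset_iff)
  have top: "I \<ominus>\<^bsub>M\<^esub> 1 \<odot>\<^bsub>M\<^esub> I \<in> ?N"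
    using I_closed subspace_zero[OF M_vspace N]
    by (simp add: vs_one[OF M_vspace] vs_minus_eq_zero[OF M_vspace, THEN iffD2])
  have ex: "\<exists>c. m \<ominus>\<^bsub>M\<^esub> c \<odot>\<^bsub>M\<^esub> I \<in> ?N" if "m \<in> carrier M" for m
    using that[unfolded M_span]
  proof (rule lin_span_induct[OF M_vspace span])
    show "\<exists>c. \<zero>\<^bsub>M\<^esub> \<ominus>\<^bsub>M\<^esub> c \<odot>\<^bsub>M\<^esub> I \<in> ?N" using low[OF subspace_zero[OF M_vspace N]] by blast
    show "\<exists>c. s \<ominus>\<^bsub>M\<^esub> c \<odot>\<^bsub>M\<^esub> I \<in> ?N" if "s \<in> insert I lower_weight_vectors" for s
      using that top low[OF lin_span_base] by blast
  qed (use add smult in blast)+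
  have \<xi>: "m \<ominus>\<^bsub>M\<^esub> \<xi> m \<odot>\<^bsub>M\<^esub> I \<in> ?N" if "m \<in> carrier M" for m
    using ex[OF that] \<xi>_eq[OF _ that] by metis
  have \<xi>_add: "\<xi> (m \<oplus>\<^bsub>M\<^esub> m') = \<xi> m + \<xi> m'" if "m \<in> carrier M" "m' \<in> carrier M" for m m'
    by (rule \<xi>_eq[OF add[OF \<xi>[OF that(1)] \<xi>[OF that(2)] that] vs_add_closed[OF M_vspace that]])
  have \<xi>_smult: "\<xi> (c \<odot>\<^bsub>M\<^esub> m) = c * \<xi> m" if "m \<in> carrier M" for m c
    by (rule \<xi>_eq[OF smult[OF \<xi>[OF that] that] vs_smult_closed[OF M_vspace that]])
  have \<xi>_low: "\<xi> m = 0" if "m \<in> lower_weight_vectors" for m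
    by (rule \<xi>_eq[OF low[OF lin_span_base[OF that]]]) (use that lower_weight_vectors_closed in auto)
  have \<xi>_I: "\<xi> I = 1" by (rule \<xi>_eq[OF top I_closed])
  have "\<xi> (act M t m) = \<Lambda> t * \<xi> m" if t: "t \<in> \<hh>" and m: "m \<in> carrier M" for t m
    using m[unfolded M_span]
  proof (rule lin_span_induct[OF M_vspace span])
    have tL: "t \<in> carrier L" using t \<hh> by auto
    note l = M_act_linear[OF tL]
    have "\<xi> \<zero>\<^bsub>M\<^esub> = 0"
      by (rule \<xi>_eq[OF low[OF subspace_zero[OF M_vspace N]] vs_zero_closed[OF M_vspace]])
    then show "\<xi> (act M t \<zero>\<^bsub>M\<^esub>) = \<Lambda> t * \<xi> \<zero>\<^bsub>M\<^esub>" by (simp add: lin_zero[OF M_vspace M_vspace l])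
    show "\<xi> (act M t s) = \<Lambda> t * \<xi> s" if "s \<in> insert I lower_weight_vectors" for s
    proof (cases "s = I")
      case True
      then show ?thesis using act_I[OF t] I_closed by (simp add: \<xi>_smult \<xi>_I)
    next
      case False
      then have s: "s \<in> lower_weight_vectors" using that by blast
      then obtain \<mu> where "act M t s = \<mu> t \<odot>\<^bsub>M\<^esub> s" "s \<in> carrier M"
        using t unfolding lower_weight_vectors_def weight_space_def by blast
      then show ?thesis by (simp add: \<xi>_smult \<xi>_low[OF s])
    qed
    fix v assume v: "v \<in> carrier M" and av: "\<xi> (act M t v) = \<Lambda> t * \<xi> v"
    show "\<xi> (act M t (c \<odot>\<^bsub>M\<^esub> v)) = \<Lambda> t * \<xi> (c \<odot>\<^bsub>M\<^esub> v)" for c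
      by (simp add: lin_smult[OF l v] \<xi>_smult v lin_closed[OF l v] av)
    fix w assume w: "w \<in> carrier M" and aw: "\<xi> (act M t w) = \<Lambda> t * \<xi> w"
    show "\<xi> (act M t (v \<oplus>\<^bsub>M\<^esub> w)) = \<Lambda> t * \<xi> (v \<oplus>\<^bsub>M\<^esub> w)"
      by (simp add: lin_add[OF l v w] \<xi>_add v w lin_closed[OF l] av aw algebra_simps)
  qed
  then have "is_highest_coefficient \<xi>"
    unfolding is_highest_coefficient_def using \<xi>_add \<xi>_smult \<xi>_I \<xi>_low \<xi> by auto
  then show ?thesis by blast
qed

definition highest_coefficient :: "('x list \<Rightarrow> complex) set set \<Rightarrow> complex" where
  "highest_coefficient = (SOME \<xi>. is_highest_coefficient \<xi>)"

lemma highest_coefficient: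
  "\<And>m m'. m \<in> carrier M \<Longrightarrow> m' \<in> carrier M \<Longrightarrow>
    highest_coefficient (m \<oplus>\<^bsub>M\<^esub> m') = highest_coefficient m + highest_coefficient m'"
  "\<And>c m. m \<in> carrier M \<Longrightarrow> highest_coefficient (c \<odot>\<^bsub>M\<^esub> m) = c * highest_coefficient m"
  "highest_coefficient I = 1"
  "\<And>m. m \<in> lower_weight_vectors \<Longrightarrow> highest_coefficient m = 0"
  "\<And>m. m \<in> carrier M \<Longrightarrow>
    m \<ominus>\<^bsub>M\<^esub> highest_coefficient m \<odot>\<^bsub>M\<^esub> I \<in> lin_span M lower_weight_vectors"
  "\<And>t m. t \<in> \<hh> \<Longrightarrow> m \<in> carrier M \<Longrightarrow> highest_coefficient (act M t m) = \<Lambda> t * highest_coefficient m"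
  using someI_ex[OF highest_coefficient_exists, folded highest_coefficient_def]
  unfolding is_highest_coefficient_def by simp_all

end

section \<open>Polynomial functions as a module over the Lie algebra\<close>

lemma complex_differentiable_cong_open:
  assumes "open S" "z \<in> S" "\<And>w. w \<in> S \<Longrightarrow> f w = g w" "complex_differentiable sa sb f z"
  shows "complex_differentiable sa sb g z"
proof -
  obtain D where D: "(f has_derivative D) (at z)" "\<forall>c v. D (sa c v) = sb c (D v)"
    using assms(4) unfolding complex_differentiable_def by blast
  have "(g has_derivative D) (at z)"
    by (rule has_derivative_transform_within_open[OF D(1) assms(1-3)])
  then show ?thesis using D(2) unfolding complex_differentiable_def by blast
qed

lemma complex_differentiable_const: "complex_differentiable sa (*) (\<lambda>_. c) z"
  unfolding complex_differentiable_def by (rule exI[of _ "\<lambda>_. 0"]) simp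

lemma complex_differentiable_add:
  assumes "complex_differentiable sa (*) f z" "complex_differentiable sa (*) g z"
  shows "complex_differentiable sa (*) (\<lambda>w. f w + g w) z"
proof -
  obtain D E where D: "(f has_derivative D) (at z)" "\<forall>c v. D (sa c v) = c * D v"
    and E: "(g has_derivative E) (at z)" "\<forall>c v. E (sa c v) = c * E v"
    using assms unfolding complex_differentiable_def by blast
  show ?thesis
    unfolding complex_differentiable_def
    by (rule exI[of _ "\<lambda>v. D v + E v"])
       (use has_derivative_add[OF D(1) E(1)] D(2) E(2) in \<open>simp add: algebra_simps\<close>)
qed

lemma complex_differentiable_mult:
  assumes "complex_differentiable sa (*) f z" "complex_differentiable sa (*) g z"
  shows "complex_differentiable sa (*) (\<lambda>w. f w * g w :: complex) z"
proof -
  obtain D E where D: "(f has_derivative D) (at z)" "\<forall>c v. D (sa c v) = c * D v"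
    and E: "(g has_derivative E) (at z)" "\<forall>c v. E (sa c v) = c * E v"
    using assms unfolding complex_differentiable_def by blast
  show ?thesis
    unfolding complex_differentiable_def
    by (rule exI[of _ "\<lambda>v. f z * E v + D v * g z"])
       (use has_derivative_mult[OF D(1) E(1)] D(2) E(2) in \<open>simp add: algebra_simps\<close>)
qed

text \<open>The operations of \<open>F\<close> are pointwise, so N is a subspace of the space of all
  functions, and linear algebra there gives a left inverse of the inclusion. Applied to a submodule
  it is linear but in general not equivariant; it serves to make maps induced on tensor products
  split injective.\<close>

lemma retraction_exists:
  fixes F :: "(complex, 'g \<Rightarrow> complex, 'm) module_scheme"
  assumes add: "add F = (\<lambda>f g x. f x + g x)" and smult: "smult F = (\<lambda>c f x. c * f x)"
    and zero: "zero F = (\<lambda>_. 0)" and F: "vspace F" and N: "subspace_of N F"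
  obtains r where "r \<in> linear_maps F (F\<lparr>carrier := N\<rparr>)" "\<And>v. v \<in> N \<Longrightarrow> r v = v"
proof -
  let ?s = "\<lambda>(c::complex) (f :: 'g \<Rightarrow> complex) x. c * f x"
  have vs: "vector_space ?s"
    by unfold_locales (auto simp: fun_eq_iff algebra_simps)
  interpret A: vector_space_pair ?s ?s
    by (rule vector_space_pair.intro[OF vs vs])
  have "A.vs1.subspace N"
    unfolding A.vs1.subspace_def
    using subspace_zero[OF F N] subspace_add[OF F N] subspace_smult[OF F N]
    by (simp add: add smult zero zero_fun_def plus_fun_def)
  moreover have "Vector_Spaces.linear ?s ?s (\<lambda>v. v)"
    unfolding Vector_Spaces.linear_iff using vs by simp
  ultimately have "\<exists>r. r ` UNIV \<subseteq> N \<and> Vector_Spaces.linear ?s ?s r \<and> (\<forall>v\<in>N. r v = v)"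
    by (intro A.linear_exists_left_inverse_on) auto
  then obtain r where r: "\<And>v. r v \<in> N" "Vector_Spaces.linear ?s ?s r" "\<And>v. v \<in> N \<Longrightarrow> r v = v" by blast
  have "r (\<lambda>x. f x + g x) = (\<lambda>x. r f x + r g x)" "r (\<lambda>x. c * f x) = (\<lambda>x. c * r f x)" for f g c
    using r(2) unfolding Vector_Spaces.linear_iff plus_fun_def by auto
  then have "r \<in> linear_maps F (F\<lparr>carrier := N\<rparr>)"
    by (intro linear_mapsI) (use r(1) in \<open>auto simp: add smult\<close>)
  then show ?thesis using that r(3) by blast
qed

section \<open>Holomorphic germs and point derivations on the group\<close>

locale lie_group =
  fixes G :: "('g, 'n::finite) complex_lie_group"
  assumes G: "is_complex_lie_group G"
begin

abbreviation (input) "F \<equiv> poly_alg G"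
abbreviation (input) "hol f \<equiv> holomorphic_near G f \<one>\<^bsub>G\<^esub>"

lemma G_group: "group G" and G_top: "topspace (group_topology G) = carrier G"
  and G_manifold: "is_complex_manifold (group_topology G) (atlas G)"
  using G by (simp_all add: is_complex_lie_group_def Let_def)

lemma one_closed: "\<one>\<^bsub>G\<^esub> \<in> carrier G"
  and mult_closed: "x \<in> carrier G \<Longrightarrow> y \<in> carrier G \<Longrightarrow> x \<otimes>\<^bsub>G\<^esub> y \<in> carrier G"
  and mult_assoc: "x \<in> carrier G \<Longrightarrow> y \<in> carrier G \<Longrightarrow> z \<in> carrier G \<Longrightarrow>
    x \<otimes>\<^bsub>G\<^esub> y \<otimes>\<^bsub>G\<^esub> z = x \<otimes>\<^bsub>G\<^esub> (y \<otimes>\<^bsub>G\<^esub> z)"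
  and mult_one: "x \<in> carrier G \<Longrightarrow> x \<otimes>\<^bsub>G\<^esub> \<one>\<^bsub>G\<^esub> = x"
proof -
  interpret group G by (rule G_group)
  show "\<one>\<^bsub>G\<^esub> \<in> carrier G" by simp
  show "x \<in> carrier G \<Longrightarrow> y \<in> carrier G \<Longrightarrow> x \<otimes>\<^bsub>G\<^esub> y \<in> carrier G" by simp
  show "x \<in> carrier G \<Longrightarrow> y \<in> carrier G \<Longrightarrow> z \<in> carrier G \<Longrightarrow>
    x \<otimes>\<^bsub>G\<^esub> y \<otimes>\<^bsub>G\<^esub> z = x \<otimes>\<^bsub>G\<^esub> (y \<otimes>\<^bsub>G\<^esub> z)" by (rule m_assoc)
  show "x \<in> carrier G \<Longrightarrow> x \<otimes>\<^bsub>G\<^esub> \<one>\<^bsub>G\<^esub> = x" by simp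
qed

lemma chart:
  assumes "(U, \<kappa>) \<in> atlas G"
  shows "U \<subseteq> carrier G" "open (\<kappa> ` U)"
proof -
  have "\<forall>(U, \<kappa>)\<in>atlas G. is_chart (group_topology G) U \<kappa>"
    using G_manifold[unfolded is_complex_manifold_def] by (elim conjE)
  from bspec[OF this assms] have "is_chart (group_topology G) U \<kappa>" by simp
  then have "openin (group_topology G) U" and op: "open (\<kappa> ` U)" by (simp_all add: is_chart_def)
  then show "U \<subseteq> carrier G" using openin_subset[of "group_topology G" U] by (simp add: G_top)
  show "open (\<kappa> ` U)" by fact
qed

lemma holomorphic_near_iff:
  "holomorphic_near G f x \<longleftrightarrow> (\<exists>N. openin (group_topology G) N \<and> x \<in> N \<and>
    (\<forall>y\<in>N. \<forall>U \<kappa>. (U, \<kappa>) \<in> atlas G \<longrightarrow> y \<in> U \<longrightarrow>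
      complex_differentiable (*s) (*) (f \<circ> inv_into U \<kappa>) (\<kappa> y)))"
  by (simp only: holomorphic_near_def Ball_def split_paired_All prod.case)

text \<open>Chart domains lie inside the carrier, so holomorphy does not see values outside it. This
  matters because polynomial functions are cut off there while the entries of a representation are
  not.\<close>

lemma holomorphic_near_cong:
  assumes "holomorphic_near G f x" "\<And>y. y \<in> carrier G \<Longrightarrow> f y = g y"
  shows "holomorphic_near G g x"
proof -
  obtain N where N: "openin (group_topology G) N" "x \<in> N"
    "\<And>y U \<kappa>. y \<in> N \<Longrightarrow> (U, \<kappa>) \<in> atlas G \<Longrightarrow> y \<in> U \<Longrightarrow>
      complex_differentiable (*s) (*) (f \<circ> inv_into U \<kappa>) (\<kappa> y)"
    using assms(1) unfolding holomorphic_near_iff by blast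
  have "complex_differentiable (*s) (*) (g \<circ> inv_into U \<kappa>) (\<kappa> y)"
    if "y \<in> N" "(U, \<kappa>) \<in> atlas G" "y \<in> U" for y U \<kappa>
  proof (rule complex_differentiable_cong_open[OF chart(2)[OF that(2)] _ _ N(3)[OF that]])
    show "\<kappa> y \<in> \<kappa> ` U" using that by blast
    show "(f \<circ> inv_into U \<kappa>) w = (g \<circ> inv_into U \<kappa>) w" if "w \<in> \<kappa> ` U" for w
      using inv_into_into[OF that] chart(1)[OF \<open>(U, \<kappa>) \<in> atlas G\<close>] assms(2) by auto
  qed
  then show ?thesis using N(1,2) unfolding holomorphic_near_iff by blast
qed

lemma holomorphic_near_const: "x \<in> carrier G \<Longrightarrow> holomorphic_near G (\<lambda>_. c) x"
  unfolding holomorphic_near_iff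
  by (rule exI[of _ "carrier G"])
     (use G_top openin_topspace[of "group_topology G"] in \<open>auto simp: o_def complex_differentiable_const\<close>)

text \<open>One argument for sums and products: intersect the two neighbourhoods and apply the rule
  \<open>op\<close> in each chart.\<close>

lemma holomorphic_near_binary:
  assumes op: "\<And>u v z. complex_differentiable (*s) (*) u z \<Longrightarrow> complex_differentiable (*s) (*) v z \<Longrightarrow>
      complex_differentiable (*s) (*) (\<lambda>w :: complex ^ 'n. h (u w) (v w)) z"
    and f: "holomorphic_near G f x" and g: "holomorphic_near G g x"
  shows "holomorphic_near G (\<lambda>y. h (f y) (g y)) x"
proof -
  obtain N where N: "openin (group_topology G) N" "x \<in> N"
    "\<And>y U \<kappa>. y \<in> N \<Longrightarrow> (U, \<kappa>) \<in> atlas G \<Longrightarrow> y \<in> U \<Longrightarrow>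
      complex_differentiable (*s) (*) (f \<circ> inv_into U \<kappa>) (\<kappa> y)"
    using f unfolding holomorphic_near_iff by blast
  obtain N' where N': "openin (group_topology G) N'" "x \<in> N'"
    "\<And>y U \<kappa>. y \<in> N' \<Longrightarrow> (U, \<kappa>) \<in> atlas G \<Longrightarrow> y \<in> U \<Longrightarrow>
      complex_differentiable (*s) (*) (g \<circ> inv_into U \<kappa>) (\<kappa> y)"
    using g unfolding holomorphic_near_iff by blast
  show ?thesis
    unfolding holomorphic_near_iff
  proof (intro exI[of _ "N \<inter> N'"] conjI ballI)
    fix y assume y: "y \<in> N \<inter> N'"
    show "\<forall>U \<kappa>. (U, \<kappa>) \<in> atlas G \<longrightarrow> y \<in> U \<longrightarrow>
        complex_differentiable (*s) (*) ((\<lambda>y. h (f y) (g y)) \<circ> inv_into U \<kappa>) (\<kappa> y)"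
    proof (intro allI impI)
      fix U \<kappa> assume U: "(U, \<kappa>) \<in> atlas G" "y \<in> U"
      show "complex_differentiable (*s) (*) ((\<lambda>y. h (f y) (g y)) \<circ> inv_into U \<kappa>) (\<kappa> y)"
        using op[OF N(3)[OF _ U] N'(3)[OF _ U]] y by (simp add: o_def)
    qed
  qed (use N N' in auto)
qed

lemma holomorphic_near_add:
  "holomorphic_near G f x \<Longrightarrow> holomorphic_near G g x \<Longrightarrow> holomorphic_near G (\<lambda>y. f y + g y) x"
  by (rule holomorphic_near_binary[where h = "(+)"]) (rule complex_differentiable_add)

lemma holomorphic_near_mult:
  "holomorphic_near G f x \<Longrightarrow> holomorphic_near G g x \<Longrightarrow> holomorphic_near G (\<lambda>y. f y * g y) x"
  by (rule holomorphic_near_binary[where h = "(*)"]) (rule complex_differentiable_mult)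

lemma hol_scale: "hol f \<Longrightarrow> hol (\<lambda>y. c * f y)"
  by (rule holomorphic_near_mult[OF holomorphic_near_const[OF one_closed]])

lemma hol_sum: "(\<And>k. k < (n::nat) \<Longrightarrow> hol (f k)) \<Longrightarrow> hol (\<lambda>y. \<Sum>k<n. f k y)"
  by (induction n) (auto intro!: holomorphic_near_add holomorphic_near_const one_closed)

context
  fixes D assumes D: "D \<in> point_derivations G"
begin

text \<open>The whole carrier is an open neighbourhood of the identity, so functions that agree on
  it have the same germ.\<close>

lemma derivation_cong:
  assumes "hol f" "\<And>y. y \<in> carrier G \<Longrightarrow> f y = g y" shows "D f = D g"
proof -
  have "hol g" by (rule holomorphic_near_cong[OF assms])
  moreover have "openin (group_topology G) (carrier G)"
    using openin_topspace[of "group_topology G"] G_top by simp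
  ultimately show ?thesis
    using D assms one_closed unfolding point_derivations_def Let_def by blast
qed

lemma derivation_add: "hol f \<Longrightarrow> hol g \<Longrightarrow> D (\<lambda>x. f x + g x) = D f + D g"
  and derivation_scale: "hol f \<Longrightarrow> D (\<lambda>x. c * f x) = c * D f"
  and derivation_mult: "hol f \<Longrightarrow> hol g \<Longrightarrow>
    D (\<lambda>x. f x * g x) = D f * g \<one>\<^bsub>G\<^esub> + f \<one>\<^bsub>G\<^esub> * D g"
  using D unfolding point_derivations_def Let_def by blast+

lemma derivation_sum: "(\<And>k. k < (n::nat) \<Longrightarrow> hol (f k)) \<Longrightarrow> D (\<lambda>y. \<Sum>k<n. f k y) = (\<Sum>k<n. D (f k))"
proof (induction n)
  case 0
  \<comment> \<open>A derivation sends the zero function to 0 because that function is 0 times a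
    constant.\<close>
  show ?case using derivation_scale[OF holomorphic_near_const[OF one_closed], of 0 0] by simp
next
  case (Suc n)
  then show ?case using derivation_add[OF hol_sum[of n f], of "f n"] by simp
qed

end

section \<open>Polynomial functions and left-invariant operators\<close>

lemma matrix_element_translate:
  assumes "matrix_representation G n \<rho>" "i < n" "j < n" "x \<in> carrier G" "y \<in> carrier G"
  shows "(if x \<otimes>\<^bsub>G\<^esub> y \<in> carrier G then \<rho> (x \<otimes>\<^bsub>G\<^esub> y) i j else 0) = (\<Sum>k<n. \<rho> x i k * \<rho> y k j)"
  using assms mult_closed unfolding matrix_representation_def by simp

lemma matrix_element_hol:
  assumes "matrix_representation G n \<rho>" "k < n" "j < n" shows "hol (\<lambda>y. \<rho> y k j)"
  using assms one_closed unfolding matrix_representation_def by blast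

text \<open>\<open>left_invariant\<close> applies a derivation to the translate of f by x, which
  must be holomorphic at the identity for the derivation rules to apply. For a matrix element the
  translate is a combination of the entries of one column with constants
  \<open>\<rho> x i k\<close>.\<close>

lemma poly_translate_hol:
  assumes "f \<in> polynomial_functions G" "x \<in> carrier G" shows "hol (\<lambda>y. f (x \<otimes>\<^bsub>G\<^esub> y))"
  using assms(1)
proof (induction rule: polynomial_functions.induct)
  case (matrix_element n \<rho> i j)
  have "hol (\<lambda>y. \<Sum>k<n. \<rho> x i k * \<rho> y k j)"
    using matrix_element by (intro hol_sum hol_scale matrix_element_hol) auto
  then show ?case
    by (rule holomorphic_near_cong) (use matrix_element assms(2) matrix_element_translate in simp)
next
  case (scale f c)
  then show ?case by (intro hol_scale)
next
  case (add f g)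
  then show ?case by (intro holomorphic_near_add)
next
  case (mult f g)
  then show ?case by (intro holomorphic_near_mult)
qed

lemma poly_zero: "(\<lambda>_. 0) \<in> polynomial_functions G"
proof -
  \<comment> \<open>The trivial one-dimensional representation has matrix element 1 on the carrier;
    scaling by 0 gives the zero function.\<close>
  have "matrix_representation G 1 (\<lambda>_ _ _. 1)"
    unfolding matrix_representation_def using holomorphic_near_const by auto
  from polynomial_functions.scale[OF polynomial_functions.matrix_element[OF this, of 0 0], of 0]
  show ?thesis by simp
qed

lemma poly_sum: "(\<And>k. k < (n::nat) \<Longrightarrow> f k \<in> polynomial_functions G) \<Longrightarrow>
    (\<lambda>x. \<Sum>k<n. f k x) \<in> polynomial_functions G"
  by (induction n) (auto intro: poly_zero polynomial_functions.add)

lemma poly_alg_simps [simp]: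
  "carrier F = polynomial_functions G" "f \<oplus>\<^bsub>F\<^esub> g = (\<lambda>x. f x + g x)" "c \<odot>\<^bsub>F\<^esub> f = (\<lambda>x. c * f x)"
  "\<zero>\<^bsub>F\<^esub> = (\<lambda>_. 0)" "f \<otimes>\<^bsub>F\<^esub> g = (\<lambda>x. f x * g x)" "act F = left_invariant G"
  by (simp_all add: poly_alg_def)

lemma poly_vspace: "vspace F"
  by (rule vspaceI) (auto simp: algebra_simps poly_zero intro: polynomial_functions.intros)

context
  fixes a assumes a: "a \<in> point_derivations G"
begin

text \<open>The rule \<rho>(x y) = \<rho>(x) \<rho>(y), differentiated in y at the identity. The
  constants \<open>a (\<lambda>y. \<rho> y k j)\<close> are the entries of the differential of
  \<rho> at a; the row index i is untouched.\<close>

lemma left_invariant_matrix_element: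
  assumes "matrix_representation G n \<rho>" "i < n" "j < n"
  shows "left_invariant G a (\<lambda>x. if x \<in> carrier G then \<rho> x i j else 0)
    = (\<lambda>x. \<Sum>k<n. a (\<lambda>y. \<rho> y k j) * (if x \<in> carrier G then \<rho> x i k else 0))"
proof
  fix x
  show "left_invariant G a (\<lambda>x. if x \<in> carrier G then \<rho> x i j else 0) x
    = (\<Sum>k<n. a (\<lambda>y. \<rho> y k j) * (if x \<in> carrier G then \<rho> x i k else 0))"
  proof (cases "x \<in> carrier G")
    case True
    have h: "hol (\<lambda>y. \<rho> y k j)" if "k < n" for k by (rule matrix_element_hol[OF assms(1) that assms(3)])
    have "a (\<lambda>y. if x \<otimes>\<^bsub>G\<^esub> y \<in> carrier G then \<rho> (x \<otimes>\<^bsub>G\<^esub> y) i j else 0) = a (\<lambda>y. \<Sum>k<n. \<rho> x i k * \<rho> y k j)"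
      by (rule derivation_cong[OF a, symmetric])
         (use assms True matrix_element_translate h in \<open>auto intro!: hol_sum hol_scale\<close>)
    also have "\<dots> = (\<Sum>k<n. a (\<lambda>y. \<rho> x i k * \<rho> y k j))"
      by (rule derivation_sum[OF a]) (intro hol_scale h)
    also have "\<dots> = (\<Sum>k<n. \<rho> x i k * a (\<lambda>y. \<rho> y k j))"
      by (rule sum.cong) (auto simp: derivation_scale[OF a h])
    finally show ?thesis using True by (simp add: left_invariant_def mult.commute)
  qed (simp add: left_invariant_def)
qed

lemma left_invariant_add:
  "f \<in> polynomial_functions G \<Longrightarrow> g \<in> polynomial_functions G \<Longrightarrow>
    left_invariant G a (\<lambda>x. f x + g x) = (\<lambda>x. left_invariant G a f x + left_invariant G a g x)"
  by (auto simp: left_invariant_def fun_eq_iff derivation_add[OF a] poly_translate_hol)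

lemma left_invariant_scale:
  "f \<in> polynomial_functions G \<Longrightarrow> left_invariant G a (\<lambda>x. c * f x) = (\<lambda>x. c * left_invariant G a f x)"
  by (auto simp: left_invariant_def fun_eq_iff derivation_scale[OF a] poly_translate_hol)

lemma left_invariant_mult:
  "f \<in> polynomial_functions G \<Longrightarrow> g \<in> polynomial_functions G \<Longrightarrow> left_invariant G a (\<lambda>x. f x * g x)
    = (\<lambda>x. left_invariant G a f x * g x + f x * left_invariant G a g x)"
  by (auto simp: left_invariant_def fun_eq_iff derivation_mult[OF a] poly_translate_hol mult_one)

lemma left_invariant_poly:
  "f \<in> polynomial_functions G \<Longrightarrow> left_invariant G a f \<in> polynomial_functions G"
proof (induction rule: polynomial_functions.induct)
  case (matrix_element n \<rho> i j)
  then show ?case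
    by (subst left_invariant_matrix_element)
       (auto intro!: poly_sum polynomial_functions.scale polynomial_functions.matrix_element)
qed (auto simp: left_invariant_add left_invariant_scale left_invariant_mult
      intro!: polynomial_functions.add polynomial_functions.mult polynomial_functions.scale)

end

text \<open>Translation on the left by x and the shift on the right inside the operator commute by
  associativity: this is the left invariance of the operator.\<close>

lemma left_invariant_translate:
  assumes b: "b \<in> point_derivations G" and f: "f \<in> polynomial_functions G"
    and x: "x \<in> carrier G" and y: "y \<in> carrier G"
  shows "left_invariant G b f (x \<otimes>\<^bsub>G\<^esub> y) = left_invariant G b (\<lambda>y. f (x \<otimes>\<^bsub>G\<^esub> y)) y"
proof -
  have "b (\<lambda>z. f (x \<otimes>\<^bsub>G\<^esub> y \<otimes>\<^bsub>G\<^esub> z)) = b (\<lambda>z. f (x \<otimes>\<^bsub>G\<^esub> (y \<otimes>\<^bsub>G\<^esub> z)))"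
    by (rule derivation_cong[OF b poly_translate_hol[OF f mult_closed[OF x y]]])
       (simp add: mult_assoc x y)
  then show ?thesis using x y mult_closed by (simp add: left_invariant_def)
qed

text \<open>The bracket of \<open>lie_alg\<close> is a commutator evaluated at the identity, here on
  a translate of f. Left invariance rewrites each of its terms as a composite operator evaluated at
  x, so that the bracket acts as the commutator at every point.\<close>

lemma left_invariant_twice:
  assumes a: "a \<in> point_derivations G" and b: "b \<in> point_derivations G"
    and f: "f \<in> polynomial_functions G" and x: "x \<in> carrier G"
  shows "a (left_invariant G b (\<lambda>y. f (x \<otimes>\<^bsub>G\<^esub> y))) = left_invariant G a (left_invariant G b f) x"
proof -
  have "a (\<lambda>y. left_invariant G b f (x \<otimes>\<^bsub>G\<^esub> y)) = a (left_invariant G b (\<lambda>y. f (x \<otimes>\<^bsub>G\<^esub> y)))"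
    by (rule derivation_cong[OF a poly_translate_hol[OF left_invariant_poly[OF b f] x]])
       (rule left_invariant_translate[OF b f x])
  then show ?thesis using x by (simp add: left_invariant_def)
qed

lemma lie_alg_simps [simp]:
  "carrier (lie_alg G) = point_derivations G" "a \<oplus>\<^bsub>lie_alg G\<^esub> b = (\<lambda>f. a f + b f)"
  "c \<odot>\<^bsub>lie_alg G\<^esub> a = (\<lambda>f. c * a f)"
  by (simp_all add: lie_alg_def)

lemma poly_lie_module: "is_lie_module (lie_alg G) F"
  unfolding is_lie_module_def
proof (intro conjI ballI)
  show "vspace F" by (rule poly_vspace)
  fix a assume "a \<in> carrier (lie_alg G)"
  then have a: "a \<in> point_derivations G" by simp
  show "act F a \<in> linear_maps F F"
    by (rule linear_mapsI)
       (simp_all add: left_invariant_poly[OF a] left_invariant_add[OF a] left_invariant_scale[OF a])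
next
  fix f assume f: "f \<in> carrier F"
  show "(\<lambda>a. act F a f) \<in> linear_maps (lie_alg G) F"
    by (rule linear_mapsI) (use f left_invariant_poly in \<open>auto simp: left_invariant_def\<close>)
next
  fix a b f assume "a \<in> carrier (lie_alg G)" "b \<in> carrier (lie_alg G)" and "f \<in> carrier F"
  then have a: "a \<in> point_derivations G" and b: "b \<in> point_derivations G"
    and f: "f \<in> polynomial_functions G" by simp_all
  have "left_invariant G (bracket (lie_alg G) a b) f =
      (\<lambda>x. left_invariant G a (left_invariant G b f) x - left_invariant G b (left_invariant G a f) x)"
  proof
    fix x
    show "left_invariant G (bracket (lie_alg G) a b) f x
        = left_invariant G a (left_invariant G b f) x - left_invariant G b (left_invariant G a f) x"
    proof (cases "x \<in> carrier G")
      case True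
      have "left_invariant G (bracket (lie_alg G) a b) f x
          = bracket (lie_alg G) a b (\<lambda>y. f (x \<otimes>\<^bsub>G\<^esub> y))"
        using True by (simp add: left_invariant_def)
      also have "\<dots> = a (left_invariant G b (\<lambda>y. f (x \<otimes>\<^bsub>G\<^esub> y))) - b (left_invariant G a (\<lambda>y. f (x \<otimes>\<^bsub>G\<^esub> y)))"
        using poly_translate_hol[OF f True] by (simp add: lie_alg_def)
      finally show ?thesis
        unfolding left_invariant_twice[OF a b f True] left_invariant_twice[OF b a f True] .
    qed (simp add: left_invariant_def)
  qed
  then show "act F (bracket (lie_alg G) a b) f = act F a (act F b f) \<ominus>\<^bsub>F\<^esub> act F b (act F a f)"
    using left_invariant_poly[OF a] left_invariant_poly[OF b] f
    by (simp add: vs_minus[OF poly_vspace])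
qed

text \<open>A finite-dimensional submodule is carried by a finite spanning set instead of the
  subspace: sums and products of functions then correspond to unions and pairwise products of sets,
  which stay finite, and stability is tested on generators only.\<close>

definition stable_generators :: "('g \<Rightarrow> complex) set \<Rightarrow> bool" where
  "stable_generators S \<longleftrightarrow> finite S \<and> S \<subseteq> polynomial_functions G \<and>
    (\<forall>a\<in>point_derivations G. \<forall>s\<in>S. left_invariant G a s \<in> lin_span F S)"

lemma stable_generators_span:
  assumes "stable_generators S"
  shows "subspace_of (lin_span F S) F" "\<And>f. f \<in> lin_span F S \<Longrightarrow> f \<in> polynomial_functions G"
    and "\<And>a f. a \<in> point_derivations G \<Longrightarrow> f \<in> lin_span F S \<Longrightarrow> left_invariant G a f \<in> lin_span F S"
proof -
  have S: "S \<subseteq> carrier F" using assms by (simp add: stable_generators_def)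
  show N: "subspace_of (lin_span F S) F" by (rule lin_span_subspace[OF poly_vspace S])
  show "f \<in> polynomial_functions G" if "f \<in> lin_span F S" for f
    using subspace_subset[OF poly_vspace N] that by auto
  fix a f assume a: "a \<in> point_derivations G" and f: "f \<in> lin_span F S"
  have l: "act F a \<in> linear_maps F F" using lm_act_linear[OF poly_lie_module] a by simp
  have "lin_span F S \<subseteq> {f \<in> carrier F. act F a f \<in> lin_span F S}"
    by (rule lin_span_minimal[OF lin_vimage_subspace[OF poly_vspace poly_vspace l N]])
       (use assms a in \<open>auto simp: stable_generators_def\<close>)
  then show "left_invariant G a f \<in> lin_span F S" using f by auto
qed

lemma stable_generators_union:
  assumes "stable_generators S" "stable_generators T" shows "stable_generators (S \<union> T)"
  using assms lin_span_mono[of S "S \<union> T" F] lin_span_mono[of T "S \<union> T" F]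
  unfolding stable_generators_def by blast

text \<open>Bilinearity in two passes: with one factor a fixed generator from T the other ranges
  over the span of S; afterwards f is fixed and the second factor ranges over the span of T.\<close>

lemma product_span:
  assumes S: "S \<subseteq> polynomial_functions G" and T: "T \<subseteq> polynomial_functions G"
    and f: "f \<in> lin_span F S" and g: "g \<in> lin_span F T"
  shows "(\<lambda>x. f x * g x) \<in> lin_span F {\<lambda>x. s x * t x | s t. s \<in> S \<and> t \<in> T}"
proof -
  let ?R = "{\<lambda>x. s x * t x | s t. s \<in> S \<and> t \<in> T}"
  have R: "?R \<subseteq> carrier F" using S T by (auto intro: polynomial_functions.mult)
  have N: "subspace_of (lin_span F ?R) F" by (rule lin_span_subspace[OF poly_vspace R])
  have l: "(\<lambda>f x. f x * h x) \<in> linear_maps F F" if "h \<in> polynomial_functions G" for h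
    by (rule linear_mapsI) (use that in \<open>auto intro: polynomial_functions.mult simp: algebra_simps\<close>)
  have *: "lin_span F S \<subseteq> {f \<in> carrier F. (\<lambda>x. f x * t x) \<in> lin_span F ?R}" if t: "t \<in> T" for t
  proof (rule lin_span_minimal[OF lin_vimage_subspace[OF poly_vspace poly_vspace l N]])
    show "t \<in> polynomial_functions G" using t T by auto
    show "S \<subseteq> {f \<in> carrier F. (\<lambda>x. f x * t x) \<in> lin_span F ?R}"
      using S t by (auto intro!: lin_span_base)
  qed
  have ft: "(\<lambda>x. t x * f x) \<in> lin_span F ?R" if "t \<in> T" for t
    using subsetD[OF *[OF that] f] by (simp add: mult.commute)
  have fF: "f \<in> polynomial_functions G"
    using subspace_subset[OF poly_vspace lin_span_subspace[OF poly_vspace, of S]] S f by auto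
  have **: "lin_span F T \<subseteq> {g \<in> carrier F. (\<lambda>x. g x * f x) \<in> lin_span F ?R}"
    by (rule lin_span_minimal[OF lin_vimage_subspace[OF poly_vspace poly_vspace l[OF fF] N]])
       (use T ft in auto)
  show ?thesis using subsetD[OF ** g] by (simp add: mult.commute)
qed

text \<open>Induction on the generation of the function: a matrix element uses all entries of its
  row, a sum the union of the two sets, and a product the pairwise products, which are stable by the
  Leibniz rule.\<close>

lemma poly_locally_finite:
  assumes "f \<in> polynomial_functions G"
  shows "\<exists>S. stable_generators S \<and> f \<in> lin_span F S"
  using assms
proof (induction rule: polynomial_functions.induct)
  case (matrix_element n \<rho> i j)
  let ?m = "\<lambda>k x. if x \<in> carrier G then \<rho> x i k else 0"
  let ?S = "?m ` {..<n}"
  have S: "?S \<subseteq> polynomial_functions G"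
    using matrix_element by (auto intro!: polynomial_functions.matrix_element)
  have N: "subspace_of (lin_span F ?S) F" by (rule lin_span_subspace[OF poly_vspace]) (use S in simp)
  \<comment> \<open>Partial sums over k < l, so that the sum in
    \<open>left_invariant_matrix_element\<close> is reached by induction at l = n.\<close>
  have sum: "(\<lambda>x. \<Sum>k<l. c k * ?m k x) \<in> lin_span F ?S" if "l \<le> n" for l c
    using that
  proof (induction l)
    case 0
    show ?case using subspace_zero[OF poly_vspace N] by simp
  next
    case (Suc l)
    have "?m l \<in> lin_span F ?S" using Suc.prems by (intro lin_span_base) auto
    from subspace_add[OF poly_vspace N Suc.IH subspace_smult[OF poly_vspace N this, of "c l"]] Suc.prems
    show ?case by simp
  qed
  have "stable_generators ?S"
    unfolding stable_generators_def
    using S left_invariant_matrix_element[OF _ matrix_element(1,2)] sum[OF order_refl] by auto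
  moreover have "?m j \<in> lin_span F ?S" using matrix_element by (intro lin_span_base) auto
  ultimately show ?case by blast
next
  case (scale f c)
  then obtain S where S: "stable_generators S" "f \<in> lin_span F S" by blast
  from subspace_smult[OF poly_vspace stable_generators_span(1)[OF S(1)] S(2), of c] S(1)
  show ?case by auto
next
  case (add f g)
  then obtain S T where S: "stable_generators S" "f \<in> lin_span F S"
    and T: "stable_generators T" "g \<in> lin_span F T" by blast
  note U = stable_generators_union[OF S(1) T(1)]
  have "f \<in> lin_span F (S \<union> T)" "g \<in> lin_span F (S \<union> T)"
    using S T lin_span_mono[of S "S \<union> T" F] lin_span_mono[of T "S \<union> T" F] by auto
  from subspace_add[OF poly_vspace stable_generators_span(1)[OF U] this] U
  show ?case by auto
next
  case (mult f g)
  then obtain S T where S: "stable_generators S" "f \<in> lin_span F S"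
    and T: "stable_generators T" "g \<in> lin_span F T" by blast
  let ?R = "{\<lambda>x. s x * t x | s t. s \<in> S \<and> t \<in> T}"
  have sub: "S \<subseteq> polynomial_functions G" "T \<subseteq> polynomial_functions G"
    and fin: "finite S" "finite T" using S T by (simp_all add: stable_generators_def)
  have "?R = (\<lambda>(s, t) x. s x * t x) ` (S \<times> T)" by auto
  then have "finite ?R" using fin by simp
  have R: "?R \<subseteq> polynomial_functions G" using sub by (auto intro: polynomial_functions.mult)
  have st: "left_invariant G a (\<lambda>x. s x * t x) \<in> lin_span F ?R"
    if a: "a \<in> point_derivations G" and s: "s \<in> S" and t: "t \<in> T" for a s t
  proof -
    have N: "subspace_of (lin_span F ?R) F" by (rule lin_span_subspace[OF poly_vspace]) (use R in simp)
    have "left_invariant G a s \<in> lin_span F S" "left_invariant G a t \<in> lin_span F T"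
      using S T a s t by (simp_all add: stable_generators_def)
    then have "(\<lambda>x. left_invariant G a s x * t x) \<in> lin_span F ?R"
      "(\<lambda>x. s x * left_invariant G a t x) \<in> lin_span F ?R"
      using product_span[OF sub _ lin_span_base[OF t]] product_span[OF sub lin_span_base[OF s]] by simp_all
    from subspace_add[OF poly_vspace N this] show ?thesis
      using left_invariant_mult[OF a subsetD[OF sub(1) s] subsetD[OF sub(2) t]] by simp
  qed
  have "stable_generators ?R"
    unfolding stable_generators_def
  proof (intro conjI ballI)
    fix a r assume a: "a \<in> point_derivations G" and "r \<in> ?R"
    then obtain s t where "s \<in> S" "t \<in> T" "r = (\<lambda>x. s x * t x)" by blast
    then show "left_invariant G a r \<in> lin_span F ?R" using st[OF a] by simp
  qed fact+
  moreover have "(\<lambda>x. f x * g x) \<in> lin_span F ?R" by (rule product_span[OF sub S(2) T(2)])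
  ultimately show ?case by blast
qed

lemma stable_generators_submodule:
  assumes "stable_generators S"
  shows "is_lie_module (lie_alg G) (F\<lparr>carrier := lin_span F S\<rparr>)" "finite_dim (F\<lparr>carrier := lin_span F S\<rparr>)"
proof -
  let ?N = "lin_span F S" and ?V = "F\<lparr>carrier := lin_span F S\<rparr>"
  note N = stable_generators_span[OF assms]
  have V: "vspace ?V" by (rule subspace_vspace[OF poly_vspace N(1)])
  have S: "S \<subseteq> ?N" by (auto intro: lin_span_base)
  show "is_lie_module (lie_alg G) ?V"
    unfolding is_lie_module_def
  proof (intro conjI ballI)
    show "vspace ?V" by fact
    fix a assume a: "a \<in> carrier (lie_alg G)"
    show "act ?V a \<in> linear_maps ?V ?V"
      by (rule linear_mapsI)
         (use a N(2,3) in \<open>auto simp: left_invariant_add left_invariant_scale\<close>)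
  next
    fix f assume f: "f \<in> carrier ?V"
    show "(\<lambda>a. act ?V a f) \<in> linear_maps (lie_alg G) ?V"
      by (rule linear_mapsI) (use f N(3) in \<open>auto simp: left_invariant_def\<close>)
  next
    fix a b f assume ab: "a \<in> carrier (lie_alg G)" "b \<in> carrier (lie_alg G)" and f: "f \<in> carrier ?V"
    then have fF: "f \<in> carrier F" using N(2) by simp
    have c: "act F a (act F b f) \<in> ?N" "act F b (act F a f) \<in> ?N" using ab f N(3) by auto
    have "act F a (act F b f) \<ominus>\<^bsub>?V\<^esub> act F b (act F a f) = act F a (act F b f) \<ominus>\<^bsub>F\<^esub> act F b (act F a f)"
      using c N(2) by (simp add: vs_minus[OF V] vs_minus[OF poly_vspace])
    then show "act ?V (bracket (lie_alg G) a b) f = act ?V a (act ?V b f) \<ominus>\<^bsub>?V\<^esub> act ?V b (act ?V a f)"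
      using lm_bracket[OF poly_lie_module ab fF] by simp
  qed
  \<comment> \<open>A span in the smaller space is an intersection over subspaces of that space
    only. Each of them is also a subspace of \<open>F\<close>, so the two spans of S agree.\<close>
  have "?N \<subseteq> lin_span ?V S"
    unfolding lin_span_def[of ?V]
  proof (rule Inter_greatest)
    fix K assume "K \<in> {K. subspace_of K ?V \<and> S \<subseteq> K}"
    then have K: "subspace_of K ?V" "S \<subseteq> K" by auto
    have "subspace_of K F"
      by (rule subspaceI[OF poly_vspace])
         (use subspace_subset[OF V K(1)] subspace_zero[OF V K(1)] subspace_add[OF V K(1)]
           subspace_smult[OF V K(1)] N(2) in auto)
    then show "?N \<subseteq> K" using K(2) by (rule lin_span_minimal)
  qed
  moreover have "lin_span ?V S \<subseteq> ?N"
    using lin_span_minimal[OF subspace_carrier[OF V]] S by simp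
  ultimately show "finite_dim ?V"
    unfolding finite_dim_def using assms S by (intro exI[of _ S]) (auto simp: stable_generators_def)
qed

end

section \<open>Naturality\<close>

lemma lie_tensor_simps [simp]:
  "carrier (lie_tensor V W) = carrier (tensor V W)" "add (lie_tensor V W) = add (tensor V W)"
  "smult (lie_tensor V W) = smult (tensor V W)" "zero (lie_tensor V W) = zero (tensor V W)"
  by (simp_all add: lie_tensor_def module.defs lie_module.defs)

text \<open>Tensor products depend only on carrier, addition and scalars, which
  \<open>lie_tensor\<close> shares with \<open>tensor\<close>. As rewrite rules these equations
  identify nested tensor products with and without an action.\<close>

lemma tensor_lie_tensor [simp]:
  "tensor_null A (lie_tensor V W) = tensor_null A (tensor V W)"
  "tensor_null (lie_tensor V W) B = tensor_null (tensor V W) B"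
  "tensor A (lie_tensor V W) = tensor A (tensor V W)" "tensor (lie_tensor V W) B = tensor (tensor V W) B"
  "pure A (lie_tensor V W) = pure A (tensor V W)" "pure (lie_tensor V W) B = pure (tensor V W) B"
  by (simp_all add: tensor_def tensor_null_def tensor_relations_def pure_def fun_eq_iff)

lemma linear_maps_lie_tensor [simp]:
  "linear_maps (lie_tensor V W) Z = linear_maps (tensor V W) Z"
  "linear_maps Z (lie_tensor V W) = linear_maps Z (tensor V W)"
  by (simp_all add: linear_maps_def)

text \<open>The part of the module structure on which the naturality arguments rest. It passes to
  \<open>lie_tensor\<close> at once, so iterated tensor products are covered by the same
  lemmas.\<close>

definition linear_action ::
  "('x, 'e) lie_algebra_scheme \<Rightarrow> ('x, 'v, 'm) lie_module_scheme \<Rightarrow> bool" where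
  "linear_action L V \<longleftrightarrow> vspace V \<and> (\<forall>x\<in>carrier L. act V x \<in> linear_maps V V)"

lemma linear_actionD:
  assumes "linear_action L V"
  shows "vspace V" "\<And>x. x \<in> carrier L \<Longrightarrow> act V x \<in> linear_maps V V"
  using assms by (simp_all add: linear_action_def)

lemma lie_module_linear_action: "is_lie_module L V \<Longrightarrow> linear_action L V"
  by (simp add: is_lie_module_def linear_action_def)

lemma lie_homI:
  assumes "f \<in> linear_maps V W"
    and "\<And>x v. x \<in> carrier L \<Longrightarrow> v \<in> carrier V \<Longrightarrow> f (act V x v) = act W x (f v)"
  shows "f \<in> lie_hom L V W"
  using assms by (simp add: lie_hom_def)

lemma lie_homD:
  assumes "f \<in> lie_hom L V W"
  shows "f \<in> linear_maps V W"
    and "\<And>x v. x \<in> carrier L \<Longrightarrow> v \<in> carrier V \<Longrightarrow> f (act V x v) = act W x (f v)"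
  using assms by (simp_all add: lie_hom_def)

lemma lie_hom_id: "(\<lambda>v. v) \<in> lie_hom L V V"
  by (simp add: lie_hom_def lin_id)

lemma lie_hom_comp:
  assumes f: "f \<in> lie_hom L V W" and g: "g \<in> lie_hom L W Z"
  shows "(\<lambda>v. g (f v)) \<in> lie_hom L V Z"
  by (rule lie_homI[OF lin_comp[OF lie_homD(1)[OF f] lie_homD(1)[OF g]]])
     (simp add: lie_homD(2)[OF f] lie_homD(2)[OF g] lin_closed[OF lie_homD(1)[OF f]])

section \<open>The action on tensor products\<close>

context
  fixes L :: "('x, 'e) lie_algebra_scheme" and V :: "('x, 'v, 'm) lie_module_scheme"
    and W :: "('x, 'w, 'n) lie_module_scheme"
  assumes V: "linear_action L V" and W: "linear_action L W"
begin

lemma lie_tensor_act_bilinear: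
  assumes x: "x \<in> carrier L"
  shows "(\<lambda>v w. pure V W (act V x v) w \<oplus>\<^bsub>tensor V W\<^esub> pure V W v (act W x w))
    \<in> bilinear_maps V W (tensor V W)"
  using bilinear_maps_plus[OF tensor_vspace
      bilinear_maps_comp[OF pure_bilinear linear_actionD(2)[OF V x] lin_id]
      bilinear_maps_comp[OF pure_bilinear lin_id linear_actionD(2)[OF W x]]]
    linear_actionD(1)[OF V] linear_actionD(1)[OF W] by blast

lemma lie_tensor_act_linear:
  "x \<in> carrier L \<Longrightarrow> act (lie_tensor V W) x \<in> linear_maps (tensor V W) (tensor V W)"
  using tensor_lift_linear[OF linear_actionD(1)[OF V] linear_actionD(1)[OF W]
      tensor_vspace[OF linear_actionD(1)[OF V] linear_actionD(1)[OF W]] lie_tensor_act_bilinear]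
  by (simp add: lie_tensor_def module.defs lie_module.defs)

lemma lie_tensor_act_pure:
  "x \<in> carrier L \<Longrightarrow> v \<in> carrier V \<Longrightarrow> w \<in> carrier W \<Longrightarrow> act (lie_tensor V W) x (pure V W v w)
    = pure V W (act V x v) w \<oplus>\<^bsub>tensor V W\<^esub> pure V W v (act W x w)"
  using tensor_lift_pure[OF linear_actionD(1)[OF V] linear_actionD(1)[OF W]
      tensor_vspace[OF linear_actionD(1)[OF V] linear_actionD(1)[OF W]] lie_tensor_act_bilinear]
  by (simp add: lie_tensor_def module.defs lie_module.defs)

lemma lie_tensor_linear_action: "linear_action L (lie_tensor V W)"
  unfolding linear_action_def
  using vspace_cong[OF tensor_vspace[OF linear_actionD(1)[OF V] linear_actionD(1)[OF W]],
      of "lie_tensor V W"] lie_tensor_act_linear by simp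

end

lemma tensor_map_lie_hom:
  assumes V: "linear_action L V" and W: "linear_action L W"
    and V': "linear_action L V'" and W': "linear_action L W'"
    and f: "f \<in> lie_hom L V V'" and g: "g \<in> lie_hom L W W'"
  shows "tensor_map V' W' f g \<in> lie_hom L (lie_tensor V W) (lie_tensor V' W')"
proof -
  note vs = linear_actionD(1)[OF V] linear_actionD(1)[OF W] linear_actionD(1)[OF V'] linear_actionD(1)[OF W']
  note fg = lie_homD(1)[OF f] lie_homD(1)[OF g]
  note l = tensor_map_linear[OF vs fg] and p = tensor_map_pure[OF vs fg]
  note pc = pure_closed[OF vs(1,2)]
  show ?thesis
  proof (rule lie_homI)
    show "tensor_map V' W' f g \<in> linear_maps (lie_tensor V W) (lie_tensor V' W')" using l by simp
    fix x T assume x: "x \<in> carrier L" and "T \<in> carrier (lie_tensor V W)"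
    then have T: "T \<in> carrier (tensor V W)" by simp
    note A = lie_tensor_act_linear[OF V W x] and A' = lie_tensor_act_linear[OF V' W' x]
    show "tensor_map V' W' f g (act (lie_tensor V W) x T) = act (lie_tensor V' W') x (tensor_map V' W' f g T)"
    proof (rule tensor_ext[OF vs(1,2) lin_comp[OF A l] lin_comp[OF l A'] _ T])
      fix v w assume v: "v \<in> carrier V" and w: "w \<in> carrier W"
      note xv = lin_closed[OF linear_actionD(2)[OF V x] v] and xw = lin_closed[OF linear_actionD(2)[OF W x] w]
      show "tensor_map V' W' f g (act (lie_tensor V W) x (pure V W v w))
          = act (lie_tensor V' W') x (tensor_map V' W' f g (pure V W v w))"
        using lie_homD(2)[OF f x v] lie_homD(2)[OF g x w]
        by (simp add: lie_tensor_act_pure[OF V W x v w] lin_add[OF l pc[OF xv w] pc[OF v xw]]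
            p[OF v w] p[OF xv w] p[OF v xw]
            lie_tensor_act_pure[OF V' W' x lin_closed[OF fg(1) v] lin_closed[OF fg(2) w]])
    qed
  qed
qed

lemma tensor_assoc_ext:
  assumes A: "vspace A" and B: "vspace B" and C: "vspace C"
    and f: "f \<in> linear_maps (tensor (tensor A B) C) Z" and g: "g \<in> linear_maps (tensor (tensor A B) C) Z"
    and eq: "\<And>a b c. a \<in> carrier A \<Longrightarrow> b \<in> carrier B \<Longrightarrow> c \<in> carrier C \<Longrightarrow>
      f (pure (tensor A B) C (pure A B a b) c) = g (pure (tensor A B) C (pure A B a b) c)"
    and T: "T \<in> carrier (tensor (tensor A B) C)"
  shows "f T = g T"
proof (rule tensor_ext[OF tensor_vspace[OF A B] C f g _ T])
  fix S c assume S: "S \<in> carrier (tensor A B)" and c: "c \<in> carrier C"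
  note p = bilinear_mapsD(2)[OF pure_bilinear[OF tensor_vspace[OF A B] C] c]
  show "f (pure (tensor A B) C S c) = g (pure (tensor A B) C S c)"
    by (rule tensor_ext[OF A B lin_comp[OF p f] lin_comp[OF p g] eq[OF _ _ c] S])
qed

text \<open>On a pure triple tensor both actions produce the same three terms, one per factor; only
  their grouping differs, and associativity of addition reconciles it.\<close>

lemma tensor_assoc_lie_hom:
  assumes A: "linear_action L A" and B: "linear_action L B" and C: "linear_action L C"
  shows "tensor_assoc A B C \<in> lie_hom L (lie_tensor (lie_tensor A B) C) (lie_tensor A (lie_tensor B C))"
proof -
  note vs = linear_actionD(1)[OF A] linear_actionD(1)[OF B] linear_actionD(1)[OF C]
  note AB = lie_tensor_linear_action[OF A B] and BC = lie_tensor_linear_action[OF B C]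
  note tAB = tensor_vspace[OF vs(1,2)] and tBC = tensor_vspace[OF vs(2,3)]
  note tA_BC = tensor_vspace[OF vs(1) tBC]
  note l = tensor_assoc_linear[OF vs] and p = tensor_assoc_pure[OF vs]
  show ?thesis
  proof (rule lie_homI)
    show "tensor_assoc A B C \<in> linear_maps (lie_tensor (lie_tensor A B) C) (lie_tensor A (lie_tensor B C))"
      using l by simp
    fix x T assume x: "x \<in> carrier L" and "T \<in> carrier (lie_tensor (lie_tensor A B) C)"
    then have T: "T \<in> carrier (tensor (tensor A B) C)" by simp
    note X = lie_tensor_act_linear[OF AB C x, simplified] and X' = lie_tensor_act_linear[OF A BC x, simplified]
    show "tensor_assoc A B C (act (lie_tensor (lie_tensor A B) C) x T)
        = act (lie_tensor A (lie_tensor B C)) x (tensor_assoc A B C T)"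
    proof (rule tensor_assoc_ext[OF vs lin_comp[OF X l] lin_comp[OF l X'] _ T])
      fix a b c assume a: "a \<in> carrier A" and b: "b \<in> carrier B" and c: "c \<in> carrier C"
      note xa = lin_closed[OF linear_actionD(2)[OF A x] a] and xb = lin_closed[OF linear_actionD(2)[OF B x] b]
        and xc = lin_closed[OF linear_actionD(2)[OF C x] c]
      note ab = pure_closed[OF vs(1,2)] and bc = pure_closed[OF vs(2,3)]
      note ab_c = pure_closed[OF tAB vs(3)] and a_bc = pure_closed[OF vs(1) tBC]
      note add1 = lin_add[OF bilinear_mapsD(2)[OF pure_bilinear[OF tAB vs(3)] c] ab[OF xa b] ab[OF a xb]]
      note add2 = lin_add[OF bilinear_mapsD(1)[OF pure_bilinear[OF vs(1) tBC] a] bc[OF xb c] bc[OF b xc]]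
      note tAB_C = tensor_vspace[OF tAB vs(3)]
      have "act (lie_tensor (lie_tensor A B) C) x (pure (tensor A B) C (pure A B a b) c)
          = (pure (tensor A B) C (pure A B (act A x a) b) c
            \<oplus>\<^bsub>tensor (tensor A B) C\<^esub> pure (tensor A B) C (pure A B a (act B x b)) c)
            \<oplus>\<^bsub>tensor (tensor A B) C\<^esub> pure (tensor A B) C (pure A B a b) (act C x c)"
        using lie_tensor_act_pure[OF AB C x, simplified, OF ab[OF a b] c]
        by (simp add: lie_tensor_act_pure[OF A B x a b] add1)
      then have "tensor_assoc A B C (act (lie_tensor (lie_tensor A B) C) x (pure (tensor A B) C (pure A B a b) c))
          = (pure A (tensor B C) (act A x a) (pure B C b c)
            \<oplus>\<^bsub>tensor A (tensor B C)\<^esub> pure A (tensor B C) a (pure B C (act B x b) c))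
            \<oplus>\<^bsub>tensor A (tensor B C)\<^esub> pure A (tensor B C) a (pure B C b (act C x c))"
        by (simp add: lin_add[OF l vs_add_closed[OF tAB_C ab_c[OF ab[OF xa b] c] ab_c[OF ab[OF a xb] c]]
              ab_c[OF ab[OF a b] xc]] lin_add[OF l ab_c[OF ab[OF xa b] c] ab_c[OF ab[OF a xb] c]]
            p[OF xa b c] p[OF a xb c] p[OF a b xc])
      also have "\<dots> = act (lie_tensor A (lie_tensor B C)) x (pure A (tensor B C) a (pure B C b c))"
        using lie_tensor_act_pure[OF A BC x a, simplified, OF bc[OF b c]]
        by (simp add: lie_tensor_act_pure[OF B C x b c] add2
            vs_assoc[OF tA_BC a_bc[OF xa bc[OF b c]] a_bc[OF a bc[OF xb c]] a_bc[OF a bc[OF b xc]]])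
      finally show "tensor_assoc A B C (act (lie_tensor (lie_tensor A B) C) x (pure (tensor A B) C (pure A B a b) c))
          = act (lie_tensor A (lie_tensor B C)) x (tensor_assoc A B C (pure (tensor A B) C (pure A B a b) c))"
        by (simp add: p[OF a b c])
    qed
  qed
qed

lemma compose_intertwiners_lie_hom:
  assumes M: "linear_action L M" and V: "linear_action L V" and W: "linear_action L W"
    and \<phi>: "\<phi> \<in> lie_hom L M (lie_tensor M V)" and \<psi>: "\<psi> \<in> lie_hom L M (lie_tensor M W)"
  shows "compose_intertwiners M V W \<phi> \<psi> \<in> lie_hom L M (lie_tensor M (lie_tensor V W))"
proof -
  have "tensor_map (lie_tensor M V) W \<phi> (\<lambda>w. w) \<in> lie_hom L (lie_tensor M W) (lie_tensor (lie_tensor M V) W)"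
    by (rule tensor_map_lie_hom[OF M W lie_tensor_linear_action[OF M V] W \<phi> lie_hom_id])
  moreover have "tensor_map (lie_tensor M V) W \<phi> (\<lambda>w. w) = tensor_map (tensor M V) W \<phi> id"
    by (simp add: tensor_map_def id_def)
  ultimately have "tensor_map (tensor M V) W \<phi> id \<in> lie_hom L (lie_tensor M W) (lie_tensor (lie_tensor M V) W)"
    by simp
  from lie_hom_comp[OF lie_hom_comp[OF \<psi> this] tensor_assoc_lie_hom[OF M V W]]
  show ?thesis by (simp add: compose_intertwiners_def o_def)
qed


subsection \<open>Action of formal series\<close>

lemma env_some:
  assumes L: "is_lie_algebra L" and u: "u \<in> carrier (env L)"
  shows "{w. (SOME t. t \<in> u) w \<noteq> 0} \<subseteq> lists (carrier L)"
proof -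
  have "(SOME t. t \<in> u) \<in> carrier (free_alg L)"
    using quot_some(1)[OF free_alg_vspace env_ideal_subspace[OF L]] u by (simp only: env_def)
  then show ?thesis by (simp add: free_carrier)
qed

lemma foldr_act_linear:
  assumes "linear_action L V" "w \<in> lists (carrier L)"
  shows "foldr (act V) w \<in> linear_maps V V"
  using assms(2)
proof (induction w)
  case Nil
  then show ?case using lin_id by (simp add: id_def)
next
  case (Cons x w)
  then have "(\<lambda>v. act V x (foldr (act V) w v)) \<in> linear_maps V V"
    by (intro lin_comp[OF _ linear_actionD(2)[OF assms(1)]]) auto
  then show ?case by (simp add: o_def)
qed

lemma env_act_linear:
  assumes L: "is_lie_algebra L" and V: "linear_action L V" and u: "u \<in> carrier (env L)"
  shows "env_act V u \<in> linear_maps V V"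
proof -
  let ?t = "SOME t. t \<in> u"
  have "(\<lambda>v. \<Oplus>\<^bsub>V\<^esub> w \<in> {w. ?t w \<noteq> 0}. ?t w \<odot>\<^bsub>V\<^esub> foldr (act V) w v) \<in> linear_maps V V"
    by (intro lin_combination_finsum linear_actionD(1)[OF V] lin_scale foldr_act_linear[OF V])
       (use env_some[OF L u] in blast)
  then show ?thesis by (simp add: env_act_def[abs_def] Let_def)
qed

text \<open>\<open>env_act\<close> reads a representative chosen from u alone, so both sides
  evaluate the same combination of words, and p commutes with each word letter by letter.\<close>

lemma env_act_natural:
  assumes L: "is_lie_algebra L" and V: "linear_action L V" and W: "linear_action L W"
    and p: "p \<in> lie_hom L V W" and u: "u \<in> carrier (env L)" and v: "v \<in> carrier V"
  shows "p (env_act V u v) = env_act W u (p v)"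
proof -
  let ?t = "SOME t. t \<in> u"
  note vV = linear_actionD(1)[OF V] and vW = linear_actionD(1)[OF W] and pl = lie_homD(1)[OF p]
  interpret W: abelian_group W by (rule vs_abelian[OF vW])
  have fold: "p (foldr (act V) w v) = foldr (act W) w (p v)" if "w \<in> lists (carrier L)" for w
    using that
  proof (induction w)
    case (Cons x w)
    then show ?case
      using lie_homD(2)[OF p _ lin_closed[OF foldr_act_linear[OF V] v]] by simp
  qed simp
  have cl: "foldr (act V) w v \<in> carrier V" if "w \<in> lists (carrier L)" for w
    by (rule lin_closed[OF foldr_act_linear[OF V that] v])
  have supp: "w \<in> lists (carrier L)" if "?t w \<noteq> 0" for w using env_some[OF L u] that by blast
  have "p (env_act V u v) = (\<Oplus>\<^bsub>W\<^esub> w \<in> {w. ?t w \<noteq> 0}. p (?t w \<odot>\<^bsub>V\<^esub> foldr (act V) w v))"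
    unfolding env_act_def Let_def
    by (rule lin_finsum[OF vV vW pl]) (use cl supp in \<open>auto simp del: in_lists_conv_set intro!: vs_smult_closed[OF vV]\<close>)
  also have "\<dots> = (\<Oplus>\<^bsub>W\<^esub> w \<in> {w. ?t w \<noteq> 0}. ?t w \<odot>\<^bsub>W\<^esub> foldr (act W) w (p v))"
  proof (rule W.finsum_cong'[OF refl])
    fix w assume "w \<in> {w. ?t w \<noteq> 0}"
    then have w: "w \<in> lists (carrier L)" using supp by blast
    show "p (?t w \<odot>\<^bsub>V\<^esub> foldr (act V) w v) = ?t w \<odot>\<^bsub>W\<^esub> foldr (act W) w (p v)"
      by (simp add: lin_smult[OF pl cl[OF w]] fold[OF w])
  next
    show "(\<lambda>w. ?t w \<odot>\<^bsub>W\<^esub> foldr (act W) w (p v)) \<in> {w. ?t w \<noteq> 0} \<rightarrow> carrier W"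
      using lin_closed[OF foldr_act_linear[OF W supp] lin_closed[OF pl v]]
      by (auto intro!: vs_smult_closed[OF vW])
  qed
  finally show ?thesis by (simp add: env_act_def Let_def)
qed

context
  fixes L :: "('x, 'e) lie_algebra_scheme" and Z :: "'x env2"
  assumes L: "is_lie_algebra L" and Z: "Z \<in> carrier (tensor (env L) (env L))"
begin

lemma env2_some:
  assumes "(SOME t. t \<in> Z) q \<noteq> 0"
  shows "fst q \<in> carrier (env L) \<and> snd q \<in> carrier (env L)"
proof -
  have "(SOME t. t \<in> Z) \<in> carrier (free_space (carrier (env L) \<times> carrier (env L)))"
    by (rule quot_some(1)[OF free_vspace tensor_null_subspace[OF env_vspace[OF L] env_vspace[OF L]]
          Z[unfolded tensor_def]])
  then have "{p. (SOME t. t \<in> Z) p \<noteq> 0} \<subseteq> carrier (env L) \<times> carrier (env L)"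
    by (simp only: free_carrier)
  from subsetD[OF this, of q] show ?thesis using assms by (cases q) simp
qed

text \<open>The sum over the chosen representative of Z is kept explicit. The representative depends
  on Z and not on the modules, so the sums for two pairs of modules have the same index set and can
  be compared termwise.\<close>

lemma env2_act_pure:
  assumes V: "linear_action L V" and W: "linear_action L W" and v: "v \<in> carrier V" and w: "w \<in> carrier W"
  shows "env2_act V W Z (pure V W v w) = (\<Oplus>\<^bsub>tensor V W\<^esub> q \<in> {q. (SOME t. t \<in> Z) q \<noteq> 0}.
      (SOME t. t \<in> Z) q \<odot>\<^bsub>tensor V W\<^esub> pure V W (env_act V (fst q) v) (env_act W (snd q) w))"
    and "env2_act V W Z (pure V W v w) \<in> carrier (tensor V W)"
proof -
  let ?t = "SOME t. t \<in> Z"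
  note vs = linear_actionD(1)[OF V] linear_actionD(1)[OF W]
  note tVW = tensor_vspace[OF vs]
  interpret T: abelian_group "tensor V W" by (rule vs_abelian[OF tVW])
  have eq: "tensor_map V W (env_act V (fst q)) (env_act W (snd q)) (pure V W v w)
      = pure V W (env_act V (fst q) v) (env_act W (snd q) w)"
    and cl: "pure V W (env_act V (fst q) v) (env_act W (snd q) w) \<in> carrier (tensor V W)"
    if "?t q \<noteq> 0" for q
  proof -
    note e = env_act_linear[OF L V conjunct1[OF env2_some[OF that]]]
      env_act_linear[OF L W conjunct2[OF env2_some[OF that]]]
    show "tensor_map V W (env_act V (fst q)) (env_act W (snd q)) (pure V W v w)
      = pure V W (env_act V (fst q) v) (env_act W (snd q) w)"
      by (rule tensor_map_pure[OF vs vs e v w])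
    show "pure V W (env_act V (fst q) v) (env_act W (snd q) w) \<in> carrier (tensor V W)"
      by (rule pure_closed[OF vs lin_closed[OF e(1) v] lin_closed[OF e(2) w]])
  qed
  have *: "(\<lambda>q. ?t q \<odot>\<^bsub>tensor V W\<^esub> pure V W (env_act V (fst q) v) (env_act W (snd q) w))
      \<in> {q. ?t q \<noteq> 0} \<rightarrow> carrier (tensor V W)"
    using cl by (auto intro!: vs_smult_closed[OF tVW])
  show 1: "env2_act V W Z (pure V W v w) = (\<Oplus>\<^bsub>tensor V W\<^esub> q \<in> {q. ?t q \<noteq> 0}.
      ?t q \<odot>\<^bsub>tensor V W\<^esub> pure V W (env_act V (fst q) v) (env_act W (snd q) w))"
    unfolding env2_act_def tensor_lift_def Let_def
    by (rule T.finsum_cong'[OF refl *]) (simp add: eq)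
  show "env2_act V W Z (pure V W v w) \<in> carrier (tensor V W)"
    unfolding 1 by (rule T.finsum_closed[OF *])
qed

lemma env2_act_natural:
  assumes V: "linear_action L V" and W: "linear_action L W"
    and V': "linear_action L V'" and W': "linear_action L W'"
    and p: "p \<in> lie_hom L V V'" and q: "q \<in> lie_hom L W W'"
    and v: "v \<in> carrier V" and w: "w \<in> carrier W"
  shows "tensor_map V' W' p q (env2_act V W Z (pure V W v w)) = env2_act V' W' Z (pure V' W' (p v) (q w))"
proof -
  let ?t = "SOME t. t \<in> Z"
  note vs = linear_actionD(1)[OF V] linear_actionD(1)[OF W] linear_actionD(1)[OF V'] linear_actionD(1)[OF W']
  note pq = lie_homD(1)[OF p] lie_homD(1)[OF q]
  note l = tensor_map_linear[OF vs pq]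
  note tVW = tensor_vspace[OF vs(1,2)] and tVW' = tensor_vspace[OF vs(3,4)]
  interpret T: abelian_group "tensor V' W'" by (rule vs_abelian[OF tVW'])
  note pv = lin_closed[OF pq(1) v] and qw = lin_closed[OF pq(2) w]
  have cl: "env_act V (fst r) v \<in> carrier V" "env_act W (snd r) w \<in> carrier W"
    and cl': "env_act V' (fst r) (p v) \<in> carrier V'" "env_act W' (snd r) (q w) \<in> carrier W'"
    and nat: "p (env_act V (fst r) v) = env_act V' (fst r) (p v)"
      "q (env_act W (snd r) w) = env_act W' (snd r) (q w)"
    if "?t r \<noteq> 0" for r
  proof -
    note U = conjunct1[OF env2_some[OF that]] conjunct2[OF env2_some[OF that]]
    show "env_act V (fst r) v \<in> carrier V" by (rule lin_closed[OF env_act_linear[OF L V U(1)] v])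
    show "env_act W (snd r) w \<in> carrier W" by (rule lin_closed[OF env_act_linear[OF L W U(2)] w])
    show "env_act V' (fst r) (p v) \<in> carrier V'" by (rule lin_closed[OF env_act_linear[OF L V' U(1)] pv])
    show "env_act W' (snd r) (q w) \<in> carrier W'" by (rule lin_closed[OF env_act_linear[OF L W' U(2)] qw])
    show "p (env_act V (fst r) v) = env_act V' (fst r) (p v)" by (rule env_act_natural[OF L V V' p U(1) v])
    show "q (env_act W (snd r) w) = env_act W' (snd r) (q w)" by (rule env_act_natural[OF L W W' q U(2) w])
  qed
  have "tensor_map V' W' p q (env2_act V W Z (pure V W v w)) = (\<Oplus>\<^bsub>tensor V' W'\<^esub> r \<in> {r. ?t r \<noteq> 0}.
      tensor_map V' W' p q (?t r \<odot>\<^bsub>tensor V W\<^esub> pure V W (env_act V (fst r) v) (env_act W (snd r) w)))"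
    unfolding env2_act_pure(1)[OF V W v w]
    by (rule lin_finsum[OF tVW tVW' l]) (use cl in \<open>auto intro!: vs_smult_closed[OF tVW] pure_closed[OF vs(1,2)]\<close>)
  also have "\<dots> = (\<Oplus>\<^bsub>tensor V' W'\<^esub> r \<in> {r. ?t r \<noteq> 0}.
      ?t r \<odot>\<^bsub>tensor V' W'\<^esub> pure V' W' (env_act V' (fst r) (p v)) (env_act W' (snd r) (q w)))"
  proof (rule T.finsum_cong'[OF refl])
    show "(\<lambda>r. ?t r \<odot>\<^bsub>tensor V' W'\<^esub> pure V' W' (env_act V' (fst r) (p v)) (env_act W' (snd r) (q w)))
        \<in> {r. ?t r \<noteq> 0} \<rightarrow> carrier (tensor V' W')"
      using cl' by (auto intro!: vs_smult_closed[OF tVW'] pure_closed[OF vs(3,4)])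
    show "tensor_map V' W' p q (?t r \<odot>\<^bsub>tensor V W\<^esub> pure V W (env_act V (fst r) v) (env_act W (snd r) w))
        = ?t r \<odot>\<^bsub>tensor V' W'\<^esub> pure V' W' (env_act V' (fst r) (p v)) (env_act W' (snd r) (q w))"
      if "r \<in> {r. ?t r \<noteq> 0}" for r
      using that
      by (simp add: lin_smult[OF l pure_closed[OF vs(1,2) cl]] tensor_map_pure[OF vs pq cl] nat)
  qed
  also have "\<dots> = env2_act V' W' Z (pure V' W' (p v) (q w))"
    by (rule env2_act_pure(1)[OF V' W' pv qw, symmetric])
  finally show ?thesis .
qed

end

text \<open>Finiteness of the sum plays no role: split injectivity makes the index sets on both sides
  coincide, and \<^const>\<open>finsum\<close> vanishes on infinite sets.\<close>

lemma series_act_natural: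
  assumes L: "is_lie_algebra L"
    and V: "linear_action L V" and W: "linear_action L W"
    and V': "linear_action L V'" and W': "linear_action L W'"
    and p: "p \<in> lie_hom L V V'" and q: "q \<in> lie_hom L W W'"
    and r: "r \<in> linear_maps V' V" "\<And>v. v \<in> carrier V \<Longrightarrow> r (p v) = v"
    and s: "s \<in> linear_maps W' W" "\<And>w. w \<in> carrier W \<Longrightarrow> s (q w) = w"
    and K: "\<And>\<beta> \<gamma>. \<beta> \<in> dual L \<hh> \<Longrightarrow> \<gamma> \<in> dual L \<hh> \<Longrightarrow> K \<beta> \<gamma> \<in> carrier (tensor (env L) (env L))"
    and v: "v \<in> carrier V" and w: "w \<in> carrier W"
  shows "tensor_map V' W' p q (series_act L \<hh> V W K (pure V W v w))
    = series_act L \<hh> V' W' K (pure V' W' (p v) (q w))"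
proof -
  let ?e = "\<lambda>b. env2_act V W (K (fst b) (snd b)) (pure V W v w)"
  let ?e' = "\<lambda>b. env2_act V' W' (K (fst b) (snd b)) (pure V' W' (p v) (q w))"
  let ?D = "dual L \<hh> \<times> dual L \<hh>"
  note vs = linear_actionD(1)[OF V] linear_actionD(1)[OF W] linear_actionD(1)[OF V'] linear_actionD(1)[OF W']
  note pq = lie_homD(1)[OF p] lie_homD(1)[OF q]
  note l = tensor_map_linear[OF vs pq] and l' = tensor_map_linear[OF vs(3,4,1,2) r(1) s(1)]
  note tVW = tensor_vspace[OF vs(1,2)] and tVW' = tensor_vspace[OF vs(3,4)]
  interpret T: abelian_group "tensor V' W'" by (rule vs_abelian[OF tVW'])
  \<comment> \<open>The tensor product of the two retractions undoes that of p and q, which is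
    therefore injective and preserves nonvanishing of the components.\<close>
  have inv: "tensor_map V W r s (tensor_map V' W' p q X) = X" if "X \<in> carrier (tensor V W)" for X
  proof (rule tensor_ext[OF vs(1,2) lin_comp[OF l l'] lin_id _ that])
    fix a b assume a: "a \<in> carrier V" and b: "b \<in> carrier W"
    show "tensor_map V W r s (tensor_map V' W' p q (pure V W a b)) = pure V W a b"
      using tensor_map_pure[OF vs(3,4,1,2) r(1) s(1) lin_closed[OF pq(1) a] lin_closed[OF pq(2) b]]
      by (simp add: tensor_map_pure[OF vs pq a b] r(2)[OF a] s(2)[OF b])
  qed
  have K': "K (fst b) (snd b) \<in> carrier (tensor (env L) (env L))" if "b \<in> ?D" for b
    using that K by auto
  have nat: "tensor_map V' W' p q (?e b) = ?e' b" and cl: "?e b \<in> carrier (tensor V W)"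
    if "b \<in> ?D" for b
    using env2_act_natural[OF L K'[OF that] V W V' W' p q v w] env2_act_pure(2)[OF L K'[OF that] V W v w]
    by blast+
  have iff: "?e b = \<zero>\<^bsub>tensor V W\<^esub> \<longleftrightarrow> ?e' b = \<zero>\<^bsub>tensor V' W'\<^esub>" if "b \<in> ?D" for b
    using nat[OF that] inv[OF cl[OF that]] lin_zero[OF tVW tVW' l] lin_zero[OF tVW' tVW l'] by metis
  have idx: "{b \<in> ?D. ?e b \<noteq> \<zero>\<^bsub>tensor V W\<^esub>} = {b \<in> ?D. ?e' b \<noteq> \<zero>\<^bsub>tensor V' W'\<^esub>}"
    using iff by blast
  have "tensor_map V' W' p q (series_act L \<hh> V W K (pure V W v w))
      = (\<Oplus>\<^bsub>tensor V' W'\<^esub> b \<in> {b \<in> ?D. ?e b \<noteq> \<zero>\<^bsub>tensor V W\<^esub>}. tensor_map V' W' p q (?e b))"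
    unfolding series_act_def by (rule lin_finsum[OF tVW tVW' l]) (use cl in blast)
  also have "\<dots> = (\<Oplus>\<^bsub>tensor V' W'\<^esub> b \<in> {b \<in> ?D. ?e' b \<noteq> \<zero>\<^bsub>tensor V' W'\<^esub>}. ?e' b)"
  proof (rule T.finsum_cong'[OF idx])
    show "?e' \<in> {b \<in> ?D. ?e' b \<noteq> \<zero>\<^bsub>tensor V' W'\<^esub>} \<rightarrow> carrier (tensor V' W')"
      using lin_closed[OF l cl] nat by (metis (no_types, lifting) Pi_I mem_Collect_eq)
    show "tensor_map V' W' p q (?e b) = ?e' b" if "b \<in> {b \<in> ?D. ?e' b \<noteq> \<zero>\<^bsub>tensor V' W'\<^esub>}" for b
      using that nat by blast
  qed
  finally show ?thesis by (simp add: series_act_def)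
qed


subsection \<open>Leading terms\<close>

context irreducible_verma
begin

text \<open>The map \<xi> \<otimes> id of the overview, with the tensor product of the scalars and V
  identified with V.\<close>

definition highest_component ::
  "('x, 'v, 'm) lie_module_scheme \<Rightarrow> (('x list \<Rightarrow> complex) set set \<times> 'v \<Rightarrow> complex) set \<Rightarrow> 'v" where
  "highest_component V = tensor_lift V (\<lambda>m v. highest_coefficient m \<odot>\<^bsub>V\<^esub> v)"

lemmas M_linear_action = lie_module_linear_action[OF M_lie_module]

context
  fixes V :: "('x, 'v, 'm) lie_module_scheme"
  assumes V: "linear_action L V"
begin

lemma highest_component_bilinear:
  "(\<lambda>m v. highest_coefficient m \<odot>\<^bsub>V\<^esub> v) \<in> bilinear_maps M V V"
proof (rule bilinear_mapsI)
  note vV = linear_actionD(1)[OF V]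
  show "(\<lambda>v. highest_coefficient m \<odot>\<^bsub>V\<^esub> v) \<in> linear_maps V V" for m
    by (rule lin_scale[OF vV lin_id])
  show "(\<lambda>m. highest_coefficient m \<odot>\<^bsub>V\<^esub> v) \<in> linear_maps M V" if "v \<in> carrier V" for v
    by (rule linear_mapsI)
       (use that in \<open>simp_all add: vs_smult_closed[OF vV] highest_coefficient(1,2)
         vs_smult_l[OF vV] vs_smult_assoc[OF vV]\<close>)
qed

lemmas highest_component_linear =
  tensor_lift_linear[OF M_vspace linear_actionD(1)[OF V] linear_actionD(1)[OF V]
    highest_component_bilinear, folded highest_component_def]

lemmas highest_component_pure =
  tensor_lift_pure[OF M_vspace linear_actionD(1)[OF V] linear_actionD(1)[OF V]
    highest_component_bilinear, folded highest_component_def]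

text \<open>The form \<open>highest_coefficient\<close> transforms under \<hh> with weight
  \<Lambda>, so the two terms of the tensor action become a scalar and the action on V. Comparison
  with the weight of \<open>\<phi> I\<close> forces the leading term to have weight zero.\<close>

lemma highest_component_act:
  assumes t: "t \<in> \<hh>" and T: "T \<in> carrier (tensor M V)"
  shows "highest_component V (act (lie_tensor M V) t T)
    = \<Lambda> t \<odot>\<^bsub>V\<^esub> highest_component V T \<oplus>\<^bsub>V\<^esub> act V t (highest_component V T)"
proof -
  note vV = linear_actionD(1)[OF V]
  have tL: "t \<in> carrier L" using t \<hh> by auto
  note l = highest_component_linear and A = lie_tensor_act_linear[OF M_linear_action V tL]
  note tV = linear_actionD(2)[OF V tL]
  show ?thesis
  proof (rule tensor_ext[OF M_vspace vV lin_comp[OF A l] lin_plus[OF vV lin_scale[OF vV l] lin_comp[OF l tV]] _ T])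
    fix m v assume m: "m \<in> carrier M" and v: "v \<in> carrier V"
    note tm = lin_closed[OF M_act_linear[OF tL] m] and tv = lin_closed[OF tV v]
    show "highest_component V (act (lie_tensor M V) t (pure M V m v)) =
        \<Lambda> t \<odot>\<^bsub>V\<^esub> highest_component V (pure M V m v) \<oplus>\<^bsub>V\<^esub> act V t (highest_component V (pure M V m v))"
      by (simp add: lie_tensor_act_pure[OF M_linear_action V tL m v]
          lin_add[OF l pure_closed[OF M_vspace vV tm v] pure_closed[OF M_vspace vV m tv]]
          highest_component_pure[OF tm v] highest_component_pure[OF m tv] highest_component_pure[OF m v]
          highest_coefficient(6)[OF t m] vs_smult_assoc[OF vV v] lin_smult[OF tV v])
  qed
qed

text \<open>Existence: every tensor differs from its highest component, placed on the highest weight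
  vector, by lower terms. Uniqueness: the highest component annihilates lower terms. The hypotheses
  concern only the value at the highest weight vector, since the rule will be applied to the star
  product, which is compared with a known intertwiner only there.\<close>

lemma leading_term_eq:
  assumes \<phi>I: "\<phi> I \<in> carrier (tensor M V)"
    and weight: "\<And>t. t \<in> \<hh> \<Longrightarrow> act (lie_tensor M V) t (\<phi> I) = \<Lambda> t \<odot>\<^bsub>tensor M V\<^esub> \<phi> I"
  shows "leading_term L \<hh> np \<Lambda> V \<phi> = highest_component V (\<phi> I)"
proof -
  note vV = linear_actionD(1)[OF V]
  note tMV = tensor_vspace[OF M_vspace vV]
  note l = highest_component_linear
  note bil = pure_bilinear[OF M_vspace vV]
  let ?X = "{pure M V v g | v g \<mu>. \<mu> \<in> dual L \<hh> \<and> weight_less L \<hh> np \<mu> \<Lambda> \<and>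
      v \<in> weight_space \<hh> M \<mu> \<and> g \<in> carrier V}"
  have X_iff: "y \<in> ?X \<longleftrightarrow> (\<exists>v g. v \<in> lower_weight_vectors \<and> g \<in> carrier V \<and> y = pure M V v g)" for y
    unfolding lower_weight_vectors_def by blast
  have X: "?X \<subseteq> carrier (tensor M V)"
  proof
    fix y assume "y \<in> ?X"
    then obtain v g where "v \<in> lower_weight_vectors" "g \<in> carrier V" "y = pure M V v g"
      unfolding X_iff by blast
    then show "y \<in> carrier (tensor M V)"
      using pure_closed[OF M_vspace vV] lower_weight_vectors_closed by auto
  qed
  note N = lin_span_subspace[OF tMV X]
  have null: "highest_component V y = \<zero>\<^bsub>V\<^esub>" if "y \<in> lin_span (tensor M V) ?X" for y
  proof -
    have "lin_span (tensor M V) ?X \<subseteq> {y \<in> carrier (tensor M V). highest_component V y = \<zero>\<^bsub>V\<^esub>}"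
    proof (rule lin_span_minimal[OF lin_kernel_subspace[OF tMV vV l]], rule subsetI)
      fix y assume y: "y \<in> ?X"
      then obtain v g where "v \<in> lower_weight_vectors" "g \<in> carrier V" "y = pure M V v g"
        unfolding X_iff by blast
      then have "highest_component V y = \<zero>\<^bsub>V\<^esub>"
        using highest_component_pure[of v g] lower_weight_vectors_closed
        by (auto simp: highest_coefficient(4) vs_smult_zero_l[OF vV])
      then show "y \<in> {y \<in> carrier (tensor M V). highest_component V y = \<zero>\<^bsub>V\<^esub>}" using y X by blast
    qed
    then show ?thesis using that by blast
  qed
  have low_pure: "pure M V n v \<in> lin_span (tensor M V) ?X"
    if n: "n \<in> lin_span M lower_weight_vectors" and v: "v \<in> carrier V" for n v
  proof -
    have "lin_span M lower_weight_vectors \<subseteq> {n \<in> carrier M. pure M V n v \<in> lin_span (tensor M V) ?X}"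
    proof (rule lin_span_minimal[OF lin_vimage_subspace[OF M_vspace tMV bilinear_mapsD(2)[OF bil v] N]], rule subsetI)
      fix n assume n: "n \<in> lower_weight_vectors"
      then have "pure M V n v \<in> ?X" unfolding X_iff using v by blast
      then have "pure M V n v \<in> lin_span (tensor M V) ?X" by (rule lin_span_base)
      then show "n \<in> {n \<in> carrier M. pure M V n v \<in> lin_span (tensor M V) ?X}"
        using n lower_weight_vectors_closed by auto
    qed
    then show ?thesis using n by blast
  qed
  have low: "T \<ominus>\<^bsub>tensor M V\<^esub> pure M V I (highest_component V T) \<in> lin_span (tensor M V) ?X"
    if "T \<in> carrier (tensor M V)" for T
    using that
  proof (rule tensor_induct[OF M_vspace vV])
    fix m v assume m: "m \<in> carrier M" and v: "v \<in> carrier V"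
    note cI = vs_smult_closed[OF M_vspace I_closed]
    have "pure M V m v \<ominus>\<^bsub>tensor M V\<^esub> pure M V I (highest_component V (pure M V m v))
        = pure M V (m \<ominus>\<^bsub>M\<^esub> highest_coefficient m \<odot>\<^bsub>M\<^esub> I) v"
      by (simp add: highest_component_pure[OF m v] lin_minus[OF M_vspace tMV bilinear_mapsD(2)[OF bil v] m cI]
          lin_smult[OF bilinear_mapsD(2)[OF bil v] I_closed] lin_smult[OF bilinear_mapsD(1)[OF bil I_closed] v])
    then show "pure M V m v \<ominus>\<^bsub>tensor M V\<^esub> pure M V I (highest_component V (pure M V m v)) \<in> lin_span (tensor M V) ?X"
      using low_pure[OF highest_coefficient(5)[OF m] v] by simp
  next
    fix S T assume S: "S \<in> carrier (tensor M V)" and T: "T \<in> carrier (tensor M V)"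
      and ih: "S \<ominus>\<^bsub>tensor M V\<^esub> pure M V I (highest_component V S) \<in> lin_span (tensor M V) ?X"
        "T \<ominus>\<^bsub>tensor M V\<^esub> pure M V I (highest_component V T) \<in> lin_span (tensor M V) ?X"
    note pI = bilinear_mapsD(1)[OF bil I_closed]
    note hS = lin_closed[OF l S] and hT = lin_closed[OF l T]
    have "(S \<oplus>\<^bsub>tensor M V\<^esub> T) \<ominus>\<^bsub>tensor M V\<^esub> pure M V I (highest_component V (S \<oplus>\<^bsub>tensor M V\<^esub> T))
        = (S \<ominus>\<^bsub>tensor M V\<^esub> pure M V I (highest_component V S))
          \<oplus>\<^bsub>tensor M V\<^esub> (T \<ominus>\<^bsub>tensor M V\<^esub> pure M V I (highest_component V T))"
      using S T lin_closed[OF pI hS] lin_closed[OF pI hT]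
      by (simp add: lin_add[OF l S T] lin_add[OF pI hS hT] vs_simps[OF tMV] vs_closed[OF tMV])
    then show "(S \<oplus>\<^bsub>tensor M V\<^esub> T) \<ominus>\<^bsub>tensor M V\<^esub> pure M V I (highest_component V (S \<oplus>\<^bsub>tensor M V\<^esub> T))
        \<in> lin_span (tensor M V) ?X"
      using subspace_add[OF tMV N ih] by simp
  qed
  let ?f = "highest_component V (\<phi> I)"
  have f: "?f \<in> carrier V" by (rule lin_closed[OF l \<phi>I])
  show ?thesis
    unfolding leading_term_def Let_def
  proof (rule the_equality, rule conjI)
    show "?f \<in> weight_space \<hh> V (\<lambda>_. 0)"
      unfolding weight_space_def
    proof (intro CollectI conjI ballI f)
      fix t assume t: "t \<in> \<hh>"
      have tL: "t \<in> carrier L" using t \<hh> by auto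
      note tf = lin_closed[OF linear_actionD(2)[OF V tL] f]
      \<comment> \<open>Both sides are the highest component of t applied to
        \<open>\<phi> I\<close>, computed by the tensor action and by the weight; cancelling leaves
        t acting by zero.\<close>
      have "\<Lambda> t \<odot>\<^bsub>V\<^esub> ?f \<oplus>\<^bsub>V\<^esub> act V t ?f = \<Lambda> t \<odot>\<^bsub>V\<^esub> ?f"
        using highest_component_act[OF t \<phi>I] by (simp add: weight[OF t] lin_smult[OF l \<phi>I])
      then have "act V t ?f = \<zero>\<^bsub>V\<^esub>"
        using abelian_group.r_neg1[OF vs_abelian[OF vV] vs_smult_closed[OF vV f, of "\<Lambda> t"] tf]
          abelian_group.l_neg[OF vs_abelian[OF vV] vs_smult_closed[OF vV f, of "\<Lambda> t"]] by simp
      then show "act V t ?f = 0 \<odot>\<^bsub>V\<^esub> ?f" by (simp add: vs_smult_zero_l[OF vV f])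
    qed
    show "\<phi> I \<ominus>\<^bsub>tensor M V\<^esub> pure M V I ?f \<in> lin_span (tensor M V) ?X" by (rule low[OF \<phi>I])
  next
    fix g assume g: "g \<in> weight_space \<hh> V (\<lambda>_. 0) \<and> \<phi> I \<ominus>\<^bsub>tensor M V\<^esub> pure M V I g \<in> lin_span (tensor M V) ?X"
    then have gV: "g \<in> carrier V" by (simp add: weight_space_def)
    have "highest_component V (\<phi> I) \<ominus>\<^bsub>V\<^esub> highest_component V (pure M V I g) = \<zero>\<^bsub>V\<^esub>"
      using null[OF conjunct2[OF g]] lin_minus[OF tMV vV l \<phi>I pure_closed[OF M_vspace vV I_closed gV]] by simp
    then show "g = ?f"
      using highest_component_pure[OF I_closed gV] f gV
      by (simp add: highest_coefficient(3) vs_one[OF vV] vs_minus_eq_zero[OF vV])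
  qed
qed

lemma lie_hom_weight:
  assumes \<phi>: "\<phi> \<in> lie_hom L M (lie_tensor M V)"
  shows "\<phi> I \<in> carrier (tensor M V)"
    "\<And>t. t \<in> \<hh> \<Longrightarrow> act (lie_tensor M V) t (\<phi> I) = \<Lambda> t \<odot>\<^bsub>tensor M V\<^esub> \<phi> I"
proof -
  show "\<phi> I \<in> carrier (tensor M V)" using lin_closed[OF lie_homD(1)[OF \<phi>] I_closed] by simp
  show "act (lie_tensor M V) t (\<phi> I) = \<Lambda> t \<odot>\<^bsub>tensor M V\<^esub> \<phi> I" if t: "t \<in> \<hh>" for t
    using lie_homD(2)[OF \<phi> subsetD[OF \<hh> t] I_closed] lin_smult[OF lie_homD(1)[OF \<phi>] I_closed]
    by (simp add: act_I[OF t])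
qed

lemma leading_term_lie_hom:
  assumes \<phi>: "\<phi> \<in> lie_hom L M (lie_tensor M V)"
  shows "leading_term L \<hh> np \<Lambda> V \<phi> = highest_component V (\<phi> I)"
  by (rule leading_term_eq) (simp_all add: lie_hom_weight[OF \<phi>])

end

text \<open>\<xi> \<otimes> id works on the first factor and p on the second, so they commute. It is
  applied to the inclusion of V, to its tensor square and to the multiplication of
  \<open>F\<close>.\<close>

lemma highest_component_natural:
  assumes V: "linear_action L V" and W: "linear_action L W" and p: "p \<in> linear_maps V W"
    and T: "T \<in> carrier (tensor M V)"
  shows "highest_component W (tensor_map M W (\<lambda>m. m) p T) = p (highest_component V T)"
proof -
  note vs = linear_actionD(1)[OF V] linear_actionD(1)[OF W]
  note tm = tensor_map_linear[OF M_vspace vs(1) M_vspace vs(2) lin_id p]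
  show ?thesis
  proof (rule tensor_ext[OF M_vspace vs(1) lin_comp[OF tm highest_component_linear[OF W]]
        lin_comp[OF highest_component_linear[OF V] p] _ T])
    fix m v assume m: "m \<in> carrier M" and v: "v \<in> carrier V"
    show "highest_component W (tensor_map M W (\<lambda>m. m) p (pure M V m v)) = p (highest_component V (pure M V m v))"
      by (simp add: tensor_map_pure[OF M_vspace vs(1) M_vspace vs(2) lin_id p m v]
          highest_component_pure[OF V m v] highest_component_pure[OF W m lin_closed[OF p v]] lin_smult[OF p v])
  qed
qed

end

section \<open>Reduction to finite-dimensional submodules\<close>

locale lie_group_verma = lie_group G + irreducible_verma "lie_alg G" \<hh> np nm \<Lambda>
  for G :: "('g, 'n::finite) complex_lie_group" and \<hh> np nm \<Lambda>
begin

text \<open>The image of M \<otimes> V in M \<otimes> F, for V the span of S. Working inside one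
  fixed space makes inclusion in S meaningful, so that finite supports can be merged.\<close>

abbreviation (input) "supported_tensors S \<equiv> lin_span (tensor M F)
  {pure M F m v | m v. m \<in> carrier M \<and> v \<in> lin_span F S}"

lemmas F_linear_action = lie_module_linear_action[OF poly_lie_module]
lemmas tensor_MF_vspace = tensor_vspace[OF M_vspace poly_vspace]

lemma supported_generators_closed:
  assumes "stable_generators S"
  shows "{pure M F m v | m v. m \<in> carrier M \<and> v \<in> lin_span F S} \<subseteq> carrier (tensor M F)"
  using stable_generators_span(2)[OF assms] by (auto intro!: pure_closed[OF M_vspace poly_vspace])

lemma supported_tensors_subspace:
  "stable_generators S \<Longrightarrow> subspace_of (supported_tensors S) (tensor M F)"
  by (rule lin_span_subspace[OF tensor_MF_vspace supported_generators_closed])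

lemma supported_tensors_mono:
  assumes "S \<subseteq> S'" shows "supported_tensors S \<subseteq> supported_tensors S'"
  using lin_span_mono[OF assms, of F] by (intro lin_span_mono) blast

text \<open>A tensor is a finite sum of pure ones; each second factor lies in a finite-dimensional
  submodule, and finitely many of these are merged by unions.\<close>

lemma supported_tensors_exhaust:
  assumes "T \<in> carrier (tensor M F)"
  shows "\<exists>S. stable_generators S \<and> T \<in> supported_tensors S"
  using assms
proof (rule tensor_induct[OF M_vspace poly_vspace])
  fix m f assume m: "m \<in> carrier M" and "f \<in> carrier F"
  then obtain S where S: "stable_generators S" "f \<in> lin_span F S" using poly_locally_finite by auto
  have "pure M F m f \<in> supported_tensors S" using m S(2) by (intro lin_span_base) blast
  then show "\<exists>S. stable_generators S \<and> pure M F m f \<in> supported_tensors S" using S(1) by blast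
next
  fix X Y assume "\<exists>S. stable_generators S \<and> X \<in> supported_tensors S"
    "\<exists>S. stable_generators S \<and> Y \<in> supported_tensors S"
  then obtain S S' where S: "stable_generators S" "X \<in> supported_tensors S"
    and S': "stable_generators S'" "Y \<in> supported_tensors S'" by blast
  note U = stable_generators_union[OF S(1) S'(1)]
  have "X \<in> supported_tensors (S \<union> S')" "Y \<in> supported_tensors (S \<union> S')"
    using S(2) S'(2) supported_tensors_mono[of S "S \<union> S'"] supported_tensors_mono[of S' "S \<union> S'"] by blast+
  from subspace_add[OF tensor_MF_vspace supported_tensors_subspace[OF U] this] U
  show "\<exists>S. stable_generators S \<and> X \<oplus>\<^bsub>tensor M F\<^esub> Y \<in> supported_tensors S" by blast
qed

lemma supported_tensors_stable:
  assumes S: "stable_generators S" and x: "x \<in> carrier (lie_alg G)" and T: "T \<in> supported_tensors S"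
  shows "act (lie_tensor M F) x T \<in> supported_tensors S"
proof -
  note A = lie_tensor_act_linear[OF M_linear_action F_linear_action x]
  note N = supported_tensors_subspace[OF S]
  have "supported_tensors S \<subseteq> {T \<in> carrier (tensor M F). act (lie_tensor M F) x T \<in> supported_tensors S}"
  proof (rule lin_span_minimal[OF lin_vimage_subspace[OF tensor_MF_vspace tensor_MF_vspace A N]], rule subsetI)
    fix y assume y: "y \<in> {pure M F m v | m v. m \<in> carrier M \<and> v \<in> lin_span F S}"
    then obtain m v where m: "m \<in> carrier M" and v: "v \<in> lin_span F S" and y_eq: "y = pure M F m v" by blast
    have vF: "v \<in> carrier F" using stable_generators_span(2)[OF S v] by simp
    have xv: "act F x v \<in> lin_span F S" using stable_generators_span(3)[OF S _ v] x by simp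
    have "pure M F (act M x m) v \<in> supported_tensors S" "pure M F m (act F x v) \<in> supported_tensors S"
      by (rule lin_span_base, use lin_closed[OF M_act_linear[OF x] m] m v xv in blast)+
    from subspace_add[OF tensor_MF_vspace N this]
    have "act (lie_tensor M F) x y \<in> supported_tensors S"
      unfolding y_eq lie_tensor_act_pure[OF M_linear_action F_linear_action x m vF] .
    then show "y \<in> {T \<in> carrier (tensor M F). act (lie_tensor M F) x T \<in> supported_tensors S}"
      using y supported_generators_closed[OF S] by blast
  qed
  then show ?thesis using T by blast
qed

text \<open>The vectors sent into the supported tensors form a submodule containing the generator of
  the Verma module, so a condition on the single tensor \<open>\<phi> I\<close> controls all values
  of \<phi>.\<close>

lemma intertwiner_support:
  assumes S: "stable_generators S" and \<phi>: "\<phi> \<in> lie_hom (lie_alg G) M (lie_tensor M F)"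
    and I: "\<phi> I \<in> supported_tensors S" and m: "m \<in> carrier M"
  shows "\<phi> m \<in> supported_tensors S"
proof -
  have l: "\<phi> \<in> linear_maps M (tensor M F)" using lie_homD(1)[OF \<phi>] by simp
  have "{m \<in> carrier M. \<phi> m \<in> supported_tensors S} = carrier M"
  proof (rule verma_cyclic[OF L \<hh> np_closed])
    show "subspace_of {m \<in> carrier M. \<phi> m \<in> supported_tensors S} M"
      by (rule lin_vimage_subspace[OF M_vspace tensor_MF_vspace l supported_tensors_subspace[OF S]])
    show "act M x m \<in> {m \<in> carrier M. \<phi> m \<in> supported_tensors S}"
      if x: "x \<in> carrier (lie_alg G)" and m: "m \<in> {m \<in> carrier M. \<phi> m \<in> supported_tensors S}" for x m
    proof -
      have "m \<in> carrier M" "\<phi> m \<in> supported_tensors S" using m by simp_all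
      then show ?thesis
        using lin_closed[OF M_act_linear[OF x]] lie_homD(2)[OF \<phi> x] supported_tensors_stable[OF S x] by simp
    qed
    show "I \<in> {m \<in> carrier M. \<phi> m \<in> supported_tensors S}" using I I_closed by simp
  qed
  then show ?thesis using m by blast
qed

text \<open>The factor is id \<otimes> r after \<phi>. The retraction r does not in general respect
  the action, but the inclusion does, and id \<otimes> r inverts the map induced by the inclusion on
  tensors supported in V; equivariance of \<phi> is thereby reflected to the factor.\<close>

lemma intertwiner_factors:
  assumes S: "stable_generators S" and \<phi>: "\<phi> \<in> lie_hom (lie_alg G) M (lie_tensor M F)"
    and I: "\<phi> I \<in> supported_tensors S"
    and r: "r \<in> linear_maps F (F\<lparr>carrier := lin_span F S\<rparr>)" "\<And>v. v \<in> lin_span F S \<Longrightarrow> r v = v"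
  shows "\<exists>\<phi>'\<in>lie_hom (lie_alg G) M (lie_tensor M (F\<lparr>carrier := lin_span F S\<rparr>)).
    \<forall>m\<in>carrier M. \<phi> m = tensor_map M F (\<lambda>m. m) (\<lambda>v. v) (\<phi>' m)"
proof -
  let ?V = "F\<lparr>carrier := lin_span F S\<rparr>"
  have V: "linear_action (lie_alg G) ?V"
    by (rule lie_module_linear_action[OF stable_generators_submodule(1)[OF S]])
  note vV = linear_actionD(1)[OF V]
  note tMV = tensor_vspace[OF M_vspace vV]
  have inc: "(\<lambda>v. v) \<in> lie_hom (lie_alg G) ?V F"
    by (rule lie_homI, rule linear_mapsI) (use stable_generators_span(2)[OF S] in auto)
  let ?R = "tensor_map M ?V (\<lambda>m. m) r" and ?J = "tensor_map M F (\<lambda>m. m) (\<lambda>v. v)"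
  note Rl = tensor_map_linear[OF M_vspace poly_vspace M_vspace vV lin_id r(1)]
  note Rp = tensor_map_pure[OF M_vspace poly_vspace M_vspace vV lin_id r(1)]
  note Jl = tensor_map_linear[OF M_vspace vV M_vspace poly_vspace lin_id lie_homD(1)[OF inc]]
  note Jp = tensor_map_pure[OF M_vspace vV M_vspace poly_vspace lin_id lie_homD(1)[OF inc]]
  note J = tensor_map_lie_hom[OF M_linear_action V M_linear_action F_linear_action lie_hom_id inc]
  have RJ: "?R (?J T) = T" if "T \<in> carrier (tensor M ?V)" for T
  proof (rule tensor_ext[OF M_vspace vV lin_comp[OF Jl Rl] lin_id _ that])
    fix m v assume m: "m \<in> carrier M" and v: "v \<in> carrier ?V"
    have "v \<in> carrier F" using v stable_generators_span(2)[OF S] by simp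
    then show "?R (?J (pure M ?V m v)) = pure M ?V m v" using r(2)[of v] v by (simp add: Jp[OF m v] Rp[OF m])
  qed
  \<comment> \<open>The fixed points of a linear map are written as a kernel, hence a subspace, so
    the equation needs checking on generators only.\<close>
  have "supported_tensors S \<subseteq> {T \<in> carrier (tensor M F). ?J (?R T) \<ominus>\<^bsub>tensor M F\<^esub> T = \<zero>\<^bsub>tensor M F\<^esub>}"
  proof (rule lin_span_minimal, rule lin_kernel_subspace[OF tensor_MF_vspace tensor_MF_vspace])
    have "(\<lambda>T. ?J (?R T) \<oplus>\<^bsub>tensor M F\<^esub> (-1) \<odot>\<^bsub>tensor M F\<^esub> T) \<in> linear_maps (tensor M F) (tensor M F)"
      by (rule lin_plus[OF tensor_MF_vspace lin_comp[OF Rl Jl] lin_scale[OF tensor_MF_vspace lin_id]])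
    then show "(\<lambda>T. ?J (?R T) \<ominus>\<^bsub>tensor M F\<^esub> T) \<in> linear_maps (tensor M F) (tensor M F)"
      using lin_closed[OF lin_comp[OF Rl Jl]]
      by (simp add: linear_maps_def vs_minus[OF tensor_MF_vspace] vs_closed[OF tensor_MF_vspace])
    show "{pure M F m v | m v. m \<in> carrier M \<and> v \<in> lin_span F S}
        \<subseteq> {T \<in> carrier (tensor M F). ?J (?R T) \<ominus>\<^bsub>tensor M F\<^esub> T = \<zero>\<^bsub>tensor M F\<^esub>}"
    proof
      fix y assume y: "y \<in> {pure M F m v | m v. m \<in> carrier M \<and> v \<in> lin_span F S}"
      then obtain m v where m: "m \<in> carrier M" and v: "v \<in> lin_span F S" and y_eq: "y = pure M F m v" by blast
      have "v \<in> carrier F" "v \<in> carrier ?V" using v stable_generators_span(2)[OF S] by simp_all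
      then have "?J (?R y) = y" using r(2)[OF v] unfolding y_eq by (simp only: Rp[OF m] Jp[OF m])
      moreover have "y \<in> carrier (tensor M F)" using y supported_generators_closed[OF S] by blast
      ultimately show "y \<in> {T \<in> carrier (tensor M F). ?J (?R T) \<ominus>\<^bsub>tensor M F\<^esub> T = \<zero>\<^bsub>tensor M F\<^esub>}"
        by (simp add: vs_minus_eq_zero[OF tensor_MF_vspace])
    qed
  qed
  then have JR: "?J (?R T) = T" if "T \<in> supported_tensors S" for T
    using that vs_minus_eq_zero[OF tensor_MF_vspace lin_closed[OF lin_comp[OF Rl Jl]]] by blast
  have \<phi>l: "\<phi> \<in> linear_maps M (tensor M F)" using lie_homD(1)[OF \<phi>] by simp
  let ?\<phi> = "\<lambda>m. ?R (\<phi> m)"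
  have \<phi>_eq: "\<phi> m = ?J (?\<phi> m)" if "m \<in> carrier M" for m
    using JR[OF intertwiner_support[OF S \<phi> I that]] by simp
  have "?\<phi> \<in> lie_hom (lie_alg G) M (lie_tensor M ?V)"
  proof (rule lie_homI)
    show "?\<phi> \<in> linear_maps M (lie_tensor M ?V)" using lin_comp[OF \<phi>l Rl] by simp
    fix x m assume x: "x \<in> carrier (lie_alg G)" and m: "m \<in> carrier M"
    have c: "?\<phi> m \<in> carrier (tensor M ?V)" by (rule lin_closed[OF lin_comp[OF \<phi>l Rl] m])
    \<comment> \<open>The action is brought down from the larger space: write \<phi> m as the image
      of the factor, carry x through the equivariant inclusion, then cancel the retraction.\<close>
    have "?\<phi> (act M x m) = ?R (act (lie_tensor M F) x (?J (?\<phi> m)))"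
      using lie_homD(2)[OF \<phi> x m] \<phi>_eq[OF m] by simp
    also have "\<dots> = ?R (?J (act (lie_tensor M ?V) x (?\<phi> m)))"
      using lie_homD(2)[OF J x] c by simp
    also have "\<dots> = act (lie_tensor M ?V) x (?\<phi> m)"
      by (rule RJ[OF lin_closed[OF lie_tensor_act_linear[OF M_linear_action V x] c]])
    finally show "?\<phi> (act M x m) = act (lie_tensor M ?V) x (?\<phi> m)" .
  qed
  then show ?thesis using \<phi>_eq by (intro bexI[of _ ?\<phi>]) auto
qed

section \<open>Multiplication of functions as an intertwiner, and the final computation\<close>

lemma mult_bilinear: "(\<lambda>f g. f \<otimes>\<^bsub>F\<^esub> g) \<in> bilinear_maps F F F"
  by (intro bilinear_mapsI linear_mapsI) (auto simp: algebra_simps intro: polynomial_functions.mult)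

text \<open>Equivariance of the multiplication is the Leibniz rule for left-invariant
  derivations.\<close>

lemma mult_map_lie_hom: "mult_map F \<in> lie_hom (lie_alg G) (lie_tensor F F) F"
proof (rule lie_homI)
  note l = tensor_lift_linear[OF poly_vspace poly_vspace poly_vspace mult_bilinear, folded mult_map_def]
  note p = tensor_lift_pure[OF poly_vspace poly_vspace poly_vspace mult_bilinear, folded mult_map_def]
  show "mult_map F \<in> linear_maps (lie_tensor F F) F" using l by simp
  fix x T assume x: "x \<in> carrier (lie_alg G)" and "T \<in> carrier (lie_tensor F F)"
  then have T: "T \<in> carrier (tensor F F)" by simp
  note A = lie_tensor_act_linear[OF F_linear_action F_linear_action x]
  note xF = linear_actionD(2)[OF F_linear_action x]
  show "mult_map F (act (lie_tensor F F) x T) = act F x (mult_map F T)"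
  proof (rule tensor_ext[OF poly_vspace poly_vspace lin_comp[OF A l] lin_comp[OF l xF] _ T])
    fix f g assume f: "f \<in> carrier F" and g: "g \<in> carrier F"
    note xf = lin_closed[OF xF f] and xg = lin_closed[OF xF g]
    have "mult_map F (act (lie_tensor F F) x (pure F F f g)) = act F x f \<otimes>\<^bsub>F\<^esub> g \<oplus>\<^bsub>F\<^esub> f \<otimes>\<^bsub>F\<^esub> act F x g"
      unfolding lie_tensor_act_pure[OF F_linear_action F_linear_action x f g]
        lin_add[OF l pure_closed[OF poly_vspace poly_vspace xf g] pure_closed[OF poly_vspace poly_vspace f xg]]
        p[OF xf g] p[OF f xg] ..
    also have "\<dots> = act F x (f \<otimes>\<^bsub>F\<^esub> g)"
      using left_invariant_mult[of x f g] x f g by simp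
    finally show "mult_map F (act (lie_tensor F F) x (pure F F f g)) = act F x (mult_map F (pure F F f g))"
      by (simp only: p[OF f g])
  qed
qed

theorem leading_term_star_product:
  assumes J: "universal_dynamical_twist TYPE('g \<Rightarrow> complex) (lie_alg G) \<hh> np nm J"
    and \<phi>: "\<phi> \<in> lie_hom (lie_alg G) M (lie_tensor M F)" and \<psi>: "\<psi> \<in> lie_hom (lie_alg G) M (lie_tensor M F)"
  shows "leading_term (lie_alg G) \<hh> np \<Lambda> F (star_product M F \<phi> \<psi>) =
         mult_map F (series_act (lie_alg G) \<hh> F F (J \<Lambda>)
           (pure F F (leading_term (lie_alg G) \<hh> np \<Lambda> F \<phi>) (leading_term (lie_alg G) \<hh> np \<Lambda> F \<psi>)))"
proof -
  have closed: "\<phi> I \<in> carrier (tensor M F)" "\<psi> I \<in> carrier (tensor M F)"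
    using lie_hom_weight(1)[OF F_linear_action] \<phi> \<psi> by blast+
  obtain S1 where S1: "stable_generators S1" "\<phi> I \<in> supported_tensors S1"
    using supported_tensors_exhaust[OF closed(1)] by blast
  obtain S2 where S2: "stable_generators S2" "\<psi> I \<in> supported_tensors S2"
    using supported_tensors_exhaust[OF closed(2)] by blast
  define S where "S = S1 \<union> S2"
  have S: "stable_generators S" unfolding S_def by (rule stable_generators_union[OF S1(1) S2(1)])
  have supp: "\<phi> I \<in> supported_tensors S" "\<psi> I \<in> supported_tensors S"
    using S1(2) S2(2) supported_tensors_mono[of S1 S] supported_tensors_mono[of S2 S] by (auto simp: S_def)
  define V where "V = F\<lparr>carrier := lin_span F S\<rparr>"
  obtain r where r: "r \<in> linear_maps F V" "\<And>v. v \<in> lin_span F S \<Longrightarrow> r v = v"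
    using retraction_exists[OF _ _ _ poly_vspace stable_generators_span(1)[OF S]]
    unfolding V_def by (auto simp: poly_alg_def)
  have V_module: "is_lie_module (lie_alg G) V" "finite_dim V"
    unfolding V_def by (rule stable_generators_submodule[OF S])+
  have V: "linear_action (lie_alg G) V" by (rule lie_module_linear_action[OF V_module(1)])
  have inc: "(\<lambda>v. v) \<in> lie_hom (lie_alg G) V F"
    unfolding V_def
    by (rule lie_homI, rule linear_mapsI) (use stable_generators_span(2)[OF S] in auto)
  let ?L = "lie_alg G" and ?i = "tensor_map M F (\<lambda>m. m) (\<lambda>v. v)" and ?j = "tensor_map F F (\<lambda>v. v) (\<lambda>v. v)"
  obtain \<phi>' where \<phi>': "\<phi>' \<in> lie_hom ?L M (lie_tensor M V)" "\<And>m. m \<in> carrier M \<Longrightarrow> \<phi> m = ?i (\<phi>' m)"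
    using intertwiner_factors[OF S \<phi> supp(1) r[unfolded V_def]] unfolding V_def by blast
  obtain \<psi>' where \<psi>': "\<psi>' \<in> lie_hom ?L M (lie_tensor M V)" "\<And>m. m \<in> carrier M \<Longrightarrow> \<psi> m = ?i (\<psi>' m)"
    using intertwiner_factors[OF S \<psi> supp(2) r[unfolded V_def]] unfolding V_def by blast
  note vV = linear_actionD(1)[OF V] and vF = poly_vspace and incl = lie_homD(1)[OF inc]
  note VV = lie_tensor_linear_action[OF V V] and FF = lie_tensor_linear_action[OF F_linear_action F_linear_action]
  note tVV = tensor_vspace[OF vV vV] and tFF = tensor_vspace[OF vF vF] and tMV = tensor_vspace[OF M_vspace vV]
  note tMF = tensor_MF_vspace
  note j = tensor_map_lie_hom[OF V V F_linear_action F_linear_action inc inc]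
  have jl: "?j \<in> linear_maps (tensor V V) (tensor F F)" using lie_homD(1)[OF j] by simp
  have ml: "mult_map F \<in> linear_maps (tensor F F) F" using lie_homD(1)[OF mult_map_lie_hom] by simp
  note il = tensor_map_linear[OF M_vspace vV M_vspace vF lin_id incl]
  note ip = tensor_map_pure[OF M_vspace vV M_vspace vF lin_id incl]
  let ?mj = "tensor_map M (tensor F F) (\<lambda>m. m) ?j" and ?mm = "tensor_map M F (\<lambda>m. m) (mult_map F)"
  note mjl = tensor_map_linear[OF M_vspace tVV M_vspace tFF lin_id jl]
  note mjp = tensor_map_pure[OF M_vspace tVV M_vspace tFF lin_id jl]
  note assocV = tensor_assoc_linear[OF M_vspace vV vV] and assocF = tensor_assoc_linear[OF M_vspace vF vF]
  \<comment> \<open>The associator is natural in the inclusion. X is an arbitrary tensor because it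
    will be a value of \<phi>'.\<close>
  have assoc_nat: "tensor_assoc M F F (pure (tensor M F) F (?i X) w)
      = ?mj (tensor_assoc M V V (pure (tensor M V) V X w))"
    if X: "X \<in> carrier (tensor M V)" and w: "w \<in> carrier V" for X w
  proof -
    have wF: "w \<in> carrier F" using lin_closed[OF incl w] .
    note pF = bilinear_mapsD(2)[OF pure_bilinear[OF tMF vF] wF] and pV = bilinear_mapsD(2)[OF pure_bilinear[OF tMV vV] w]
    show ?thesis
    proof (rule tensor_ext[OF M_vspace vV lin_comp[OF lin_comp[OF il pF] assocF]
          lin_comp[OF lin_comp[OF pV assocV] mjl] _ X])
      fix a b assume a: "a \<in> carrier M" and b: "b \<in> carrier V"
      have bF: "b \<in> carrier F" using lin_closed[OF incl b] .
      show "tensor_assoc M F F (pure (tensor M F) F (?i (pure M V a b)) w)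
          = ?mj (tensor_assoc M V V (pure (tensor M V) V (pure M V a b) w))"
        by (simp only: ip[OF a b] tensor_assoc_pure[OF M_vspace vF vF a bF wF]
            tensor_assoc_pure[OF M_vspace vV vV a b w] mjp[OF a pure_closed[OF vV vV b w]]
            tensor_map_pure[OF vV vV vF vF incl incl b w])
    qed
  qed
  have \<phi>l: "\<phi> \<in> linear_maps M (tensor M F)" and \<phi>'l: "\<phi>' \<in> linear_maps M (tensor M V)"
    and \<psi>'l: "\<psi>' \<in> linear_maps M (tensor M V)"
    using lie_homD(1)[OF \<phi>] lie_homD(1)[OF \<phi>'(1)] lie_homD(1)[OF \<psi>'(1)] by simp_all
  let ?C = "compose_intertwiners M V V \<phi>' \<psi>' I"
  \<comment> \<open>Equality is claimed at the highest weight vector only, which is where a leading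
    term reads its map.\<close>
  have compose_nat: "compose_intertwiners M F F \<phi> \<psi> I = ?mj ?C"
  proof -
    note fF = tensor_map_linear[OF M_vspace vF tMF vF \<phi>l lin_id]
      and fFp = tensor_map_pure[OF M_vspace vF tMF vF \<phi>l lin_id]
    note fV = tensor_map_linear[OF M_vspace vV tMV vV \<phi>'l lin_id]
      and fVp = tensor_map_pure[OF M_vspace vV tMV vV \<phi>'l lin_id]
    have "tensor_assoc M F F (tensor_map (tensor M F) F \<phi> (\<lambda>w. w) (?i T))
        = ?mj (tensor_assoc M V V (tensor_map (tensor M V) V \<phi>' (\<lambda>w. w) T))"
      if T: "T \<in> carrier (tensor M V)" for T
    proof (rule tensor_ext[OF M_vspace vV lin_comp[OF lin_comp[OF il fF] assocF]
          lin_comp[OF lin_comp[OF fV assocV] mjl] _ T])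
      fix m w assume m: "m \<in> carrier M" and w: "w \<in> carrier V"
      show "tensor_assoc M F F (tensor_map (tensor M F) F \<phi> (\<lambda>w. w) (?i (pure M V m w)))
          = ?mj (tensor_assoc M V V (tensor_map (tensor M V) V \<phi>' (\<lambda>w. w) (pure M V m w)))"
        by (simp only: ip[OF m w] fFp[OF m lin_closed[OF incl w]] fVp[OF m w] \<phi>'(2)[OF m]
            assoc_nat[OF lin_closed[OF \<phi>'l m] w])
    qed
    from this[OF lin_closed[OF \<psi>'l I_closed]] show ?thesis
      by (simp add: compose_intertwiners_def id_def \<psi>'(2)[OF I_closed])
  qed
  note C = compose_intertwiners_lie_hom[OF M_linear_action V V \<phi>'(1) \<psi>'(1)]
  have C_closed: "?C \<in> carrier (tensor M (tensor V V))"
    using lie_hom_weight(1)[OF VV C] by simp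
  have star: "star_product M F \<phi> \<psi> I = ?mm (?mj ?C)"
    by (simp add: star_product_def compose_nat id_def)
  have mj_hom: "?mj \<in> lie_hom ?L (lie_tensor M (lie_tensor V V)) (lie_tensor M (lie_tensor F F))"
    using tensor_map_lie_hom[OF M_linear_action VV M_linear_action FF lie_hom_id j]
    by (simp add: tensor_map_def)
  have mm_hom: "?mm \<in> lie_hom ?L (lie_tensor M (lie_tensor F F)) (lie_tensor M F)"
    by (rule tensor_map_lie_hom[OF M_linear_action FF M_linear_action F_linear_action lie_hom_id mult_map_lie_hom])
  \<comment> \<open>This intertwiner agrees with the star product at the highest weight vector; from
    it the value of the star product there inherits membership in the tensor product and its
    weight.\<close>
  have star_hom: "(\<lambda>m. ?mm (?mj (compose_intertwiners M V V \<phi>' \<psi>' m))) \<in> lie_hom ?L M (lie_tensor M F)"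
    by (rule lie_hom_comp[OF lie_hom_comp[OF C mj_hom] mm_hom])
  have "leading_term ?L \<hh> np \<Lambda> F (star_product M F \<phi> \<psi>) = highest_component F (star_product M F \<phi> \<psi> I)"
    by (rule leading_term_eq[OF F_linear_action])
       (use lie_hom_weight[OF F_linear_action star_hom] star in auto)
  also have "\<dots> = mult_map F (?j (highest_component (lie_tensor V V) ?C))"
  proof -
    have "highest_component F (?mm (?mj ?C)) = mult_map F (highest_component (lie_tensor F F) (?mj ?C))"
      using highest_component_natural[OF FF F_linear_action, of "mult_map F" "?mj ?C"]
        ml lin_closed[OF mjl C_closed] by simp
    moreover have "highest_component (lie_tensor F F) (?mj ?C) = ?j (highest_component (lie_tensor V V) ?C)"
      using highest_component_natural[OF VV FF, of ?j ?C] jl C_closed by (simp add: tensor_map_def)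
    ultimately show ?thesis by (simp add: star)
  qed
  also have "highest_component (lie_tensor V V) ?C
      = leading_term ?L \<hh> np \<Lambda> (lie_tensor V V) (compose_intertwiners M V V \<phi>' \<psi>')"
    by (rule leading_term_lie_hom[OF VV C, symmetric])
  \<comment> \<open>The defining property of the twist applies: V is a finite-dimensional module,
    and its carrier consists of functions on the group, the type at which the twist is
    given.\<close>
  also have "\<dots> = series_act ?L \<hh> V V (J \<Lambda>)
      (pure V V (leading_term ?L \<hh> np \<Lambda> V \<phi>') (leading_term ?L \<hh> np \<Lambda> V \<psi>'))"
    using J V_module \<phi>'(1) \<psi>'(1) \<Lambda> irr
    unfolding universal_dynamical_twist_def Let_def by blast
  also have "?j \<dots> = series_act ?L \<hh> F F (J \<Lambda>)
      (pure F F (leading_term ?L \<hh> np \<Lambda> V \<phi>') (leading_term ?L \<hh> np \<Lambda> V \<psi>'))"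
  \<comment> \<open>The one retraction r splits the inclusion in both factors.\<close>
  proof (rule series_act_natural[OF L V V F_linear_action F_linear_action inc inc r(1) _ r(1)])
    have "twist_series ?L \<hh> np nm (J \<Lambda>)"
      using J \<Lambda> irr unfolding universal_dynamical_twist_def Let_def by blast
    then show "J \<Lambda> \<beta> \<gamma> \<in> carrier (tensor (env ?L) (env ?L))" if "\<beta> \<in> dual ?L \<hh>" "\<gamma> \<in> dual ?L \<hh>" for \<beta> \<gamma>
      using that unfolding twist_series_def Let_def by blast
    show "leading_term ?L \<hh> np \<Lambda> V \<phi>' \<in> carrier V" "leading_term ?L \<hh> np \<Lambda> V \<psi>' \<in> carrier V"
      using leading_term_lie_hom[OF V] lie_hom_weight(1)[OF V] lin_closed[OF highest_component_linear[OF V]]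
        \<phi>'(1) \<psi>'(1) by metis+
  qed (use r(2) in \<open>simp_all add: V_def\<close>)
  \<comment> \<open>By naturality under the inclusion, the leading terms of \<phi>' and \<phi> are
    one and the same function, read in V and in \<open>F\<close>.\<close>
  also have "leading_term ?L \<hh> np \<Lambda> V \<phi>' = leading_term ?L \<hh> np \<Lambda> F \<phi>"
    using leading_term_lie_hom[OF V \<phi>'(1)] leading_term_lie_hom[OF F_linear_action \<phi>]
      highest_component_natural[OF V F_linear_action incl lie_hom_weight(1)[OF V \<phi>'(1)]] \<phi>'(2)[OF I_closed]
    by simp
  also have "leading_term ?L \<hh> np \<Lambda> V \<psi>' = leading_term ?L \<hh> np \<Lambda> F \<psi>"
    using leading_term_lie_hom[OF V \<psi>'(1)] leading_term_lie_hom[OF F_linear_action \<psi>]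
      highest_component_natural[OF V F_linear_action incl lie_hom_weight(1)[OF V \<psi>'(1)]] \<psi>'(2)[OF I_closed]
    by simp
  finally show ?thesis .
qed

end

theorem proposition22:
  fixes G :: "('g, 'n::finite) complex_lie_group" and H :: "'g set"
    and np nm :: "(('g \<Rightarrow> complex) \<Rightarrow> complex) set"
    and J :: "((('g \<Rightarrow> complex) \<Rightarrow> complex) \<Rightarrow> complex) \<Rightarrow> (('g \<Rightarrow> complex) \<Rightarrow> complex) env2_series"
    and \<Lambda> :: "(('g \<Rightarrow> complex) \<Rightarrow> complex) \<Rightarrow> complex"
  defines "L \<equiv> lie_alg G" and "\<hh> \<equiv> lie_of_subgroup G H" and "F \<equiv> poly_alg G"
    and "M \<equiv> verma (lie_alg G) (lie_of_subgroup G H) np \<Lambda>"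
  assumes "simple_complex_lie_group G"
    and "cartan_subgroup G H"
    and "triangular_decomposition L \<hh> np nm"
    and "universal_dynamical_twist TYPE('g \<Rightarrow> complex) L \<hh> np nm J"
    and "\<Lambda> \<in> dual L \<hh>"
    and "irreducible_module L M"
    and "\<phi> \<in> lie_hom L M (lie_tensor M F)"
    and "\<psi> \<in> lie_hom L M (lie_tensor M F)"
  shows "leading_term L \<hh> np \<Lambda> F (star_product M F \<phi> \<psi>) =
         mult_map F (series_act L \<hh> F F (J \<Lambda>)
           (pure F F (leading_term L \<hh> np \<Lambda> F \<phi>) (leading_term L \<hh> np \<Lambda> F \<psi>)))"
proof -
  \<comment> \<open>That the point derivations form a Lie algebra is contained in the simplicity
    assumption on \<open>lie_alg G\<close>.\<close>
  have G: "is_complex_lie_group G" "is_lie_algebra (lie_alg G)"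
    using assms(5) by (simp_all add: simple_complex_lie_group_def simple_lie_algebra_def)
  have "lie_of_subgroup G H \<subseteq> carrier (lie_alg G)" by (auto simp: lie_of_subgroup_def)
  then interpret lie_group_verma G "lie_of_subgroup G H" np nm \<Lambda>
    using assms(7,9,10) G unfolding L_def \<hh>_def M_def by unfold_locales
  show ?thesis
    using leading_term_star_product assms(8,11,12) unfolding L_def \<hh>_def F_def M_def by blast
qed

end
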